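(* Let $\mathcal A$ be an essential arrangement of $d$ lines in $\mathbb P^2_k$, $d$ odd, that is free with $\mathcal D_{\mathcal A}\simeq\mathcal O_{\mathbb P^2}\!\left(-\frac{d-1}{2}\right)^2$. Let $\mathcal B$ be an arrangement of lines in $\mathbb P^2_k$ whose intersection lattice is isomorphic to that of $\mathcal A$ and which is a counterexample to Terao's conjecture, i.e. $D(\mathcal B)$ is not free. Then $\mathcal B$ must have a syzygy of degree $<\frac{d-1}{2}$ and also a syzygy of degree $>\frac{d-1}{2}$; that is, a minimal homogeneous generating set of $D_0(\mathcal B)$ contains an element of degree $<\frac{d-1}{2}$ and an element of degree $>\frac{d-1}{2}$.
   Context: $k$ is a field of characteristic $0$, $R=k[x_0,x_1,x_2]$. An arrangement $\mathcal A$ of $d$ lines in $\mathbb P^2_k$ is a set of $d$ distinct lines, equivalently a central arrangement of $d$ planes in $k^3$, with defining polynomial $Q\in R_d$ the product of the $d$ linear forms; it is essential if the lines do not all pass through one point. $D(\mathcal A)=\{\theta\in\mathrm{Der}_k(R):\theta(Q)\in\langle Q\rangle\}$, graded by $\deg(\sum f_i\,\partial/\partial x_i)=\deg f_i$; $\mathcal A$ is free if $D(\mathcal A)$ is a free $R$-module. $D(\mathcal A)=D_0(\mathcal A)\oplus R\theta_E$, where $\theta_E=\sum x_i\,\partial/\partial x_i$ and $D_0(\mathcal A)=\{\theta:\theta(Q)=0\}$ is the module of syzygies on the partial derivatives of $Q$ (the generators of the Jacobian ideal). $\mathcal D_{\mathcal A}$ is the rank two bundle on $\mathbb P^2$ associated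 to $D_0(\mathcal A)$. The intersection lattice consists of all intersections of the planes of the arrangement in $k^3$, ordered by reverse inclusion. Terao's conjecture: in characteristic zero, freeness of $D(\mathcal A)$ depends only on the isomorphism class of the intersection lattice. The degree of a syzygy is its degree as an element of $D_0$. *)

theory Defs
  imports
    "HOL-Analysis.Finite_Cartesian_Product"
    "HOL-Library.Poly_Mapping"
    "HOL-Library.Function_Algebras"
    "HOL-Computational_Algebra.Fraction_Field"
begin

section \<open>The graded ring \<open>R = k[x\<^sub>0, x\<^sub>1, x\<^sub>2]\<close>\<close>

text \<open>A polynomial maps exponent vectors to coefficients; the multiplication of
  \<^theory>\<open>HOL-Library.Poly_Mapping\<close> is convolution.\<close>

type_synonym 'k poly3 = "(3 \<Rightarrow>\<^sub>0 nat) \<Rightarrow>\<^sub>0 'k"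

definition Var :: "3 \<Rightarrow> 'k::field_char_0 poly3" where
  "Var i = Poly_Mapping.single (Poly_Mapping.single i 1) 1"

definition Const :: "'k::field_char_0 \<Rightarrow> 'k poly3" where
  "Const c = Poly_Mapping.single 0 c"

text \<open>The zero polynomial is homogeneous of every degree.\<close>

definition homogeneous :: "nat \<Rightarrow> 'k::field_char_0 poly3 \<Rightarrow> bool" where
  "homogeneous m p \<longleftrightarrow>
     (\<forall>t \<in> Poly_Mapping.keys p. (\<Sum>i\<in>UNIV. Poly_Mapping.lookup t i) = m)"


section \<open>Modules of functions\<close>

text \<open>Derivations are functions \<open>R \<Rightarrow> R\<close>, with pointwise addition and
  the following scalar multiplication.\<close>

definition pscale :: "'a::comm_ring_1 \<Rightarrow> ('b \<Rightarrow> 'a) \<Rightarrow> ('b \<Rightarrow> 'a)" where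
  "pscale r s = (\<lambda>x. r * s x)"

global_interpretation pmod: module "pscale :: 'a::comm_ring_1 \<Rightarrow> ('b \<Rightarrow> 'a) \<Rightarrow> ('b \<Rightarrow> 'a)"
  by unfold_locales (auto simp: pscale_def fun_eq_iff algebra_simps)

definition free_module :: "('b \<Rightarrow> 'a::comm_ring_1) set \<Rightarrow> bool" where
  "free_module M \<longleftrightarrow> (\<exists>S. pmod.independent S \<and> pmod.span S = M)"


section \<open>Line arrangements and their intersection lattices\<close>

text \<open>Lines of \<open>\<P>\<^sup>2\<close> over \<open>k\<close> are represented by the corresponding planes
  through the origin of \<open>k\<^sup>3\<close>.\<close>

definition plane :: "'k::field_char_0 ^ 3 \<Rightarrow> ('k ^ 3) set" where
  "plane a = {v. (\<Sum>i\<in>UNIV. a $ i * v $ i) = 0}"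

definition arrangement :: "('k::field_char_0 ^ 3) set set \<Rightarrow> bool" where
  "arrangement A \<longleftrightarrow> finite A \<and> (\<forall>H\<in>A. \<exists>a. a \<noteq> 0 \<and> H = plane a)"

text \<open>The points of \<open>\<P>\<^sup>2\<close> over \<open>k\<close> are given by the nonzero vectors of \<open>k\<^sup>3\<close>.\<close>

definition essential :: "('k::field_char_0 ^ 3) set set \<Rightarrow> bool" where
  "essential A \<longleftrightarrow> \<not> (\<exists>v. v \<noteq> 0 \<and> (\<forall>H\<in>A. v \<in> H))"

text \<open>The empty intersection, which is all of \<open>k\<^sup>3\<close>, is the least element of the lattice.\<close>

definition intersection_lattice :: "('k::field_char_0 ^ 3) set set \<Rightarrow> ('k ^ 3) set set" where
  "intersection_lattice A = {\<Inter>S | S. S \<subseteq> A}"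

definition lattice_iso ::
    "('k::field_char_0 ^ 3) set set \<Rightarrow> ('k ^ 3) set set \<Rightarrow> bool" where
  "lattice_iso A B \<longleftrightarrow>
     (\<exists>\<phi>. bij_betw \<phi> (intersection_lattice A) (intersection_lattice B) \<and>
          (\<forall>X\<in>intersection_lattice A. \<forall>Y\<in>intersection_lattice A.
             X \<supseteq> Y \<longleftrightarrow> \<phi> X \<supseteq> \<phi> Y))"

definition linear_form :: "'k::field_char_0 ^ 3 \<Rightarrow> 'k poly3" where
  "linear_form a = (\<Sum>i\<in>UNIV. Const (a $ i) * Var i)"

text \<open>The linear form of a plane, hence also the defining polynomial, is determined only
  up to a nonzero constant, on which the modules below do not depend.\<close>

definition plane_form :: "('k::field_char_0 ^ 3) set \<Rightarrow> 'k poly3" where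
  "plane_form H = linear_form (SOME a. a \<noteq> 0 \<and> H = plane a)"

definition defining_poly :: "('k::field_char_0 ^ 3) set set \<Rightarrow> 'k poly3" where
  "defining_poly A = (\<Prod>H\<in>A. plane_form H)"


section \<open>Derivations\<close>

definition Der :: "('k::field_char_0 poly3 \<Rightarrow> 'k poly3) set" where
  "Der = {\<theta>. (\<forall>p q. \<theta> (p + q) = \<theta> p + \<theta> q) \<and>
              (\<forall>c p. \<theta> (Const c * p) = Const c * \<theta> p) \<and>
              (\<forall>p q. \<theta> (p * q) = \<theta> p * q + p * \<theta> q)}"

text \<open>The coefficients of \<open>\<theta> = \<Sum> f\<^sub>i \<partial>/\<partial>x\<^sub>i\<close> are \<open>f\<^sub>i = \<theta>(x\<^sub>i)\<close>.\<close>

definition der_homogeneous :: "nat \<Rightarrow> ('k::field_char_0 poly3 \<Rightarrow> 'k poly3) \<Rightarrow> bool" where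
  "der_homogeneous m \<theta> \<longleftrightarrow> (\<forall>i. homogeneous m (\<theta> (Var i)))"

definition D :: "('k::field_char_0 ^ 3) set set \<Rightarrow> ('k poly3 \<Rightarrow> 'k poly3) set" where
  "D A = {\<theta> \<in> Der. defining_poly A dvd \<theta> (defining_poly A)}"

definition D0 :: "('k::field_char_0 ^ 3) set set \<Rightarrow> ('k poly3 \<Rightarrow> 'k poly3) set" where
  "D0 A = {\<theta> \<in> Der. \<theta> (defining_poly A) = 0}"

definition homogeneous_generating_set ::
    "('k::field_char_0 poly3 \<Rightarrow> 'k poly3) set \<Rightarrow> ('k poly3 \<Rightarrow> 'k poly3) set \<Rightarrow> bool" where
  "homogeneous_generating_set M G \<longleftrightarrow>
     (\<forall>\<theta>\<in>G. \<exists>m. der_homogeneous m \<theta>) \<and> pmod.span G = M"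

definition minimal_homogeneous_generating_set ::
    "('k::field_char_0 poly3 \<Rightarrow> 'k poly3) set \<Rightarrow> ('k poly3 \<Rightarrow> 'k poly3) set \<Rightarrow> bool" where
  "minimal_homogeneous_generating_set M G \<longleftrightarrow>
     homogeneous_generating_set M G \<and> (\<forall>G'. G' \<subset> G \<longrightarrow> \<not> homogeneous_generating_set M G')"


section \<open>Sheaves on \<open>\<P>\<^sup>2\<close>\<close>

text \<open>A sheaf on \<open>\<P>\<^sup>2 = Proj R\<close> is determined by its sections over the basic open sets
  \<open>D\<^sub>+(f)\<close>, \<open>f\<close> homogeneous of positive degree, and morphisms of sheaves correspond to
  families of maps on these sections compatible with restriction.  The sheaf associated to a
  graded module \<open>M\<close> has the degree zero part of the localization \<open>M\<^sub>f\<close> as its sections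
  over \<open>D\<^sub>+(f)\<close>.  For a submodule \<open>M\<close> of the functions \<open>'i \<Rightarrow> R\<close>
  these sections are functions from \<open>'i\<close> to the fraction field of \<open>R\<close>, and the restriction
  maps are inclusions.\<close>

definition basic_open :: "'k::field_char_0 poly3 \<Rightarrow> bool" where
  "basic_open f \<longleftrightarrow> f \<noteq> 0 \<and> (\<exists>r>0. homogeneous r f)"

text \<open>\<open>D\<^sub>+(g) \<subseteq> D\<^sub>+(f)\<close> holds iff \<open>g\<close> lies in the radical of \<open>(f)\<close>.\<close>

definition basic_open_le :: "'k::field_char_0 poly3 \<Rightarrow> 'k poly3 \<Rightarrow> bool" where
  "basic_open_le g f \<longleftrightarrow> (\<exists>n. f dvd g ^ n)"

text \<open>The sections of the twisting sheaf \<open>\<O>(n)\<close> over \<open>D\<^sub>+(f)\<close>, i.e. the degree \<open>n\<close>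
  part of \<open>R\<^sub>f\<close>; those of the structure sheaf are obtained for \<open>n = 0\<close>.\<close>

definition twist :: "int \<Rightarrow> 'k::field_char_0 poly3 \<Rightarrow> 'k poly3 fract set" where
  "twist n f = {Fract g (f ^ j) | g j.
     \<exists>r m. homogeneous r f \<and> homogeneous m g \<and> int m = n + int (j * r)}"

definition twist_sq :: "int \<Rightarrow> 'k::field_char_0 poly3 \<Rightarrow> (2 \<Rightarrow> 'k poly3 fract) set" where
  "twist_sq n f = {s. \<forall>i. s i \<in> twist n f}"

text \<open>The bundle associated to \<open>D\<^sub>0\<close>: its sections over \<open>D\<^sub>+(f)\<close> are the \<open>\<theta> / f\<^sup>j\<close>
  with \<open>\<theta>\<close> homogeneous of the same degree as \<open>f\<^sup>j\<close>.\<close>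

definition der_bundle ::
    "('k::field_char_0 ^ 3) set set \<Rightarrow> 'k poly3 \<Rightarrow> ('k poly3 \<Rightarrow> 'k poly3 fract) set" where
  "der_bundle A f = {(\<lambda>p. Fract (\<theta> p) (f ^ j)) | \<theta> j.
     \<theta> \<in> D0 A \<and> (\<exists>r. homogeneous r f \<and> der_homogeneous (j * r) \<theta>)}"

definition sheaf_iso ::
    "('k::field_char_0 poly3 \<Rightarrow> ('i \<Rightarrow> 'k poly3 fract) set) \<Rightarrow>
     ('k poly3 \<Rightarrow> ('j \<Rightarrow> 'k poly3 fract) set) \<Rightarrow> bool" where
  "sheaf_iso F G \<longleftrightarrow> (\<exists>\<phi>.
     (\<forall>f. basic_open f \<longrightarrow>
        bij_betw (\<phi> f) (F f) (G f) \<and>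
        (\<forall>s\<in>F f. \<forall>t\<in>F f. \<phi> f (s + t) = \<phi> f s + \<phi> f t) \<and>
        (\<forall>a\<in>twist 0 f. \<forall>s\<in>F f. \<phi> f (pscale a s) = pscale a (\<phi> f s))) \<and>
     (\<forall>f g. basic_open f \<longrightarrow> basic_open g \<longrightarrow> basic_open_le g f \<longrightarrow>
        (\<forall>s\<in>F f. \<phi> g s = \<phi> f s)))"

end

theory Submission
  imports Defs "HOL-Analysis.Cartesian_Space" "Berlekamp_Zassenhaus.Unique_Factorization_Poly"
begin

text \<open>
  Let \<open>e = (d - 1) / 2\<close>, let \<open>M\<close> be the graded module \<open>D\<^sub>0(\<B>)\<close> and \<open>h(m)\<close> the dimension of \<open>M\<^sub>m\<close>.
  Adding a line \<open>H\<close> with form \<open>\<alpha>\<close> to an arrangement of \<open>c\<close> lines that meet \<open>H\<close> in \<open>n\<close> points replaces the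
  module of derivations by the kernel of \<open>\<theta> \<mapsto> \<theta>(\<alpha>) mod \<alpha>\<close>, whose image is, in large degrees, generated by
  one form of degree \<open>c - n\<close>.  Hence \<open>h(m)\<close> for large \<open>m\<close> depends only on the intersection lattice, and
  comparison with \<open>D\<^sub>0(\<A>)\<close>, which contains a copy of \<open>R(-e)\<^sup>2\<close>, shows that
  \<open>h(m) = 2 dim R\<^bsub>m-e\<^esub> + \<kappa>\<close> with a constant \<open>\<kappa> \<ge> 0\<close>.

  Suppose that \<open>M\<close> vanishes in degrees below \<open>e\<close>, and let \<open>b\<close> be the least degree such that \<open>M\<close> contains two
  independent elements of degree at most \<open>b\<close>.  Cutting with two linear forms through a general point
  shows that the second difference of \<open>h\<close> is at least \<open>2\<close> from \<open>b\<close> on, so that \<open>h(m) - 2 dim R\<^bsub>m-e\<^esub>\<close> is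
  convex and eventually constant, and therefore at least \<open>\<kappa> \<ge> 0\<close> for \<open>m = b - 1\<close>.  But in degrees below \<open>b\<close>
  the module has rank one, hence \<open>h(b - 1) \<le> dim R\<^bsub>b-1-e\<^esub>\<close> by unique factorization.  This forces \<open>b = e\<close>,
  and two independent elements of degree \<open>e\<close> together with the Euler derivation are a basis of \<open>D(\<B>)\<close> by
  Saito's criterion.  So a non-free \<open>\<B>\<close> has a syzygy \<open>\<eta>\<close> of degree less than \<open>e\<close>.  If all generators had
  degree at most \<open>e\<close>, then \<open>det(\<theta>\<^sub>E, \<eta>, \<theta>)\<close>, being divisible by \<open>Q\<close> and of degree less than \<open>d\<close>, would vanish
  for every generator \<open>\<theta>\<close>, which is impossible because \<open>M\<close> has rank two.
\<close>

section \<open>Polynomials in three variables\<close>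

text \<open>The lattice controls h(m) only in large degrees, because the image of theta ->
  theta(alpha) is known only where a form can be prescribed at all n points on H. The statement to
  be proved concerns small degrees. Convexity bridges the gap: nondecreasing differences that end at
  0 are nonpositive before, so the eventual value kappa bounds h(m) - 2 dim R_{m-e} from below all
  the way down to m = b - 1. In terms of bundles kappa is e^2 - c_2; here it occurs only as the
  constant term of a Hilbert function, and only its sign enters, supplied by two global sections
  obtained from the splitting of the bundle of A. All points that occur are rational: those on H are
  intersections of planes over k, and the general point exists because k is infinite. Derivations
  are handled through their coefficient vectors, so that graded pieces become subspaces of the
  finite-dimensional spaces of triples of forms.\<close>

abbreviation "lookup \<equiv> Poly_Mapping.lookup"
abbreviation "keys \<equiv> Poly_Mapping.keys"
abbreviation "single \<equiv> Poly_Mapping.single"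

lemma sum_single: "(\<Sum>t\<in>keys p. single t (lookup p t)) = p"
proof (rule poly_mapping_eqI)
  fix s
  have "lookup (\<Sum>t\<in>keys p. single t (lookup p t)) s = (\<Sum>t\<in>keys p. if t = s then lookup p t else 0)"
    by (simp add: lookup_sum lookup_single when_def)
  also have "\<dots> = lookup p s"
    by (simp add: sum.delta' in_keys_iff)
  finally show "lookup (\<Sum>t\<in>keys p. single t (lookup p t)) s = lookup p s" .
qed

lemma poly_mapping_single_induct:
  fixes p :: "'a \<Rightarrow>\<^sub>0 'b::comm_monoid_add"
  assumes "\<And>t c. t \<in> keys p \<Longrightarrow> P (single t c)" "P 0" "\<And>p q. P p \<Longrightarrow> P q \<Longrightarrow> P (p + q)"
  shows "P p"
proof -
  have "finite S \<Longrightarrow> S \<subseteq> keys p \<Longrightarrow> P (\<Sum>t\<in>S. single t (lookup p t))" for S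
    by (induction S rule: finite_induct) (auto intro: assms)
  from this[of "keys p"] show ?thesis by (simp add: sum_single)
qed

definition tdeg :: "(3 \<Rightarrow>\<^sub>0 nat) \<Rightarrow> nat" where
  "tdeg t = (\<Sum>i\<in>UNIV. lookup t i)"

lemma tdeg_add: "tdeg (s + t) = tdeg s + tdeg t"
  by (simp add: tdeg_def lookup_add sum.distrib)

lemma tdeg_single [simp]: "tdeg (single i n) = n"
  by (simp add: tdeg_def lookup_single when_def)

lemma tdeg_eq_0_iff [simp]: "tdeg t = 0 \<longleftrightarrow> t = 0"
  by (auto simp: tdeg_def poly_mapping_eq_iff fun_eq_iff)

lemma homogeneous_tdeg: "homogeneous m p \<longleftrightarrow> (\<forall>t\<in>keys p. tdeg t = m)"
  by (simp add: homogeneous_def tdeg_def)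

lemma homogeneous_0 [simp]: "homogeneous m 0"
  by (simp add: homogeneous_def)

lemma homogeneous_single [simp]: "homogeneous m (single t c) \<longleftrightarrow> tdeg t = m \<or> c = 0"
  by (simp add: homogeneous_tdeg)

lemma homogeneous_Const [simp]: "homogeneous 0 (Const c)"
  by (simp add: Const_def)

lemma homogeneous_1 [simp]: "homogeneous 0 1"
  using homogeneous_Const[of 1] by (simp add: Const_def)

lemma homogeneous_Var [simp]: "homogeneous (Suc 0) (Var i)"
  by (simp add: Var_def)

lemma homogeneous_add: "homogeneous m p \<Longrightarrow> homogeneous m q \<Longrightarrow> homogeneous m (p + q)"
  using keys_add[of p q] by (auto simp: homogeneous_tdeg)

lemma homogeneous_uminus [simp]: "homogeneous m (- p) \<longleftrightarrow> homogeneous m p"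
  by (auto simp: homogeneous_tdeg in_keys_iff)

lemma homogeneous_diff: "homogeneous m p \<Longrightarrow> homogeneous m q \<Longrightarrow> homogeneous m (p - q)"
  using homogeneous_add[of m p "- q"] by simp

lemma homogeneous_mult: "homogeneous m p \<Longrightarrow> homogeneous n q \<Longrightarrow> homogeneous (m + n) (p * q)"
  using keys_mult[of p q] by (auto simp: homogeneous_tdeg tdeg_add)

lemma homogeneous_Const_mult: "homogeneous m p \<Longrightarrow> homogeneous m (Const c * p)"
  using homogeneous_mult[of 0 "Const c" m p] by simp

lemma homogeneous_sum: "(\<And>x. x \<in> S \<Longrightarrow> homogeneous m (f x)) \<Longrightarrow> homogeneous m (sum f S)"
  by (induction S rule: infinite_finite_induct) (auto intro: homogeneous_add)

lemma homogeneous_prod: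
  "(\<And>x. x \<in> S \<Longrightarrow> homogeneous (n x) (f x)) \<Longrightarrow> homogeneous (sum n S) (prod f S)"
  by (induction S rule: infinite_finite_induct) (auto intro: homogeneous_mult)

lemma homogeneous_power: "homogeneous m p \<Longrightarrow> homogeneous (n * m) (p ^ n)"
  by (induction n) (auto intro: homogeneous_mult)

lemma Const_0 [simp]: "Const 0 = 0" and Const_1 [simp]: "Const 1 = 1"
  by (simp_all add: Const_def)

lemma Const_add: "Const (a + b) = Const a + Const b"
  by (simp add: Const_def single_add)

lemma Const_mult: "Const (a * b) = Const a * Const b"
  by (simp add: Const_def mult_single)

lemma Const_uminus: "Const (- a) = - Const a"
  by (simp add: Const_def single_uminus)

lemma Const_diff: "Const (a - b) = Const a - Const b"
  by (simp add: Const_def single_diff)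

lemma Const_of_nat: "Const (of_nat n) = of_nat n"
  by (simp add: Const_def)

lemma Const_prod: "Const (prod f S) = (\<Prod>x\<in>S. Const (f x))"
  by (induction S rule: infinite_finite_induct) (simp_all add: Const_mult)

lemma Const_eq_iff [simp]: "Const a = Const b \<longleftrightarrow> a = b"
  unfolding Const_def by (metis lookup_single_eq)

lemma Const_eq_0_iff [simp]: "Const a = 0 \<longleftrightarrow> a = 0"
  using Const_eq_iff[of a 0] by (simp del: Const_eq_iff)

lemma Const_inverse: "c \<noteq> 0 \<Longrightarrow> Const (inverse c) * Const c = 1"
  by (simp flip: Const_mult)

lemma homogeneous_0_iff: "homogeneous 0 p \<longleftrightarrow> (\<exists>c. p = Const c)"
proof
  assume "homogeneous 0 p"
  then have "keys p \<subseteq> {0}" by (auto simp: homogeneous_tdeg)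
  then have "p = Const (lookup p 0)"
    by (intro poly_mapping_eqI) (auto simp: Const_def lookup_single when_def in_keys_iff)
  then show "\<exists>c. p = Const c" by blast
qed auto

lemma Var_neq_0 [simp]: "Var i \<noteq> 0"
  unfolding Var_def by (metis lookup_single_eq lookup_zero zero_neq_one)

lemma Const_mult_single: "Const a * single t c = single t (a * c)"
  by (simp add: Const_def mult_single)

lemma single_Var_mult:
  assumes "lookup t i > 0"
  shows "single t c = Var i * single (t - single i 1) c"
proof -
  have "t = single i 1 + (t - single i 1)"
    using assms by (intro poly_mapping_eqI) (auto simp: lookup_add lookup_minus lookup_single when_def)
  then show ?thesis by (simp add: Var_def mult_single)
qed

lemma single_homogeneous_induct:
  assumes C: "\<And>c. P 0 (Const c)"
    and M: "\<And>n i q. homogeneous n q \<Longrightarrow> P n q \<Longrightarrow> P (Suc n) (Var i * q)"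
  shows "P (tdeg t) (single t c)"
proof (induction "tdeg t" arbitrary: t)
  case 0
  then have "t = 0" by simp
  then show ?case using C by (simp add: Const_def tdeg_def)
next
  case (Suc n)
  then obtain i where i: "lookup t i > 0"
    unfolding tdeg_def by (metis gr0I sum.neutral nat.distinct(1))
  have t: "t = single i 1 + (t - single i 1)"
    using i by (intro poly_mapping_eqI) (auto simp: lookup_add lookup_minus lookup_single when_def)
  have "tdeg t = 1 + tdeg (t - single i 1)"
    by (subst t) (simp add: tdeg_add)
  with Suc(2) have n: "n = tdeg (t - single i 1)" by simp
  have "P (Suc n) (Var i * single (t - single i 1) c)"
    by (intro M) (use Suc(1)[OF n] n in auto)
  then show ?case using Suc(2) single_Var_mult[OF i, of c] by simp
qed

lemma homogeneous_induct [consumes 1, case_names Const add Var]: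
  assumes "homogeneous n p"
    and C: "\<And>c. P 0 (Const c)"
    and A: "\<And>n p q. homogeneous n p \<Longrightarrow> homogeneous n q \<Longrightarrow> P n p \<Longrightarrow> P n q \<Longrightarrow> P n (p + q)"
    and M: "\<And>n i q. homogeneous n q \<Longrightarrow> P n q \<Longrightarrow> P (Suc n) (Var i * q)"
  shows "P n p"
proof -
  \<comment> \<open>Zero is homogeneous of every degree, so it has to be reached in degree n:
    multiply \<open>Const 0\<close> by n variables.\<close>
  have 0: "P n 0" for n
    by (induction n) (use C[of 0] M[of _ 0] in auto)
  have "homogeneous n p \<and> P n p"
  proof (rule poly_mapping_single_induct[of p "\<lambda>p. homogeneous n p \<and> P n p"])
    show "homogeneous n (single t c) \<and> P n (single t c)" if "t \<in> keys p" for t c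
      using single_homogeneous_induct[of P, OF C M, of t c] that assms(1) by (auto simp: homogeneous_tdeg)
  qed (auto intro: 0 A homogeneous_add)
  then show ?thesis ..
qed

lemma poly3_induct [case_names Const Var add mult]:
  assumes C: "\<And>c. P (Const c)" and V: "\<And>i. P (Var i)"
    and A: "\<And>p q. P p \<Longrightarrow> P q \<Longrightarrow> P (p + q)"
    and M: "\<And>p q. P p \<Longrightarrow> P q \<Longrightarrow> P (p * q)"
  shows "P p"
proof (rule poly_mapping_single_induct[of p P])
  show "P (single t c)" for t c
    using single_homogeneous_induct[of "\<lambda>_. P", OF C M[OF V]] by simp
  show "P 0" using C[of 0] by simp
qed (auto intro: A)

subsection \<open>Homogeneous components\<close>

definition hc :: "nat \<Rightarrow> 'k::field_char_0 poly3 \<Rightarrow> 'k poly3" where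
  "hc n p = (\<Sum>t\<in>{t \<in> keys p. tdeg t = n}. single t (lookup p t))"

lemma lookup_hc: "lookup (hc n p) t = (if tdeg t = n then lookup p t else 0)"
proof -
  have "lookup (hc n p) t = (\<Sum>s\<in>{s \<in> keys p. tdeg s = n}. if s = t then lookup p s else 0)"
    by (simp add: hc_def lookup_sum lookup_single when_def)
  then show ?thesis by (simp add: sum.delta' in_keys_iff)
qed

lemma homogeneous_hc [simp]: "homogeneous n (hc n p)"
  by (auto simp: homogeneous_tdeg in_keys_iff lookup_hc split: if_splits)

lemma hc_0 [simp]: "hc n 0 = 0"
  by (intro poly_mapping_eqI) (simp add: lookup_hc)

lemma hc_add: "hc n (p + q) = hc n p + hc n q"
  by (intro poly_mapping_eqI) (simp add: lookup_hc lookup_add)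

lemma hc_sum: "hc n (sum f S) = (\<Sum>x\<in>S. hc n (f x))"
  by (induction S rule: infinite_finite_induct) (simp_all add: hc_add)

lemma hc_homogeneous: "homogeneous n p \<Longrightarrow> hc m p = (if m = n then p else 0)"
  by (intro poly_mapping_eqI) (auto simp: lookup_hc homogeneous_tdeg in_keys_iff)

lemma sum_hc: "(\<Sum>n\<in>tdeg ` keys p. hc n p) = p"
  by (intro poly_mapping_eqI) (auto simp: lookup_sum lookup_hc in_keys_iff)

lemma hc_eq_0: "n \<notin> tdeg ` keys p \<Longrightarrow> hc n p = 0"
  by (intro poly_mapping_eqI) (auto simp: lookup_hc in_keys_iff)

lemma eq_0_if_hc: "(\<And>n. hc n p = 0) \<Longrightarrow> p = 0"
  using sum_hc[of p] by simp

lemma hc_mult_left: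
  assumes "homogeneous i a"
  shows "hc n (a * q) = (if i \<le> n then a * hc (n - i) q else 0)"
proof -
  let ?J = "tdeg ` keys q"
  have "hc n (a * q) = hc n (a * (\<Sum>j\<in>?J. hc j q))" by (simp add: sum_hc)
  also have "\<dots> = (\<Sum>j\<in>?J. hc n (a * hc j q))" by (simp add: sum_distrib_left hc_sum)
  also have "\<dots> = (\<Sum>j\<in>?J. if i + j = n then a * hc j q else 0)"
    by (intro sum.cong refl, subst hc_homogeneous[OF homogeneous_mult[OF assms homogeneous_hc]]) auto
  also have "\<dots> = (if i \<le> n then a * hc (n - i) q else 0)"
  proof (cases "i \<le> n")
    case True
    then have "(\<Sum>j\<in>?J. if i + j = n then a * hc j q else 0) = (\<Sum>j\<in>?J. if n - i = j then a * hc j q else 0)"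
      by (intro sum.cong) auto
    also have "\<dots> = a * hc (n - i) q"
      by (auto simp: hc_eq_0)
    finally show ?thesis using True by simp
  next
    case False
    then show ?thesis by (intro trans[OF sum.neutral]) auto
  qed
  finally show ?thesis .
qed

text \<open>The top degrees of two nonzero factors add up.\<close>

lemma homogeneous_factor_const:
  assumes pq: "homogeneous a (p * q)" and n: "hc n q \<noteq> 0" "a \<le> n"
    and p: "p \<noteq> 0"
  shows "\<exists>c. p = Const c"
proof -
  define t where "t = Max (tdeg ` keys p)"
  define l where "l = Max (tdeg ` keys q)"
  have kp: "keys p \<noteq> {}" and kq: "keys q \<noteq> {}" using p n by (auto simp: keys_eq_empty)
  have t: "t \<in> tdeg ` keys p" and tm: "\<And>s. s \<in> keys p \<Longrightarrow> tdeg s \<le> t"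
    unfolding t_def using kp by (auto intro!: Max_in)
  have l: "l \<in> tdeg ` keys q" and lm: "\<And>s. s \<in> keys q \<Longrightarrow> tdeg s \<le> l"
    unfolding l_def using kq by (auto intro!: Max_in)
  have "hc (t + l) (p * q) = hc (t + l) ((\<Sum>j\<in>tdeg ` keys p. hc j p) * q)" by (simp add: sum_hc)
  also have "\<dots> = (\<Sum>j\<in>tdeg ` keys p. hc (t + l) (hc j p * q))" by (simp add: sum_distrib_right hc_sum)
  also have "\<dots> = (\<Sum>j\<in>tdeg ` keys p. if j = t then hc t p * hc l q else 0)"
  proof (intro sum.cong refl)
    fix j assume "j \<in> tdeg ` keys p"
    then have j: "j \<le> t" using tm by auto
    show "hc (t + l) (hc j p * q) = (if j = t then hc t p * hc l q else 0)"
    proof (cases "j = t")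
      case False
      then have "t + l - j > l" using j by simp
      then have "t + l - j \<notin> tdeg ` keys q" using lm by fastforce
      then show ?thesis using False by (simp add: hc_mult_left[OF homogeneous_hc] hc_eq_0)
    qed (simp add: hc_mult_left[OF homogeneous_hc])
  qed
  also have "\<dots> = hc t p * hc l q" using t by simp
  finally have e: "hc (t + l) (p * q) = hc t p * hc l q" .
  have nz: "hc n p \<noteq> 0" if "n \<in> tdeg ` keys p" for n and p :: "'a poly3"
  proof -
    from that obtain s where "s \<in> keys p" "tdeg s = n" by auto
    then have "lookup (hc n p) s \<noteq> 0" by (simp add: lookup_hc in_keys_iff)
    then show ?thesis by (metis lookup_zero)
  qed
  have "hc (t + l) (p * q) \<noteq> 0" using e nz t l by simp
  then have "t + l = a" using hc_homogeneous[OF pq] by (metis (full_types))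
  \<comment> \<open>Together this reads t + l = a <= n <= l, which leaves only t = 0.\<close>
  moreover have "n \<le> l" using n(1) hc_eq_0[of n q] lm by force
  ultimately have "t = 0" using n(2) by simp
  then have "homogeneous 0 p" using tm by (force simp: homogeneous_tdeg)
  then show ?thesis by (simp add: homogeneous_0_iff)
qed

subsection \<open>Evaluation\<close>

text \<open>Values in an arbitrary commutative ring serve four purposes: substitution of
  polynomials, first order deformations for derivations, the passage to iterated univariate
  polynomials, and points over k.\<close>

definition ins :: "('k::field_char_0 \<Rightarrow> 'b::comm_ring_1) \<Rightarrow> (3 \<Rightarrow> 'b) \<Rightarrow> 'k poly3 \<Rightarrow> 'b" where
  "ins \<phi> x p = (\<Sum>t\<in>keys p. \<phi> (lookup p t) * (\<Prod>i\<in>UNIV. x i ^ lookup t i))"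

context
  fixes \<phi> :: "'k::field_char_0 \<Rightarrow> 'b::comm_ring_1"
  assumes \<phi>: "comm_ring_hom \<phi>"
begin

interpretation comm_ring_hom \<phi> by (rule \<phi>)

lemma ins_superset:
  "finite S \<Longrightarrow> keys p \<subseteq> S \<Longrightarrow> ins \<phi> x p = (\<Sum>t\<in>S. \<phi> (lookup p t) * (\<Prod>i\<in>UNIV. x i ^ lookup t i))"
  unfolding ins_def by (intro sum.mono_neutral_left) (auto simp: in_keys_iff)

lemma ins_0: "ins \<phi> x 0 = 0"
  by (simp add: ins_def)

lemma ins_add: "ins \<phi> x (p + q) = ins \<phi> x p + ins \<phi> x q"
proof -
  let ?S = "keys p \<union> keys q"
  have "keys (p + q) \<subseteq> ?S" by (rule keys_add)
  then show ?thesis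
    by (simp add: ins_superset[of ?S] lookup_add hom_add algebra_simps sum.distrib)
qed

lemma ins_single: "ins \<phi> x (single t c) = \<phi> c * (\<Prod>i\<in>UNIV. x i ^ lookup t i)"
  by (subst ins_superset[of "{t}"]) (auto simp: )

lemma ins_mult: "ins \<phi> x (p * q) = ins \<phi> x p * ins \<phi> x q"
proof (rule poly_mapping_single_induct[of p "\<lambda>p. ins \<phi> x (p * q) = ins \<phi> x p * ins \<phi> x q"])
  fix s :: "3 \<Rightarrow>\<^sub>0 nat" and c :: 'k
  show "ins \<phi> x (single s c * q) = ins \<phi> x (single s c) * ins \<phi> x q"
  proof (rule poly_mapping_single_induct[of q "\<lambda>q. ins \<phi> x (single s c * q) = ins \<phi> x (single s c) * ins \<phi> x q"])
    show "ins \<phi> x (single s c * single t d) = ins \<phi> x (single s c) * ins \<phi> x (single t d)" for t d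
      by (simp add: mult_single ins_single hom_mult lookup_add power_add prod.distrib mult_ac)
  qed (simp_all add: ins_0 ins_add algebra_simps)
qed (simp_all add: ins_0 ins_add algebra_simps)

lemma ins_Const: "ins \<phi> x (Const c) = \<phi> c"
  by (simp add: Const_def ins_single)

lemma ins_Var: "ins \<phi> x (Var i) = x i"
proof -
  have "(\<Prod>j\<in>UNIV. x j ^ lookup (single i (1::nat)) j) = (\<Prod>j\<in>UNIV. if j = i then x j else 1)"
    by (intro prod.cong) (auto simp: lookup_single when_def)
  then show ?thesis by (simp add: Var_def ins_single)
qed

lemma comm_ring_hom_ins: "comm_ring_hom (ins \<phi> x)"
  using ins_Const[of x 1] by unfold_locales (auto simp: ins_0 ins_add ins_mult)

end

lemma comm_ring_hom_Const: "comm_ring_hom Const"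
  by unfold_locales (auto simp: Const_add Const_mult)

definition subst :: "(3 \<Rightarrow> 'k::field_char_0 poly3) \<Rightarrow> 'k poly3 \<Rightarrow> 'k poly3" where
  "subst = ins Const"

interpretation subst: comm_ring_hom "subst x"
  unfolding subst_def by (rule comm_ring_hom_ins[OF comm_ring_hom_Const])

lemma subst_Const [simp]: "subst x (Const c) = Const c" and subst_Var [simp]: "subst x (Var i) = x i"
  by (simp_all add: subst_def ins_Const ins_Var comm_ring_hom_Const)

subsection \<open>Derivations\<close>

text \<open>Working over the dual numbers, the derivation with coefficients \<open>v\<close> is the first order part
  of the substitution \<open>x\<^sub>i \<mapsto> x\<^sub>i + \<epsilon> v\<^sub>i\<close>.\<close>

definition der :: "(3 \<Rightarrow> 'k::field_char_0 poly3) \<Rightarrow> 'k poly3 \<Rightarrow> 'k poly3" where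
  "der v p = coeff (ins (\<lambda>c. [:Const c:]) (\<lambda>i. [:Var i, v i:]) p) 1"

lemma comm_ring_hom_Const_poly: "comm_ring_hom (\<lambda>c. [:Const c:])"
  by unfold_locales (simp_all add: Const_add Const_mult pCons_one)

context
begin

interpretation I: comm_ring_hom "ins (\<lambda>c. [:Const c:]) (\<lambda>i. [:Var i, v i:])"
  by (rule comm_ring_hom_ins[OF comm_ring_hom_Const_poly])

lemma der_Const [simp]: "der v (Const c) = 0"
  by (simp add: der_def ins_Const comm_ring_hom_Const_poly)

lemma der_Var [simp]: "der v (Var i) = v i"
  by (simp add: der_def ins_Var comm_ring_hom_Const_poly)

lemma der_add: "der v (p + q) = der v p + der v q"
  by (simp add: der_def I.hom_add)

lemma coeff_0_ins: "coeff (ins (\<lambda>c. [:Const c:]) (\<lambda>i. [:Var i, v i:]) p) 0 = p"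
  by (induction p rule: poly3_induct)
    (simp_all add: I.hom_add I.hom_mult ins_Const ins_Var comm_ring_hom_Const_poly coeff_mult)

lemma der_mult: "der v (p * q) = der v p * q + p * der v q"
  by (simp add: der_def I.hom_mult coeff_mult coeff_0_ins)

end

lemma der_0 [simp]: "der v 0 = 0"
  using der_Const[of v 0] by simp

lemma der_1 [simp]: "der v 1 = 0"
  using der_Const[of v 1] by simp

lemma der_Const_mult: "der v (Const c * p) = Const c * der v p"
  by (simp add: der_mult)

lemma der_sum: "der v (sum f S) = (\<Sum>x\<in>S. der v (f x))"
  by (induction S rule: infinite_finite_induct) (simp_all add: der_add)

lemma der_plus_vec: "der (v + w) p = der v p + der w p"
  by (induction p rule: poly3_induct) (simp_all add: der_add der_mult algebra_simps)

lemma der_pscale: "der (pscale r v) p = r * der v p"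
  by (induction p rule: poly3_induct) (simp_all add: der_add der_mult algebra_simps pscale_def)

lemma der_zero_vec [simp]: "der 0 p = 0"
  using der_pscale[of 0 0 p] by (simp add: pscale_def zero_fun_def)

lemma der_minus_vec: "der (v - w) p = der v p - der w p"
  using der_plus_vec[of "v - w" w p] by simp

lemma der_sum_vec: "der (sum f S) p = (\<Sum>x\<in>S. der (f x) p)"
proof (induction S rule: infinite_finite_induct)
  case (insert x F)
  then show ?case by (simp only: sum.insert der_plus_vec not_False_eq_True)
qed (simp_all only: sum.infinite sum.empty der_zero_vec not_False_eq_True)

lemma der_prod_dvd:
  assumes "finite S" "\<And>x. x \<in> S \<Longrightarrow> f x dvd der v (f x)"
  shows "prod f S dvd der v (prod f S)"
  using assms by (induction S rule: finite_induct) (auto simp: der_mult mult_dvd_mono)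

lemma der_in_Der: "der v \<in> Der"
  by (simp add: Der_def der_add der_mult)

lemma Der_eq_der:
  assumes "\<theta> \<in> Der"
  shows "\<theta> = der (\<lambda>i. \<theta> (Var i))"
proof
  fix p
  have add: "\<theta> (p + q) = \<theta> p + \<theta> q" and Cm: "\<theta> (Const c * p) = Const c * \<theta> p"
    and mult: "\<theta> (p * q) = \<theta> p * q + p * \<theta> q" for p q c
    using assms by (auto simp: Der_def)
  have "\<theta> 1 = 0" using mult[of 1 1] by simp
  then have C: "\<theta> (Const c) = 0" for c using Cm[of c 1] by simp
  show "\<theta> p = der (\<lambda>i. \<theta> (Var i)) p"
    by (induction p rule: poly3_induct) (simp_all add: add mult C der_add der_mult)
qed

lemma der_inject: "der v = der w \<longleftrightarrow> v = w"
  by (metis der_Var ext)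

text \<open>The resulting degree is n + m - 1; writing \<open>Suc k = n + m\<close> avoids truncated
  subtraction.\<close>

lemma homogeneous_der:
  assumes "homogeneous n p" "\<And>i. homogeneous m (v i)" "Suc k = n + m"
  shows "homogeneous k (der v p)"
  using assms(1,3)
proof (induction arbitrary: k rule: homogeneous_induct)
  case (Var n i q)
  have 1: "homogeneous k (v i * q)"
    using homogeneous_mult[OF assms(2)[of i] Var(1)] Var(3) by (simp add: add.commute)
  have 2: "homogeneous k (Var i * der v q)"
  proof (cases "n + m")
    \<comment> \<open>There is no degree to apply the induction hypothesis in, but q is a constant
      and its derivative vanishes.\<close>
    case 0
    then have "homogeneous 0 q" using Var(1) by simp
    then show ?thesis by (auto simp: homogeneous_0_iff)
  next
    case (Suc l)
    then show ?thesis using homogeneous_mult[OF homogeneous_Var Var(2)[of l], of i] Var(3) by simp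
  qed
  show ?case using homogeneous_add[OF 1 2] by (simp add: der_mult)
qed (auto simp: der_add intro: homogeneous_add)

lemma Euler: "homogeneous n p \<Longrightarrow> der Var p = of_nat n * p"
  by (induction rule: homogeneous_induct) (simp_all add: der_add der_mult algebra_simps)

subsection \<open>Unique factorization\<close>

text \<open>Peel off the prime factors of f one at a time: such a prime divides every g v_i but not
  every v_i, hence divides g. This is what makes a vector proportional to a primitive vector v a
  polynomial multiple of v.\<close>

lemma ufd_primitive_dvd:
  fixes v w :: "'i \<Rightarrow> 'a::ufd"
  assumes f: "f \<noteq> 0" "\<And>i. f * w i = g * v i"
    and prim: "\<And>p. (\<And>i. p dvd v i) \<Longrightarrow> p dvd 1"
  shows "f dvd g"
proof (cases "f dvd 1")
  case True
  then show ?thesis by (meson dvd_trans one_dvd)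
next
  case False
  with f obtain F where "mset_factors F f" using mset_factors_exist by blast
  then have F: "\<And>p. p \<in># F \<Longrightarrow> prime_elem p" "f = prod_mset F"
    by (auto simp: mset_factors_def)
  have "prod_mset F dvd g" if "\<And>p. p \<in># F \<Longrightarrow> prime_elem p" "\<And>i. prod_mset F * w i = g * v i" for F g
    using that
  proof (induction F arbitrary: g)
    case (add p F)
    have p: "prime_elem p" by (rule add(2)) simp
    have pg: "p dvd g * v i" for i
      using add(3)[of i] by (metis dvd_triv_left mult.assoc prod_mset.add_mset)
    have "p dvd g"
    proof (rule ccontr)
      assume "\<not> p dvd g"
      then have "p dvd v i" for i using pg[of i] prime_elem_dvd_multD[OF p] by blast
      then have "p dvd 1" by (rule prim)
      then show False using prime_elem_not_unit[OF p] by contradiction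
    qed
    then obtain g' where g': "g = p * g'" by blast
    have "p \<noteq> 0" by (rule prime_elem_not_zeroI[OF p])
    then have "prod_mset F * w i = g' * v i" for i
      using add(3)[of i] by (simp add: g' mult.assoc)
    then have "prod_mset F dvd g'" using add(1,2) by simp
    then show ?case by (simp add: g' mult_dvd_mono)
  qed simp
  then show ?thesis using F f(2) by blast
qed

text \<open>The isomorphism of R with k[x_1][x_2][x_3], whose only purpose is to transport unique
  factorization and root counting. The indices are 1, 2, 3 with 3 = 0 in the index type; x_1 is the
  innermost variable and x_3 the outermost.\<close>

definition iter_poly :: "'k::field_char_0 poly3 \<Rightarrow> 'k poly poly poly" where
  "iter_poly = ins (\<lambda>c. [:[:[:c:]:]:]) (\<lambda>i. if i = 1 then [:[:[:0, 1:]:]:] else if i = 2 then [:[:0, 1:]:] else [:0, 1:])"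

lemma comm_ring_hom_const3: "comm_ring_hom (\<lambda>c::'k::field_char_0. [:[:[:c:]:]:])"
  by unfold_locales (simp_all add: pCons_one)

interpretation iter_poly: comm_ring_hom iter_poly
  unfolding iter_poly_def by (rule comm_ring_hom_ins[OF comm_ring_hom_const3])

lemma iter_poly_Const: "iter_poly (Const c) = [:[:[:c:]:]:]"
  by (simp add: iter_poly_def ins_Const comm_ring_hom_const3)

lemma iter_poly_Var: "iter_poly (Var i) =
    (if i = 1 then [:[:[:0, 1:]:]:] else if i = 2 then [:[:0, 1:]:] else [:0, 1:])"
  by (simp add: iter_poly_def ins_Var comm_ring_hom_const3)

lemma const_poly_power: "[:p:] ^ n = [:p ^ n:]"
  by (induction n) (simp_all add: pCons_one mult.commute)

lemma const_poly_mult: "[:p:] * [:q:] = [:p * q :: 'a::comm_ring_1:]"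
  by (simp add: mult.commute)

lemma const_poly_mult_monom: "[:p:] * monom 1 n = monom (p :: 'a::comm_ring_1) n"
  by (simp add: smult_monom)

lemma X_power_eq_monom: "[:0, 1:] ^ n = monom 1 n"
  by (simp add: monom_altdef)

lemma prod_UNIV_3: "prod f (UNIV :: 3 set) = f 1 * f 2 * f 3"
  unfolding UNIV_3 by (simp add: ac_simps)

lemma coeff_iter_poly:
  "coeff (coeff (coeff (iter_poly p) (lookup t 3)) (lookup t 2)) (lookup t 1) = lookup p t"
proof (rule poly_mapping_single_induct[where p = p])
  fix s :: "3 \<Rightarrow>\<^sub>0 nat" and c :: 'a
  have "iter_poly (single s c) = [:[:[:c:]:]:] * ([:[:[:0, 1:]:]:] ^ lookup s 1 * [:[:0, 1:]:] ^ lookup s 2 * [:0, 1:] ^ lookup s 3)"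
  proof -
    have "(2::3) \<noteq> 1" "(3::3) \<noteq> 1" "(3::3) \<noteq> 2" by simp_all
    then show ?thesis
      unfolding iter_poly_def ins_single[OF comm_ring_hom_const3] prod_UNIV_3
      by (simp only: if_True if_False simp_thms)
  qed
  also have "\<dots> = [:[:[:c:] * monom 1 (lookup s 1):] * monom 1 (lookup s 2):] * monom 1 (lookup s 3)"
    unfolding const_poly_power X_power_eq_monom mult.assoc[symmetric] const_poly_mult by (rule refl)
  also have "\<dots> = monom (monom (monom c (lookup s 1)) (lookup s 2)) (lookup s 3)"
    by (simp only: const_poly_mult_monom)
  finally have e: "iter_poly (single s c) = monom (monom (monom c (lookup s 1)) (lookup s 2)) (lookup s 3)" .
  have "s = t \<longleftrightarrow> lookup s 1 = lookup t 1 \<and> lookup s 2 = lookup t 2 \<and> lookup s 3 = lookup t 3"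
    unfolding poly_mapping_eq_iff fun_eq_iff forall_3 by auto
  then show "coeff (coeff (coeff (iter_poly (single s c)) (lookup t 3)) (lookup t 2)) (lookup t 1) = lookup (single s c) t"
    by (auto simp: e lookup_single when_def)
qed (simp_all add: iter_poly.hom_add lookup_add)

lemma inj_iter_poly: "inj iter_poly"
  by (rule injI, rule poly_mapping_eqI) (metis coeff_iter_poly)

lemma surj_iter_poly: "surj iter_poly"
proof -
  let ?I = "range iter_poly"
  have add: "a + b \<in> ?I" if "a \<in> ?I" "b \<in> ?I" for a b
    using that by (auto simp: iter_poly.hom_add[symmetric])
  have mult: "a * b \<in> ?I" if "a \<in> ?I" "b \<in> ?I" for a b
    using that by (auto simp: iter_poly.hom_mult[symmetric])
  have var: "[:[:[:0, 1:]:]:] \<in> ?I" "[:[:0, 1:]:] \<in> ?I" "[:0, 1:] \<in> ?I"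
    by (rule range_eqI[of _ _ "Var 1"] range_eqI[of _ _ "Var 2"] range_eqI[of _ _ "Var 3"]; simp add: iter_poly_Var; fail)+
  have c0: "[:[:[:c:]:]:] \<in> ?I" for c by (metis iter_poly_Const rangeI)
  have c1: "[:[:p:]:] \<in> ?I" for p
  proof (induction p)
    case 0
    then show ?case using c0[of 0] by simp
  next
    case (pCons a p)
    have "[:[:pCons a p:]:] = [:[:[:a:]:]:] + [:[:[:0, 1:]:]:] * [:[:p:]:]" by simp
    then show ?case using add[OF c0 mult[OF var(1) pCons(2)]] by simp
  qed
  have c2: "[:p:] \<in> ?I" for p
  proof (induction p)
    case 0
    then show ?case using c0[of 0] by simp
  next
    case (pCons a p)
    have "[:pCons a p:] = [:[:a:]:] + [:[:0, 1:]:] * [:p:]" by simp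
    then show ?case using add[OF c1 mult[OF var(2) pCons(2)]] by simp
  qed
  have "p \<in> ?I" for p
  proof (induction p)
    case 0
    then show ?case using c0[of 0] by simp
  next
    case (pCons a p)
    have "pCons a p = [:a:] + [:0, 1:] * p" by simp
    then show ?case using add[OF c2 mult[OF var(3) pCons(2)]] by simp
  qed
  then show ?thesis by blast
qed

lemma iter_poly_dvd_iff: "iter_poly a dvd iter_poly b \<longleftrightarrow> a dvd b"
proof
  assume "iter_poly a dvd iter_poly b"
  then obtain c where "iter_poly b = iter_poly a * c" by blast
  moreover obtain c' where "c = iter_poly c'" using surj_iter_poly by blast
  ultimately have "b = a * c'"
    by (simp add: iter_poly.hom_mult[symmetric] inj_eq[OF inj_iter_poly])
  then show "a dvd b" by simp
next
  assume "a dvd b"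
  then show "iter_poly a dvd iter_poly b" by (auto simp: iter_poly.hom_mult)
qed

lemma primitive_dvd:
  fixes v w :: "'i \<Rightarrow> 'k::field_char_0 poly3"
  assumes f: "f \<noteq> 0" "\<And>i. f * w i = g * v i"
    and prim: "\<And>p. (\<And>i. p dvd v i) \<Longrightarrow> p dvd 1"
  shows "f dvd g"
proof -
  have "iter_poly f dvd iter_poly g"
  proof (rule ufd_primitive_dvd[of "iter_poly f" "\<lambda>i. iter_poly (w i)" _ "\<lambda>i. iter_poly (v i)"])
    show "iter_poly f \<noteq> 0" using f inj_eq[OF inj_iter_poly, of f 0] by simp
    show "iter_poly f * iter_poly (w i) = iter_poly g * iter_poly (v i)" for i
      using f(2)[of i] by (metis iter_poly.hom_mult)
  next
    fix q :: "'k poly poly poly"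
    assume q: "\<And>i. q dvd iter_poly (v i)"
    obtain p where p: "q = iter_poly p" using surj_iter_poly by blast
    then have "p dvd 1" using prim q by (simp add: iter_poly_dvd_iff)
    then have "iter_poly p dvd iter_poly 1" by (simp only: iter_poly_dvd_iff)
    then show "q dvd 1" by (simp add: p)
  qed
  then show ?thesis by (simp add: iter_poly_dvd_iff)
qed

subsection \<open>Points\<close>

lemma comm_ring_hom_id: "comm_ring_hom (\<lambda>c::'k::field_char_0. c)"
  by unfold_locales auto

definition ev :: "(3 \<Rightarrow> 'k::field_char_0) \<Rightarrow> 'k poly3 \<Rightarrow> 'k" where
  "ev = ins (\<lambda>c. c)"

interpretation ev: comm_ring_hom "ev x"
  unfolding ev_def by (rule comm_ring_hom_ins[OF comm_ring_hom_id])

lemma ev_Const [simp]: "ev x (Const c) = c" and ev_Var [simp]: "ev x (Var i) = x i"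
  by (simp_all add: ev_def ins_Const ins_Var comm_ring_hom_id)

text \<open>The range of h will be the scalars of k inside a polynomial ring over k: they are
  infinitely many, and a nonzero polynomial over a domain has finitely many roots.\<close>

lemma exists_const_not_root:
  fixes p :: "'a::idom poly"
  assumes "p \<noteq> 0" "infinite (range h)"
  shows "\<exists>c. poly p (h c) \<noteq> 0"
proof (rule ccontr)
  assume "\<not> ?thesis"
  then have "range h \<subseteq> {x. poly p x = 0}" by auto
  then show False using poly_roots_finite[OF assms(1)] assms(2) finite_subset by blast
qed

text \<open>Specialize the outermost variable first; each scalar is chosen so that the remaining
  polynomial in fewer variables stays nonzero.\<close>

lemma exists_point_not_root:
  fixes f :: "'k::field_char_0 poly3"
  assumes "f \<noteq> 0"
  shows "\<exists>x. ev x f \<noteq> 0"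
proof -
  have inf: "infinite (range (\<lambda>c::'k. c))" using infinite_UNIV_char_0 by simp
  then have inf1: "infinite (range (\<lambda>c::'k. [:c:]))" and inf2: "infinite (range (\<lambda>c::'k. [:[:c:]:]))"
    by (auto simp: finite_image_iff inj_def)
  have "iter_poly f \<noteq> 0" using assms inj_eq[OF inj_iter_poly, of f 0] by simp
  then obtain c3 where "poly (iter_poly f) [:[:c3:]:] \<noteq> 0" using exists_const_not_root inf2 by blast
  then obtain c2 where "poly (poly (iter_poly f) [:[:c3:]:]) [:c2:] \<noteq> 0" using exists_const_not_root inf1 by blast
  then obtain c1 where c: "poly (poly (poly (iter_poly f) [:[:c3:]:]) [:c2:]) c1 \<noteq> 0"
    using exists_const_not_root inf by blast
  have "poly (poly (poly (iter_poly f) [:[:c3:]:]) [:c2:]) c1 = ev (\<lambda>i. if i = 1 then c1 else if i = 2 then c2 else c3) f"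
    by (induction f rule: poly3_induct)
      (simp_all add: iter_poly_Const iter_poly_Var iter_poly.hom_add iter_poly.hom_mult ev.hom_add ev.hom_mult)
  with c show ?thesis by metis
qed

section \<open>Dimensions\<close>

context vector_space
begin

text \<open>The spaces of polynomials are infinite-dimensional. Here and below the finite set F
  encloses the subspaces considered, so that their dimensions are honest cardinalities of finite
  bases.\<close>

lemma finite_basis_extend:
  assumes "B0 \<subseteq> V" "independent B0" "V \<subseteq> span F" "finite F"
  obtains B where "B0 \<subseteq> B" "B \<subseteq> V" "independent B" "V \<subseteq> span B" "finite B" "card B = dim V"
proof -
  obtain B where B: "B0 \<subseteq> B" "B \<subseteq> V" "independent B" "V \<subseteq> span B"
    using maximal_independent_subset_extend[OF assms(1,2)] by blast
  moreover have "finite B"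
    using independent_span_bound[OF assms(4) B(3)] B(2) assms(3) by blast
  moreover have "card B = dim V" by (rule basis_card_eq_dim[OF B(2,4,3)])
  ultimately show ?thesis using that by blast
qed

lemma dim_mono_finite:
  assumes "V \<subseteq> W" "W \<subseteq> span F" "finite F"
  shows "dim V \<le> dim W"
proof -
  obtain B where B: "B \<subseteq> V" "independent B" "card B = dim V"
    using finite_basis_extend[of "{}" V F] assms by (metis independent_empty empty_subsetI subset_trans)
  then obtain B' where "B \<subseteq> B'" "finite B'" "card B' = dim W"
    using finite_basis_extend[of B W F] assms by (metis subset_trans)
  then show ?thesis using B card_mono by metis
qed

lemma span_Int_independent:
  assumes "independent B" "S \<subseteq> B" "T \<subseteq> B" "S \<inter> T = {}" "x \<in> span S" "x \<in> span T"
  shows "x = 0"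
proof -
  have "representation B x = representation S x" "representation B x = representation T x"
    using assms by (auto intro: representation_extend)
  moreover have "representation S x b = 0 \<or> representation T x b = 0" for b
    using representation_ne_zero[of S x b] representation_ne_zero[of T x b] assms(4) by blast
  ultimately have "representation B x b = 0" for b by metis
  moreover have "x \<in> span B" using assms(2,5) span_mono by blast
  ultimately show ?thesis
    using sum_nonzero_representation_eq[OF assms(1), of x] by simp
qed

end

context vector_space_pair
begin

lemma rank_nullity:
  assumes f: "Vector_Spaces.linear s1 s2 f" and V: "vs1.subspace V" "V \<subseteq> vs1.span F" "finite F"
  shows "vs1.dim V = vs1.dim {x \<in> V. f x = 0} + vs2.dim (f ` V)"
proof -
  interpret f: Vector_Spaces.linear s1 s2 f by (rule f)
  let ?K = "{x \<in> V. f x = 0}"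
  have "?K \<subseteq> vs1.span F" using V(2) by blast
  then obtain B0 where B0: "{} \<subseteq> B0" "B0 \<subseteq> ?K" "vs1.independent B0" "?K \<subseteq> vs1.span B0" "finite B0" "card B0 = vs1.dim ?K"
    by (rule vs1.finite_basis_extend[OF empty_subsetI vs1.independent_empty _ V(3)])
  note B0 = B0(2-4,6)
  obtain B where B: "B0 \<subseteq> B" "B \<subseteq> V" "vs1.independent B" "V \<subseteq> vs1.span B" "finite B" "card B = vs1.dim V"
  proof (rule vs1.finite_basis_extend[OF _ B0(2) V(2,3)])
    show "B0 \<subseteq> V" using B0(1) by blast
  qed
  let ?C = "B - B0"
  have "x = 0" if x: "x \<in> vs1.span ?C" "f x = 0" for x
  proof -
    have "x \<in> V" using x(1) B(2) V(1) vs1.span_minimal[of ?C V] by blast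
    then have "x \<in> vs1.span B0" using x(2) B0(3) by blast
    then show ?thesis
      using vs1.span_Int_independent[OF B(3), of B0 ?C x] x(1) B(1) by blast
  qed
  then have inj: "inj_on f (vs1.span ?C)"
    using f.inj_on_iff_eq_0[OF vs1.subspace_span] by blast
  have ind: "vs2.independent (f ` ?C)"
    by (rule f.independent_injective_image[OF vs1.independent_mono[OF B(3)] inj]) auto
  have "f ` V \<subseteq> vs2.span (f ` B)" using B(4) by (rule f.spans_image)
  also have "\<dots> \<subseteq> vs2.span (f ` ?C)"
  proof (rule vs2.span_minimal)
    show "f ` B \<subseteq> vs2.span (f ` ?C)"
    proof
      fix y assume "y \<in> f ` B"
      then obtain x where x: "x \<in> B" "y = f x" by blast
      show "y \<in> vs2.span (f ` ?C)"
      proof (cases "x \<in> B0")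
        case True
        then show ?thesis using x B0(1) vs2.span_zero by auto
      next
        case False
        then show ?thesis using x by (intro vs2.span_base) blast
      qed
    qed
  qed simp
  finally have "card (f ` ?C) = vs2.dim (f ` V)"
    using vs2.basis_card_eq_dim[of "f ` ?C" "f ` V"] ind B(2) by blast
  moreover have "card (f ` ?C) = card ?C"
    using inj vs1.span_superset by (intro card_image inj_on_subset[OF inj]) blast
  moreover have "card ?C = card B - card B0" "card B0 \<le> card B"
    using B(1,5) by (auto intro: card_Diff_subset card_mono finite_subset)
  ultimately show ?thesis using B0(4) B(6) by linarith
qed

lemma dim_image_inj:
  assumes f: "Vector_Spaces.linear s1 s2 f" and V: "vs1.subspace V" "V \<subseteq> vs1.span F" "finite F"
    and inj: "\<And>x. x \<in> V \<Longrightarrow> f x = 0 \<Longrightarrow> x = 0"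
  shows "vs2.dim (f ` V) = vs1.dim V"
proof -
  have "{x \<in> V. f x = 0} \<subseteq> {0}" using inj by blast
  then have "vs1.dim {x \<in> V. f x = 0} = 0"
    using vs1.dim_le_card[of _ "{}"] by simp
  then show ?thesis using rank_nullity[OF f V] by simp
qed

end

context vector_space
begin

text \<open>A linear map g that kills a basis of U and fixes the rest of a basis of U + W has kernel
  U on U + W and kernel the intersection on W, with the same image on both. The formula is
  rank-nullity for g, applied twice.\<close>

lemma dim_sum_inter:
  assumes U: "subspace U" "U \<subseteq> span F" "finite F" and W: "subspace W" "W \<subseteq> span F"
  shows "dim {x + y |x y. x \<in> U \<and> y \<in> W} + dim (U \<inter> W) = dim U + dim W"
proof -
  interpret p: vector_space_pair scale scale by unfold_locales
  let ?S = "{x + y |x y. x \<in> U \<and> y \<in> W}"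
  have S: "subspace ?S" by (rule subspace_sums[OF U(1) W(1)])
  have SF: "?S \<subseteq> span F" using U(2) W(2) by (auto intro: span_add)
  have US: "U \<subseteq> ?S" using subspace_0[OF W(1)] by force
  have WS: "W \<subseteq> ?S" using subspace_0[OF U(1)] by force
  obtain B0 where B0: "B0 \<subseteq> U" "independent B0" "U \<subseteq> span B0"
    using finite_basis_extend[of "{}" U F] U by (metis independent_empty empty_subsetI)
  obtain B where B: "B0 \<subseteq> B" "B \<subseteq> ?S" "independent B" "?S \<subseteq> span B" "finite B" "card B = dim ?S"
    by (rule finite_basis_extend[OF subset_trans[OF B0(1) US] B0(2) SF U(3)])
  obtain g where g: "Vector_Spaces.linear scale scale g" "\<And>x. x \<in> B \<Longrightarrow> g x = (if x \<in> B0 then 0 else x)"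
    using p.linear_independent_extend[OF B(3), of "\<lambda>x. if x \<in> B0 then 0 else x"] by blast
  interpret g: Vector_Spaces.linear scale scale g by (rule g(1))
  have g0: "g x = 0" if "x \<in> U" for x
  proof -
    have "x \<in> span B0" using that B0 by blast
    then show ?thesis
      using g.eq_0_on_span[of B0 x] g(2) B(1) by (metis subsetD)
  qed
  have gid: "g y = y" if "y \<in> span (B - B0)" for y
    using that
  proof (induction rule: span_induct_alt)
    case (step c x y)
    then show ?case using g(2)[of x] by (simp add: g.add g.scale)
  qed simp
  have ker: "x \<in> U" if x: "x \<in> ?S" "g x = 0" for x
  proof -
    have "B0 \<union> (B - B0) = B" using B(1) by blast
    then have "x \<in> {u + y |u y. u \<in> span B0 \<and> y \<in> span (B - B0)}"
      using subsetD[OF B(4) x(1)] span_Un[of B0 "B - B0"] by metis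
    then obtain u y where uy: "x = u + y" "u \<in> span B0" "y \<in> span (B - B0)"
      by blast
    have "u \<in> U" using uy(2) B0(1) U(1) span_minimal by blast
    moreover have "y = 0" using x(2) gid[OF uy(3)] g0[OF \<open>u \<in> U\<close>] by (simp add: uy(1) g.add)
    ultimately show ?thesis using uy by simp
  qed
  have gS: "g ` ?S = g ` W"
  proof
    show "g ` ?S \<subseteq> g ` W" using g0 by (auto simp: g.add)
    show "g ` W \<subseteq> g ` ?S" using WS by blast
  qed
  have 1: "{x \<in> ?S. g x = 0} = U" using ker g0 US by blast
  have 2: "{x \<in> W. g x = 0} = U \<inter> W" using ker g0 WS by blast
  have "dim ?S = dim U + dim (g ` W)"
    using p.rank_nullity[OF g(1) S SF U(3)] unfolding 1 gS .
  moreover have "dim W = dim (U \<inter> W) + dim (g ` W)"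
    using p.rank_nullity[OF g(1) W U(3)] unfolding 2 .
  ultimately show ?thesis by linarith
qed

end

section \<open>Graded pieces as vector spaces over k\<close>

definition kscale :: "'k::field_char_0 \<Rightarrow> 'k poly3 \<Rightarrow> 'k poly3" where
  "kscale c p = Const c * p"

definition kvscale :: "'k::field_char_0 \<Rightarrow> ('i \<Rightarrow> 'k poly3) \<Rightarrow> 'i \<Rightarrow> 'k poly3" where
  "kvscale c v = pscale (Const c) v"

interpretation kR: vector_space kscale
  by unfold_locales (simp_all add: kscale_def Const_add Const_mult algebra_simps)

interpretation kV: vector_space kvscale
  by unfold_locales (simp_all add: kvscale_def pscale_def fun_eq_iff Const_add Const_mult algebra_simps)

interpretation kRR: vector_space_pair kscale kscale by unfold_locales
interpretation kRV: vector_space_pair kscale kvscale by unfold_locales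
interpretation kVR: vector_space_pair kvscale kscale by unfold_locales
interpretation kVV: vector_space_pair kvscale kvscale by unfold_locales

definition forms :: "nat \<Rightarrow> 'k::field_char_0 poly3 set" where
  "forms m = {p. homogeneous m p}"

definition vforms :: "nat \<Rightarrow> ('i \<Rightarrow> 'k::field_char_0 poly3) set" where
  "vforms m = {v. \<forall>i. homogeneous m (v i)}"

lemma subspace_forms: "kR.subspace (forms m)"
  by (auto simp: kR.subspace_def forms_def kscale_def homogeneous_Const_mult homogeneous_add)

lemma subspace_vforms: "kV.subspace (vforms m)"
  by (auto simp: kV.subspace_def vforms_def kvscale_def pscale_def homogeneous_Const_mult homogeneous_add)

lemma card_monomials:
  "finite {t. tdeg t = m} \<and> 2 * card {t. tdeg t = m} = (m + 1) * (m + 2)"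
proof -
  define f :: "(3 \<Rightarrow>\<^sub>0 nat) \<Rightarrow> nat \<times> nat" where "f t = (lookup t 1, lookup t 2)" for t
  define g :: "nat \<times> nat \<Rightarrow> (3 \<Rightarrow>\<^sub>0 nat)" where
    "g = (\<lambda>(a, b). single 1 a + single 2 b + single 3 (m - a - b))"
  have td: "tdeg t = lookup t 1 + lookup t 2 + lookup t 3" for t
    by (simp add: tdeg_def sum_3)
  have g: "lookup (g (a, b)) 1 = a" "lookup (g (a, b)) 2 = b" "lookup (g (a, b)) 3 = m - a - b" for a b
    by (simp_all add: g_def lookup_add lookup_single)
  let ?S = "SIGMA a:{..m}. {..m - a}"
  have "bij_betw f {t. tdeg t = m} ?S"
  proof (rule bij_betw_byWitness[where f' = g])
    show "\<forall>t\<in>{t. tdeg t = m}. g (f t) = t"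
      unfolding poly_mapping_eq_iff fun_eq_iff forall_3 f_def g by (auto simp: td)
    show "\<forall>s\<in>?S. f (g s) = s" by (auto simp: f_def g)
    show "f ` {t. tdeg t = m} \<subseteq> ?S" by (auto simp: f_def td)
    show "g ` ?S \<subseteq> {t. tdeg t = m}" by (auto simp: td g)
  qed
  then have "finite {t. tdeg t = m}" "card {t. tdeg t = m} = card ?S"
    by (auto dest: bij_betw_finite bij_betw_same_card)
  moreover have "card ?S = (\<Sum>a\<le>m. m - a + 1)" by simp
  moreover have "(\<Sum>a\<le>m. m - a + 1) = (\<Sum>a\<le>m. a + 1)"
    by (rule sum.reindex_bij_witness[of _ "\<lambda>a. m - a" "\<lambda>a. m - a"]) auto
  moreover have "2 * (\<Sum>a\<le>m. a + 1) = (m + 1) * (m + 2)"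
    by (induction m) simp_all
  ultimately show ?thesis by simp
qed

lemma lookup_Const_mult: "lookup (Const c * p) t = c * lookup p t"
proof (rule poly_mapping_single_induct[of p "\<lambda>p. lookup (Const c * p) t = c * lookup p t"])
  show "lookup (Const c * single s a) t = c * lookup (single s a) t" for s a
    by (simp add: Const_mult_single lookup_single when_def)
qed (simp_all add: algebra_simps lookup_add)

lemma vforms_basis:
  fixes m :: nat
  defines "E \<equiv> (\<lambda>(i::'i::finite, t) j. if j = i then single t (1::'k::field_char_0) else 0) ` (UNIV \<times> {t. tdeg t = m})"
  shows "E \<subseteq> vforms m" "kV.independent E" "vforms m \<subseteq> kV.span E" "finite E"
    "2 * card E = CARD('i) * ((m + 1) * (m + 2))"
proof -
  let ?e = "\<lambda>(i::'i, t) j. if j = i then single t (1::'k) else 0"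
  let ?T = "{t. tdeg t = m}"
  note T = card_monomials[of m]
  show "E \<subseteq> vforms m" by (auto simp: E_def vforms_def)
  show fin: "finite E" using T by (simp add: E_def)
  have e: "lookup (?e (i, t) j) s = (if j = i \<and> s = t then 1 else 0)" for i t j s
    by (simp add: lookup_single when_def)
  have inj: "inj_on ?e (UNIV \<times> ?T)"
  proof (rule inj_onI)
    fix x y :: "'i \<times> (3 \<Rightarrow>\<^sub>0 nat)" assume "?e x = ?e y"
    then have "lookup (?e (fst x, snd x) (fst x)) (snd x) = lookup (?e (fst y, snd y) (fst x)) (snd x)" by simp
    then show "x = y" unfolding e by (auto split: if_splits simp: prod_eq_iff)
  qed
  then show "2 * card E = CARD('i) * ((m + 1) * (m + 2))"
    unfolding E_def using T
    by (simp only: card_image card_cartesian_product mult.left_commute[of 2])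
  have sum_apply: "sum f S i = (\<Sum>x\<in>S. f x i)" for f :: "'i \<times> (3 \<Rightarrow>\<^sub>0 nat) \<Rightarrow> 'i \<Rightarrow> 'k poly3" and S i
    by (induction S rule: infinite_finite_induct) auto
  have coeff: "lookup ((\<Sum>x\<in>UNIV \<times> ?T. kvscale (c x) (?e x)) i) t = c (i, t)" if "t \<in> ?T" for c i t
  proof -
    have "lookup ((\<Sum>x\<in>UNIV \<times> ?T. kvscale (c x) (?e x)) i) t = (\<Sum>x\<in>UNIV \<times> ?T. lookup (kvscale (c x) (?e x) i) t)"
      by (simp add: sum_apply lookup_sum)
    also have "\<dots> = (\<Sum>x\<in>UNIV \<times> ?T. if x = (i, t) then c (i, t) else 0)"
      by (intro sum.cong refl)
        (auto simp: kvscale_def pscale_def lookup_Const_mult lookup_single when_def split: if_splits)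
    also have "\<dots> = c (i, t)" using T that by simp
    finally show ?thesis .
  qed
  show "kV.independent E"
  proof (rule kV.independent_if_scalars_zero[OF fin])
    fix c v assume 0: "(\<Sum>x\<in>E. kvscale (c x) x) = 0" and v: "v \<in> E"
    obtain i t where it: "v = ?e (i, t)" "t \<in> ?T" using v by (auto simp: E_def)
    have "(\<Sum>x\<in>UNIV \<times> ?T. kvscale (c (?e x)) (?e x)) = 0"
      using 0 unfolding E_def sum.reindex[OF inj] by (simp add: comp_def)
    then show "c v = 0" using coeff[OF it(2), of "\<lambda>x. c (?e x)" i] it(1) by simp
  qed
  show "vforms m \<subseteq> kV.span E"
  proof
    fix v :: "'i \<Rightarrow> 'k poly3" assume v: "v \<in> vforms m"
    have "v = (\<Sum>x\<in>UNIV \<times> ?T. kvscale (lookup (v (fst x)) (snd x)) (?e x))" (is "v = ?w")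
    proof (intro ext poly_mapping_eqI)
      fix i t
      show "lookup (v i) t = lookup (?w i) t"
      proof (cases "t \<in> ?T")
        case True
        then show ?thesis using coeff[of t "\<lambda>x. lookup (v (fst x)) (snd x)" i] by simp
      next
        case False
        then have "t \<notin> keys (v i)" using v by (auto simp: vforms_def homogeneous_tdeg)
        then have "lookup (v i) t = 0" by (simp add: in_keys_iff)
        moreover have "lookup (kvscale (lookup (v (fst x)) (snd x)) (?e x) i) t = 0" if "x \<in> UNIV \<times> ?T" for x
          using that False by (auto simp: kvscale_def pscale_def lookup_Const_mult lookup_single when_def split: if_splits)
        ultimately show ?thesis by (simp add: sum_apply lookup_sum)
      qed
    qed
    also have "?w \<in> kV.span E"
      unfolding E_def by (intro kV.span_sum kV.span_scale kV.span_base) auto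
    finally show "v \<in> kV.span E" .
  qed
qed

lemma vforms_finite_span: "\<exists>F. finite F \<and> (vforms m :: ('i::finite \<Rightarrow> 'k::field_char_0 poly3) set) \<subseteq> kV.span F"
  using vforms_basis(3,4) by blast

lemma dim_vforms:
  "2 * kV.dim (vforms m :: ('i::finite \<Rightarrow> 'k::field_char_0 poly3) set) = CARD('i) * ((m + 1) * (m + 2))"
  using kV.basis_card_eq_dim[OF vforms_basis(1,3,2)] vforms_basis(5) by metis

lemma linear_apply_vec: "Vector_Spaces.linear kvscale kscale (\<lambda>v. v i)"
  by unfold_locales (simp_all add: kvscale_def kscale_def pscale_def)

text \<open>Forms are vectors of forms over a one-element index type, so the count of monomials done
  for vectors also covers them.\<close>

lemma forms_eq_image: "forms m = (\<lambda>v. v ()) ` vforms m"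
proof -
  have "p \<in> (\<lambda>v. v ()) ` vforms m" if "p \<in> forms m" for p
    using that by (intro image_eqI[of _ _ "\<lambda>_. p"]) (auto simp: forms_def vforms_def)
  then show ?thesis by (auto simp: forms_def vforms_def)
qed

lemma forms_finite_span: "\<exists>F. finite F \<and> (forms m :: 'k::field_char_0 poly3 set) \<subseteq> kR.span F"
proof -
  obtain F where F: "finite F" "(vforms m :: (unit \<Rightarrow> 'k poly3) set) \<subseteq> kV.span F"
    using vforms_finite_span by blast
  interpret Vector_Spaces.linear kvscale kscale "\<lambda>v. v ()" by (rule linear_apply_vec)
  show ?thesis using F spans_image[OF F(2)] forms_eq_image by (metis finite_imageI)
qed

text \<open>The binomial coefficient (m + 2 over 2); the division is exact by
  \<open>two_rdim\<close>.\<close>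

definition rdim :: "nat \<Rightarrow> nat" where "rdim m = (m + 1) * (m + 2) div 2"

lemma two_rdim: "2 * rdim m = (m + 1) * (m + 2)"
  unfolding rdim_def by (metis card_monomials dvd_triv_left dvd_mult_div_cancel)

lemma rdim_Suc: "rdim (Suc m) = rdim m + m + 2"
  using two_rdim[of m] two_rdim[of "Suc m"] by simp

lemma dim_forms: "kR.dim (forms m :: 'k::field_char_0 poly3 set) = rdim m"
proof -
  obtain F where F: "finite F" "(vforms m :: (unit \<Rightarrow> 'k poly3) set) \<subseteq> kV.span F"
    using vforms_finite_span by blast
  have "kR.dim (forms m :: 'k poly3 set) = kV.dim (vforms m :: (unit \<Rightarrow> 'k poly3) set)"
    unfolding forms_eq_image
    by (rule kVR.dim_image_inj[OF linear_apply_vec subspace_vforms F(2,1)]) (auto simp: fun_eq_iff)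
  then show ?thesis using dim_vforms[where 'i = unit and 'k = 'k, of m] two_rdim[of m] by simp
qed

lemma dim_vforms': "kV.dim (vforms m :: ('i::finite \<Rightarrow> 'k::field_char_0 poly3) set) = CARD('i) * rdim m"
  using dim_vforms[where 'i = 'i and 'k = 'k, of m] two_rdim[of m] by (metis mult.left_commute mult_left_cancel zero_neq_numeral)

section \<open>Linear forms and planes\<close>

definition dot :: "'k::field_char_0 ^ 3 \<Rightarrow> 'k ^ 3 \<Rightarrow> 'k" where
  "dot a v = (\<Sum>i\<in>UNIV. a $ i * v $ i)"

lemma plane_dot: "v \<in> plane a \<longleftrightarrow> dot a v = 0"
  by (simp add: plane_def dot_def)

lemma dot_scale_left: "dot (c *s a) v = c * dot a v"
  by (simp add: dot_def sum_distrib_left mult.assoc)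

lemma dot_scale_right: "dot a (c *s v) = c * dot a v"
  by (simp add: dot_def sum_distrib_left mult.left_commute)

lemma dot_add_left: "dot (a + b) v = dot a v + dot b v"
  by (simp add: dot_def sum.distrib algebra_simps)

lemma dot_add_right: "dot a (v + w) = dot a v + dot a w"
  by (simp add: dot_def sum.distrib algebra_simps)

lemma dot_diff_right: "dot a (v - w) = dot a v - dot a w"
  by (simp add: dot_def sum_subtractf algebra_simps)

lemma dot_axis: "dot a (axis i c) = a $ i * c"
proof -
  have "dot a (axis i c) = (\<Sum>j\<in>UNIV. if j = i then a $ j * c else 0)"
    unfolding dot_def by (intro sum.cong refl) (simp add: axis_def)
  then show ?thesis by simp
qed

lemma dot_eqI: "(\<And>v. dot a v = dot b v) \<Longrightarrow> a = b"
  using dot_axis[of a _ 1] dot_axis[of b _ 1] by (metis mult.right_neutral Finite_Cartesian_Product.vec_eq_iff)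

lemma exists_dual:
  assumes "a \<noteq> 0"
  shows "\<exists>w. dot a w = 1"
proof -
  obtain i where "a $ i \<noteq> 0" using assms by (auto simp: Finite_Cartesian_Product.vec_eq_iff)
  then show ?thesis by (intro exI[of _ "axis i (1 / a $ i)"]) (simp add: dot_axis)
qed

text \<open>With w such that a(w) = 1, every v is a(v) w plus a vector of \<open>plane a\<close>; a
  form vanishing on that plane is therefore determined by its value at w.\<close>

lemma plane_subset:
  assumes "a \<noteq> 0" "plane a \<subseteq> plane b"
  shows "\<exists>c. b = c *s a"
proof -
  obtain w where w: "dot a w = 1" using exists_dual[OF assms(1)] by blast
  have "dot b v = dot (dot b w *s a) v" for v
  proof -
    have "v - dot a v *s w \<in> plane a" by (simp add: plane_dot dot_diff_right dot_scale_right w)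
    then have "dot b (v - dot a v *s w) = 0" using assms(2) plane_dot by blast
    then show ?thesis by (simp add: dot_diff_right dot_scale_right dot_scale_left)
  qed
  then show ?thesis using dot_eqI by blast
qed

lemma plane_scale: "c \<noteq> 0 \<Longrightarrow> plane (c *s a) = plane a"
  by (auto simp: plane_dot dot_scale_left)

lemma plane_subset_eq:
  assumes "a \<noteq> 0" "b \<noteq> 0" "plane a \<subseteq> plane b"
  shows "plane a = plane b"
proof -
  obtain c where c: "b = c *s a" using plane_subset[OF assms(1,3)] by blast
  then have "c \<noteq> 0" using assms(2) by auto
  then show ?thesis using c plane_scale by blast
qed

lemma exists_dual_pair:
  assumes "a \<noteq> 0" "b \<noteq> 0" "plane a \<noteq> plane b"
  shows "\<exists>w. dot a w = 1 \<and> dot b w = 0"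
proof -
  have "\<not> plane b \<subseteq> plane a" using plane_subset_eq[OF assms(2,1)] assms(3) by metis
  then obtain u where u: "dot b u = 0" "dot a u \<noteq> 0"
    by (auto simp: plane_dot subset_iff)
  then show ?thesis by (intro exI[of _ "(1 / dot a u) *s u"]) (simp add: dot_scale_right)
qed

lemma linear_form_add: "linear_form (a + b) = linear_form a + linear_form b"
  by (simp add: linear_form_def Const_add sum.distrib algebra_simps)

lemma linear_form_scale: "linear_form (c *s a) = Const c * linear_form a"
  by (simp add: linear_form_def Const_mult sum_distrib_left mult.assoc)

lemma homogeneous_linear_form [simp]: "homogeneous (Suc 0) (linear_form a)"
  unfolding linear_form_def by (intro homogeneous_sum homogeneous_Const_mult) simp

lemma der_linear_form: "der v (linear_form a) = (\<Sum>i\<in>UNIV. Const (a $ i) * v i)"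
  by (simp add: linear_form_def der_sum der_Const_mult)

lemma ev_linear_form: "ev (\<lambda>i. w $ i) (linear_form a) = dot a w"
  by (simp add: linear_form_def dot_def ev.hom_sum ev.hom_mult)

lemma subst_linear_form: "subst x (linear_form a) = (\<Sum>i\<in>UNIV. Const (a $ i) * x i)"
  by (simp add: linear_form_def subst.hom_sum subst.hom_mult)

lemma linear_form_inject: "linear_form a = linear_form b \<longleftrightarrow> a = b"
  by (metis dot_eqI ev_linear_form)

lemma linear_form_eq_0: "linear_form a = 0 \<longleftrightarrow> a = 0"
proof -
  have "linear_form (0 :: 'a ^ 3) = 0" by (simp add: linear_form_def)
  then show ?thesis using linear_form_inject[of a 0] by simp
qed

text \<open>If a(w) = 1, this substitution sends the form of a to 0 and changes every polynomial
  only by a multiple of it. It is thus a model of R/(alpha) inside the domain R, and primality of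
  alpha can be read off from its kernel.\<close>

definition proj1 :: "'k::field_char_0 ^ 3 \<Rightarrow> 'k ^ 3 \<Rightarrow> 'k poly3 \<Rightarrow> 'k poly3" where
  "proj1 a w = subst (\<lambda>i. Var i - Const (w $ i) * linear_form a)"

interpretation proj1: comm_ring_hom "proj1 a w"
  unfolding proj1_def by unfold_locales

lemma sum_Const_dot: "(\<Sum>i\<in>UNIV. Const (b $ i) * (Const (w $ i) * p)) = Const (dot b w) * p"
  unfolding dot_def by (simp add: sum_3 Const_add Const_mult algebra_simps)

lemma proj1_linear_form: "proj1 a w (linear_form b) = linear_form b - Const (dot b w) * linear_form a"
  unfolding proj1_def subst_linear_form
  by (simp add: right_diff_distrib sum_subtractf sum_Const_dot) (simp add: linear_form_def)

lemma dvd_diff_proj1: "linear_form a dvd p - proj1 a w p"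
proof (induction p rule: poly3_induct)
  case (add p q)
  have "p + q - proj1 a w (p + q) = (p - proj1 a w p) + (q - proj1 a w q)"
    by (simp add: proj1.hom_add)
  then show ?case using add by (metis dvd_add)
next
  case (mult p q)
  have "p * q - proj1 a w (p * q) = (p - proj1 a w p) * q + proj1 a w p * (q - proj1 a w q)"
    by (simp add: proj1.hom_mult algebra_simps)
  then show ?case using mult by (metis dvd_add dvd_mult dvd_mult2)
qed (simp_all add: proj1_def)

lemma dvd_iff_proj1:
  assumes "dot a w = 1"
  shows "linear_form a dvd p \<longleftrightarrow> proj1 a w p = 0"
proof
  assume "linear_form a dvd p"
  then show "proj1 a w p = 0"
    using proj1_linear_form[of a w a] assms by (auto simp: proj1.hom_mult)
qed (use dvd_diff_proj1[of a p w] in simp)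

lemma prime_linear_form:
  assumes "a \<noteq> 0"
  shows "prime_elem (linear_form a)"
proof -
  obtain w where w: "dot a w = 1" using exists_dual[OF assms] by blast
  show ?thesis
    unfolding prime_elem_def by (simp add: dvd_iff_proj1[OF w] proj1.hom_mult linear_form_eq_0 assms)
qed

lemma linear_form_dvd:
  assumes "a \<noteq> 0" "linear_form a dvd linear_form b"
  shows "\<exists>c. b = c *s a"
proof -
  obtain w where w: "dot a w = 1" using exists_dual[OF assms(1)] by blast
  have "linear_form b = linear_form (dot b w *s a)"
    using assms(2) by (simp add: dvd_iff_proj1[OF w] proj1_linear_form linear_form_scale)
  then show ?thesis using linear_form_inject by blast
qed

section \<open>Ideals generated by two elements and ideals of points\<close>

definition ideal2 :: "'a::comm_ring_1 \<Rightarrow> 'a \<Rightarrow> 'a set" where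
  "ideal2 a b = {a * x + b * y | x y. True}"

lemma ideal2I: "p = a * x + b * y \<Longrightarrow> p \<in> ideal2 a b"
  by (auto simp: ideal2_def)

lemma ideal2E:
  assumes "p \<in> ideal2 a b"
  obtains x y where "p = a * x + b * y"
  using assms by (auto simp: ideal2_def)

lemma ideal2_0: "0 \<in> ideal2 a b"
  by (rule ideal2I[of _ _ 0 _ 0]) simp

lemma ideal2_add: "p \<in> ideal2 a b \<Longrightarrow> q \<in> ideal2 a b \<Longrightarrow> p + q \<in> ideal2 a b"
  by (elim ideal2E, rule_tac x = "x + xa" and y = "y + ya" in ideal2I) (simp add: algebra_simps)

lemma ideal2_mult: "p \<in> ideal2 a b \<Longrightarrow> q * p \<in> ideal2 a b"
  by (elim ideal2E, rule_tac x = "q * x" and y = "q * y" in ideal2I) (simp add: algebra_simps)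

lemma ideal2_uminus: "p \<in> ideal2 a b \<Longrightarrow> - p \<in> ideal2 a b"
  using ideal2_mult[of p a b "- 1"] by simp

lemma ideal2_diff: "p \<in> ideal2 a b \<Longrightarrow> q \<in> ideal2 a b \<Longrightarrow> p - q \<in> ideal2 a b"
  using ideal2_add[of p a b "- q"] ideal2_uminus by auto

text \<open>The analogue of \<open>proj1\<close> for two forms: if u, w is dual to a, b, it models
  the quotient by the ideal of the point where both planes meet.\<close>

definition proj2 :: "'k::field_char_0 ^ 3 \<Rightarrow> 'k ^ 3 \<Rightarrow> 'k ^ 3 \<Rightarrow> 'k ^ 3 \<Rightarrow> 'k poly3 \<Rightarrow> 'k poly3" where
  "proj2 a b u w = subst (\<lambda>i. Var i - Const (u $ i) * linear_form a - Const (w $ i) * linear_form b)"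

interpretation proj2: comm_ring_hom "proj2 a b u w"
  unfolding proj2_def by unfold_locales

lemma proj2_linear_form: "proj2 a b u w (linear_form c) =
    linear_form c - Const (dot c u) * linear_form a - Const (dot c w) * linear_form b"
  unfolding proj2_def subst_linear_form
  by (simp add: right_diff_distrib sum_subtractf sum_Const_dot) (simp add: linear_form_def)

lemma diff_proj2_in_ideal2: "p - proj2 a b u w p \<in> ideal2 (linear_form a) (linear_form b)"
proof (induction p rule: poly3_induct)
  case (Const c)
  then show ?case by (simp add: proj2_def ideal2_0)
next
  case (Var i)
  show ?case
    by (rule ideal2I[of _ _ "Const (u $ i)" _ "Const (w $ i)"]) (simp add: proj2_def algebra_simps)
next
  case (add p q)
  have "p + q - proj2 a b u w (p + q) = (p - proj2 a b u w p) + (q - proj2 a b u w q)"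
    by (simp add: proj2.hom_add)
  then show ?case using add by (metis ideal2_add)
next
  case (mult p q)
  have "p * q - proj2 a b u w (p * q) = q * (p - proj2 a b u w p) + proj2 a b u w p * (q - proj2 a b u w q)"
    by (simp add: proj2.hom_mult algebra_simps)
  then show ?case using mult by (metis ideal2_add ideal2_mult)
qed

lemma exists_proj2:
  assumes "a \<noteq> 0" "b \<noteq> 0" "plane a \<noteq> plane b"
  shows "\<exists>u w. dot a u = 1 \<and> dot b u = 0 \<and> dot a w = 0 \<and> dot b w = 1 \<and>
    (\<forall>p. p \<in> ideal2 (linear_form a) (linear_form b) \<longleftrightarrow> proj2 a b u w p = 0)"
proof -
  obtain u where u: "dot a u = 1" "dot b u = 0" using exists_dual_pair[OF assms] by blast
  obtain w where w: "dot b w = 1" "dot a w = 0" using exists_dual_pair[OF assms(2,1)] assms(3) by metis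
  have "proj2 a b u w p = 0" if "p \<in> ideal2 (linear_form a) (linear_form b)" for p
    using that u w by (auto elim!: ideal2E simp: proj2.hom_add proj2.hom_mult proj2_linear_form)
  moreover have "p \<in> ideal2 (linear_form a) (linear_form b)" if "proj2 a b u w p = 0" for p
    using diff_proj2_in_ideal2[of p a b u w] that by simp
  ultimately show ?thesis using u w by blast
qed

lemma ideal2_prime:
  assumes "a \<noteq> 0" "b \<noteq> 0" "plane a \<noteq> plane b"
    and "p * q \<in> ideal2 (linear_form a) (linear_form b)"
  shows "p \<in> ideal2 (linear_form a) (linear_form b) \<or> q \<in> ideal2 (linear_form a) (linear_form b)"
proof -
  obtain u w where uw: "\<And>p. p \<in> ideal2 (linear_form a) (linear_form b) \<longleftrightarrow> proj2 a b u w p = 0"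
    using exists_proj2[OF assms(1-3)] by blast
  then show ?thesis using assms(4) by (simp add: proj2.hom_mult)
qed

lemma one_notin_ideal2:
  assumes "a \<noteq> 0" "b \<noteq> 0" "plane a \<noteq> plane b"
  shows "1 \<notin> ideal2 (linear_form a) (linear_form b)"
proof -
  obtain u w where uw: "\<And>p. p \<in> ideal2 (linear_form a) (linear_form b) \<longleftrightarrow> proj2 a b u w p = 0"
    using exists_proj2[OF assms] by blast
  then show ?thesis unfolding uw proj2.hom_one by simp
qed

lemma linear_form_in_ideal2:
  assumes "a \<noteq> 0" "b \<noteq> 0" "plane a \<noteq> plane b" "linear_form c \<in> ideal2 (linear_form a) (linear_form b)"
  shows "plane a \<inter> plane b \<subseteq> plane c"
proof -
  obtain u w where "proj2 a b u w (linear_form c) = 0"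
    using exists_proj2[OF assms(1-3)] assms(4) by blast
  then have "linear_form c = linear_form (dot c u *s a + dot c w *s b)"
    unfolding proj2_linear_form linear_form_add linear_form_scale by (simp only: diff_diff_eq right_minus_eq)
  then have c: "c = dot c u *s a + dot c w *s b" by (simp only: linear_form_inject)
  have "dot c v = 0" if "dot a v = 0" "dot b v = 0" for v
    by (subst c) (simp add: dot_add_left dot_scale_left that)
  then show ?thesis by (auto simp: plane_dot)
qed

lemma plane_Int_subset:
  assumes "a \<noteq> 0" "b \<noteq> 0" "plane a \<noteq> plane b" "plane a \<inter> plane b \<subseteq> plane c"
  shows "\<exists>s t. c = s *s a + t *s b"
proof -
  obtain u where u: "dot a u = 1" "dot b u = 0" using exists_dual_pair[OF assms(1-3)] by blast
  obtain w where w: "dot b w = 1" "dot a w = 0" using exists_dual_pair[OF assms(2,1)] assms(3) by metis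
  have "dot c v = dot (dot c u *s a + dot c w *s b) v" for v
  proof -
    have "v - dot a v *s u - dot b v *s w \<in> plane a \<inter> plane b"
      by (simp add: plane_dot dot_diff_right dot_scale_right u w)
    then have "dot c (v - dot a v *s u - dot b v *s w) = 0" using assms(4) plane_dot by blast
    then show ?thesis by (simp add: dot_diff_right dot_add_right dot_scale_right dot_scale_left dot_add_left algebra_simps)
  qed
  then show ?thesis using dot_eqI by blast
qed

text \<open>Modulo the ideal of a point all variables are multiples of a single one.\<close>

lemma point_quotient:
  assumes "a \<noteq> 0" "b \<noteq> 0" "plane a \<noteq> plane b"
  shows "\<exists>l. \<forall>n p. homogeneous n p \<longrightarrow>
    (\<exists>c. p - Const c * Var l ^ n \<in> ideal2 (linear_form a) (linear_form b))"
proof -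
  let ?I = "ideal2 (linear_form a) (linear_form b)"
  \<comment> \<open>If all 2x2 minors vanished, a and b would be proportional and the planes
    equal.\<close>
  have "\<exists>i j. a $ i * b $ j - a $ j * b $ i \<noteq> 0"
  proof (rule ccontr)
    assume "\<not> ?thesis"
    then have m: "a $ i * b $ j = a $ j * b $ i" for i j by auto
    obtain i where i: "a $ i \<noteq> 0" using assms(1) by (auto simp: Finite_Cartesian_Product.vec_eq_iff)
    have "b = (b $ i / a $ i) *s a"
      using i m[of i] by (auto simp: Finite_Cartesian_Product.vec_eq_iff field_simps)
    moreover from this have "b $ i / a $ i \<noteq> 0" using assms(2) by (metis vector_smult_lzero)
    ultimately show False using assms(3) plane_scale by metis
  qed
  then obtain i j where m: "a $ i * b $ j - a $ j * b $ i \<noteq> 0" by blast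
  then have "i \<noteq> j" by auto
  then obtain l where l: "{i, j, l} = UNIV" "l \<noteq> i" "l \<noteq> j"
  proof -
    assume *: "\<And>l. \<lbrakk>{i, j, l} = UNIV; l \<noteq> i; l \<noteq> j\<rbrakk> \<Longrightarrow> thesis"
    have "card {i, j} = 2" using \<open>i \<noteq> j\<close> by simp
    then have "card (UNIV - {i, j} :: 3 set) = 1" by (subst card_Diff_subset) auto
    then obtain l where "UNIV - {i, j} = {l}" by (auto simp: card_1_singleton_iff)
    then show thesis using *[of l] by blast
  qed
  have lf: "linear_form c = Const (c $ i) * Var i + Const (c $ j) * Var j + Const (c $ l) * Var l" for c
    unfolding linear_form_def l(1)[symmetric] using l(2,3) \<open>i \<noteq> j\<close> by (simp add: add_ac)
  let ?m = "a $ i * b $ j - a $ j * b $ i"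
  \<comment> \<open>Cramer's rule modulo the ideal: combine both forms so that the j-th variable
    cancels and divide by the minor. The indices are generalized because the statement is used again
    with i and j exchanged.\<close>
  have v: "Var i - Const c * Var l \<in> ?I"
    if "c = - (a $ l * b $ j - a $ j * b $ l) / (a $ i * b $ j - a $ j * b $ i)" "a $ i * b $ j - a $ j * b $ i \<noteq> 0"
      "\<And>c :: 'a ^ 3. linear_form c = Const (c $ i) * Var i + Const (c $ j) * Var j + Const (c $ l) * Var l" for i j l c
  proof -
    let ?m = "a $ i * b $ j - a $ j * b $ i"
    have "?m * c = - (a $ l * b $ j - a $ j * b $ l)" using that(1,2) by simp
    then have mc: "a $ l * b $ j - a $ j * b $ l = - (?m * c)" by simp
    have "linear_form a * Const (b $ j) + linear_form b * Const (- a $ j) =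
        Const ?m * Var i + Const (a $ l * b $ j - a $ j * b $ l) * Var l"
      unfolding that(3)[of a] that(3)[of b] by (simp add: Const_mult Const_diff Const_uminus algebra_simps)
    also have "\<dots> = Const ?m * (Var i - Const c * Var l)"
      unfolding mc Const_uminus Const_mult by (simp add: algebra_simps)
    finally have "Const (inverse ?m) * (linear_form a * Const (b $ j) + linear_form b * Const (- a $ j)) =
        (Const (inverse ?m) * Const ?m) * (Var i - Const c * Var l)"
      by (simp only: mult.assoc)
    then have "Var i - Const c * Var l =
        linear_form a * (Const (inverse ?m) * Const (b $ j)) + linear_form b * (Const (inverse ?m) * Const (- a $ j))"
      unfolding Const_inverse[OF that(2)] by (simp only: algebra_simps mult_1_left)
    then show ?thesis by (rule ideal2I)
  qed
  have "\<exists>c. Var h - Const c * Var l \<in> ?I" for h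
  proof -
    have "h = i \<or> h = j \<or> h = l" using l(1) by blast
    then show ?thesis
    proof (elim disjE)
      assume "h = i"
      then show ?thesis using v[OF refl m lf] by blast
    next
      assume "h = j"
      have m': "a $ j * b $ i - a $ i * b $ j \<noteq> 0" using m by simp
      show ?thesis using v[OF refl m', of l] lf \<open>h = j\<close> by (metis add.commute)
    next
      assume "h = l"
      then show ?thesis by (intro exI[of _ 1]) (simp add: ideal2_0)
    qed
  qed
  then obtain q where q: "\<And>h. Var h - Const (q h) * Var l \<in> ?I" by metis
  have "\<exists>c. p - Const c * Var l ^ n \<in> ?I" if "homogeneous n p" for n p
    using that
  proof (induction rule: homogeneous_induct)
    case (Const c)
    then show ?case by (intro exI[of _ c]) (simp add: ideal2_0)
  next
    case (add n p p')
    then obtain c c' where "p - Const c * Var l ^ n \<in> ?I" "p' - Const c' * Var l ^ n \<in> ?I" by blast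
    then have "(p - Const c * Var l ^ n) + (p' - Const c' * Var l ^ n) \<in> ?I" by (rule ideal2_add)
    then show ?case by (intro exI[of _ "c + c'"]) (simp add: Const_add algebra_simps)
  next
    case (Var n h p)
    then obtain c where c: "p - Const c * Var l ^ n \<in> ?I" by blast
    have "Var h * (p - Const c * Var l ^ n) + (Const c * Var l ^ n) * (Var h - Const (q h) * Var l) \<in> ?I"
      by (intro ideal2_add ideal2_mult c q)
    then show ?case by (intro exI[of _ "c * q h"]) (simp add: Const_mult algebra_simps)
  qed
  then show ?thesis by blast
qed

subsection \<open>Planes\<close>

definition is_plane :: "('k::field_char_0 ^ 3) set \<Rightarrow> bool" where
  "is_plane H \<longleftrightarrow> (\<exists>a. a \<noteq> 0 \<and> H = plane a)"

lemma arrangement_is_plane: "arrangement A \<longleftrightarrow> finite A \<and> (\<forall>H\<in>A. is_plane H)"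
  by (simp add: arrangement_def is_plane_def)

definition normal :: "('k::field_char_0 ^ 3) set \<Rightarrow> 'k ^ 3" where
  "normal H = (SOME a. a \<noteq> 0 \<and> H = plane a)"

lemma plane_form_normal: "plane_form H = linear_form (normal H)"
  by (simp add: plane_form_def normal_def)

lemma normal:
  assumes "is_plane H"
  shows "normal H \<noteq> 0" "plane (normal H) = H"
proof -
  have "normal H \<noteq> 0 \<and> H = plane (normal H)"
    unfolding normal_def using assms unfolding is_plane_def by (rule someI_ex)
  then show "normal H \<noteq> 0" "plane (normal H) = H" by auto
qed

lemma homogeneous_plane_form [simp]: "homogeneous (Suc 0) (plane_form H)"
  by (simp add: plane_form_normal)

lemma prime_plane_form: "is_plane H \<Longrightarrow> prime_elem (plane_form H)"
  by (simp add: plane_form_normal prime_linear_form normal)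

lemma plane_form_neq_0: "is_plane H \<Longrightarrow> plane_form H \<noteq> 0"
  by (simp add: plane_form_normal linear_form_eq_0 normal)

lemma plane_form_dvd:
  assumes "is_plane H" "is_plane K" "plane_form H dvd plane_form K"
  shows "H = K"
proof -
  obtain c where c: "normal K = c *s normal H"
    using linear_form_dvd assms by (metis normal(1) plane_form_normal)
  then have "c \<noteq> 0" using normal(1)[OF assms(2)] by auto
  then show ?thesis using c assms normal(2) plane_scale by metis
qed

text \<open>L belongs to the pencil of H and K. Because t is nonzero, the form of L can replace that
  of K modulo the form of H, up to a unit.\<close>

lemma plane_form_span:
  assumes "is_plane H" "is_plane K" "is_plane L" "H \<noteq> K" "H \<inter> K \<subseteq> L" "L \<noteq> H"
  shows "\<exists>s t. t \<noteq> 0 \<and> plane_form L = Const s * plane_form H + Const t * plane_form K"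
proof -
  obtain s t where st: "normal L = s *s normal H + t *s normal K"
    using plane_Int_subset[of "normal H" "normal K" "normal L"] assms normal by metis
  then have "plane_form L = Const s * plane_form H + Const t * plane_form K"
    by (simp add: plane_form_normal linear_form_add linear_form_scale)
  moreover have "t \<noteq> 0"
  proof
    assume "t = 0"
    then have "plane_form H dvd plane_form L" using calculation by simp
    then show False using plane_form_dvd assms by blast
  qed
  ultimately show ?thesis by blast
qed

lemma plane_subset_plane: "is_plane H \<Longrightarrow> is_plane K \<Longrightarrow> H \<subseteq> K \<Longrightarrow> H = K"
  using plane_subset_eq by (metis normal)

section \<open>The defining polynomial and logarithmic derivations\<close>

lemma prime_elem_dvd_prod:
  assumes "prime_elem p" "finite S" "p dvd prod f S"
  shows "\<exists>x\<in>S. p dvd f x"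
  using assms(2,3)
proof (induction S rule: finite_induct)
  case empty
  then show ?case using prime_elem_not_unit[OF assms(1)] by simp
next
  case (insert x S)
  then show ?case using prime_elem_dvd_multD[OF assms(1), of "f x" "prod f S"] by auto
qed

lemma prod_prime_dvd:
  fixes f :: "'i \<Rightarrow> 'a::idom"
  assumes "finite S" "\<And>x. x \<in> S \<Longrightarrow> prime_elem (f x)"
    and "\<And>x y. x \<in> S \<Longrightarrow> y \<in> S \<Longrightarrow> f x dvd f y \<Longrightarrow> x = y"
    and "\<And>x. x \<in> S \<Longrightarrow> f x dvd p"
  shows "prod f S dvd p"
  using assms
proof (induction S arbitrary: p rule: finite_induct)
  case (insert x F)
  then have "prod f F dvd p" by auto
  then obtain c where c: "p = prod f F * c" by blast
  have x: "prime_elem (f x)" using insert by auto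
  have "\<not> f x dvd prod f F"
  proof
    assume "f x dvd prod f F"
    from prime_elem_dvd_prod[OF x insert(1) this] obtain y where "y \<in> F" "f x dvd f y" by blast
    then have "x = y" using insert(5)[of x y] by simp
    then show False using insert(2) \<open>y \<in> F\<close> by simp
  qed
  then have "f x dvd c" using insert(6)[of x] prime_elem_dvd_multD[OF x] c by auto
  then show ?case using insert c by (simp add: mult_dvd_mono mult.commute)
qed simp

text \<open>Coefficient vectors of D(B). Testing tangency line by line, instead of on the product Q,
  turns the addition of a line into one further condition.\<close>

definition log_vf :: "('k::field_char_0 ^ 3) set set \<Rightarrow> (3 \<Rightarrow> 'k poly3) set" where
  "log_vf B = {v. \<forall>H\<in>B. plane_form H dvd der v (plane_form H)}"

lemma defining_poly_dvd:
  assumes "arrangement B" "\<And>H. H \<in> B \<Longrightarrow> plane_form H dvd p"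
  shows "defining_poly B dvd p"
  unfolding defining_poly_def
  by (rule prod_prime_dvd) (use assms in \<open>auto simp: arrangement_is_plane prime_plane_form plane_form_dvd\<close>)

lemma defining_poly_neq_0: "arrangement B \<Longrightarrow> defining_poly B \<noteq> 0"
  by (auto simp: defining_poly_def arrangement_is_plane plane_form_neq_0)

lemma homogeneous_defining_poly: "homogeneous (card B) (defining_poly B)"
  unfolding defining_poly_def using homogeneous_prod[of B "\<lambda>_. Suc 0" plane_form] by simp

text \<open>Write Q = alpha q. Modulo alpha the product rule leaves only theta(alpha) q, and alpha
  is prime and does not divide q because the lines are distinct.\<close>

lemma log_vf_iff:
  assumes B: "arrangement B"
  shows "v \<in> log_vf B \<longleftrightarrow> defining_poly B dvd der v (defining_poly B)"
proof
  assume "v \<in> log_vf B"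
  then show "defining_poly B dvd der v (defining_poly B)"
    unfolding defining_poly_def log_vf_def using B by (intro der_prod_dvd) (auto simp: arrangement_def)
next
  assume d: "defining_poly B dvd der v (defining_poly B)"
  have "plane_form H dvd der v (plane_form H)" if H: "H \<in> B" for H
  proof -
    let ?q = "prod plane_form (B - {H})"
    have fin: "finite B" using B by (simp add: arrangement_def)
    have Q: "defining_poly B = plane_form H * ?q"
      unfolding defining_poly_def using fin H by (rule prod.remove)
    have "plane_form H dvd der v (plane_form H) * ?q + plane_form H * der v ?q"
      using d unfolding Q der_mult by (metis dvd_mult_left)
    then have d1: "plane_form H dvd der v (plane_form H) * ?q"
      by (simp add: dvd_add_left_iff)
    have pr: "prime_elem (plane_form H)" using B H by (auto simp: arrangement_is_plane prime_plane_form)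
    have d2: "\<not> plane_form H dvd ?q"
    proof
      assume "plane_form H dvd ?q"
      from prime_elem_dvd_prod[OF pr _ this] fin obtain K
        where "K \<in> B - {H}" "plane_form H dvd plane_form K" by blast
      then show False using plane_form_dvd B H by (auto simp: arrangement_is_plane)
    qed
    show ?thesis using prime_elem_dvd_multD[OF pr d1] d2 by simp
  qed
  then show "v \<in> log_vf B" by (simp add: log_vf_def)
qed

section \<open>Adding a line\<close>

lemma der_power: "der v (p ^ n) = of_nat n * p ^ (n - 1) * der v p"
proof (induction n)
  case (Suc n)
  then show ?case by (cases n) (simp_all add: der_mult algebra_simps)
qed simp

lemma hc_diff: "hc n (p - q) = hc n p - hc n q"
  using hc_add[of n "p - q" q] by simp

lemma hc_Const_mult: "hc n (Const c * p) = Const c * hc n p"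
  by (subst hc_mult_left[OF homogeneous_Const]) simp

lemma dvd_hc:
  assumes "homogeneous i a" "a dvd p"
  shows "a dvd hc n p"
  using assms by (auto simp: hc_mult_left)

definition vhc :: "nat \<Rightarrow> ('i \<Rightarrow> 'k::field_char_0 poly3) \<Rightarrow> 'i \<Rightarrow> 'k poly3" where
  "vhc n v = (\<lambda>i. hc n (v i))"

lemma vhc_in_vforms [simp]: "vhc n v \<in> vforms n"
  by (simp add: vhc_def vforms_def)

lemma vhc_vforms: "v \<in> vforms n \<Longrightarrow> vhc n v = v"
  unfolding vhc_def by (rule ext) (simp add: vforms_def hc_homogeneous[of n])

lemma der_vhc_linear_form: "der (vhc n v) (linear_form a) = hc n (der v (linear_form a))"
  by (simp add: der_linear_form vhc_def hc_sum hc_Const_mult)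

lemma log_vf_vhc:
  assumes "v \<in> log_vf B"
  shows "vhc n v \<in> log_vf B"
proof -
  have "plane_form H dvd der (vhc n v) (plane_form H)" if "H \<in> B" for H
  proof -
    have "plane_form H dvd der v (plane_form H)" using assms that by (simp add: log_vf_def)
    from dvd_hc[OF homogeneous_plane_form this, of n] show ?thesis
      by (simp add: plane_form_normal der_vhc_linear_form)
  qed
  then show ?thesis by (simp add: log_vf_def)
qed

lemma log_vf_0: "0 \<in> log_vf B"
  by (simp add: log_vf_def)

lemma log_vf_add: "v \<in> log_vf B \<Longrightarrow> w \<in> log_vf B \<Longrightarrow> v + w \<in> log_vf B"
  by (simp add: log_vf_def der_plus_vec)

lemma log_vf_pscale: "v \<in> log_vf B \<Longrightarrow> pscale p v \<in> log_vf B"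
  by (simp add: log_vf_def der_pscale)

lemma log_vf_sum: "(\<And>x. x \<in> S \<Longrightarrow> f x \<in> log_vf B) \<Longrightarrow> sum f S \<in> log_vf B"
  by (induction S rule: infinite_finite_induct) (simp_all only: sum.infinite sum.empty sum.insert log_vf_0 log_vf_add insert_iff not_False_eq_True simp_thms)

lemma subspace_log_vf: "kV.subspace (log_vf B \<inter> vforms m)"
proof (rule kV.subspace_inter[OF _ subspace_vforms])
  show "kV.subspace (log_vf B)"
    unfolding kV.subspace_def kvscale_def by (blast intro: log_vf_0 log_vf_add log_vf_pscale)
qed

lemma linear_der: "Vector_Spaces.linear kvscale kscale (\<lambda>v. der v p)"
  by unfold_locales (simp_all only: der_plus_vec kvscale_def kscale_def der_pscale)

lemma linear_mult: "Vector_Spaces.linear kscale kscale (\<lambda>p. q * p)"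
  by unfold_locales (simp_all add: kscale_def algebra_simps)

lemma dim_mult_forms:
  fixes q :: "'k::field_char_0 poly3"
  assumes "q \<noteq> 0"
  shows "kR.dim ((\<lambda>p. q * p) ` forms m) = rdim m"
proof -
  obtain F :: "'k poly3 set" where F: "finite F" "forms m \<subseteq> kR.span F"
    using forms_finite_span by blast
  have "kR.dim ((\<lambda>p. q * p) ` forms m) = kR.dim (forms m :: 'k poly3 set)"
    by (rule kRR.dim_image_inj[OF linear_mult subspace_forms F(2,1)]) (use assms in auto)
  then show ?thesis by (simp add: dim_forms)
qed

lemma subspace_mult_forms: "kR.subspace ((\<lambda>p. q * p) ` forms m)"
proof -
  interpret Vector_Spaces.linear kscale kscale "\<lambda>p. q * p" by (rule linear_mult)
  show ?thesis by (rule subspace_image[OF subspace_forms])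
qed

text \<open>Ideal membership computations in plain letters. The first two serve
  \<open>log_vf_local\<close>, with p the product of the forms through a point, b the equation of
  the point and q a power of b; the third serves \<open>ideal_power_cancel\<close>, the fourth
  \<open>ideal_prod_powers\<close>.\<close>

lemma poly3_identities:
  fixes a b d :: "'k::field_char_0 poly3"
  shows "\<lbrakk>p = a * z + u * (b * q); a * e - b * d = p * y\<rbrakk> \<Longrightarrow> b * (d + u * y * q) = a * (e - z * y)"
    and "d + u * y * q = a * x \<Longrightarrow> d = a * x + q * - (u * y)"
    and "g * (a * w + q * z') = a * y1 + b * q * y2 \<Longrightarrow> q * (g * z' - b * y2) = a * (y1 - g * w)"
    and "\<lbrakk>p = a * y + g * z; p = a * y' + b * z'\<rbrakk> \<Longrightarrow> g * z = a * (y' - y) + b * z'"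
  by Groebner_Basis.algebra+

lemma prod_cong_mod:
  fixes f g :: "'i \<Rightarrow> 'a::comm_ring_1"
  assumes "\<And>x. x \<in> S \<Longrightarrow> a dvd f x - g x"
  shows "a dvd prod f S - prod g S"
  using assms
proof (induction S rule: infinite_finite_induct)
  case (insert x S)
  have "prod f (insert x S) - prod g (insert x S) = (f x - g x) * prod f S + g x * (prod f S - prod g S)"
    using insert(1,2) by (simp add: algebra_simps)
  then show ?case using insert by (metis dvd_add dvd_mult dvd_mult2 insertCI)
qed simp_all

text \<open>Modulo a, every factor is a nonzero constant times b.\<close>

lemma prod_pencil:
  assumes "finite S" "\<And>K. K \<in> S \<Longrightarrow> \<exists>s t. t \<noteq> 0 \<and> f K = Const s * a + Const t * b"
  shows "\<exists>u. u \<noteq> 0 \<and> a dvd prod f S - Const u * b ^ card S"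
  using assms
proof (induction S rule: finite_induct)
  case empty
  then show ?case by (intro exI[of _ 1]) simp
next
  case (insert K S)
  then obtain u where u: "u \<noteq> 0" "a dvd prod f S - Const u * b ^ card S" by auto
  have "\<exists>s t. t \<noteq> 0 \<and> f K = Const s * a + Const t * b" by (rule insert(4)) simp
  then obtain s t where st: "t \<noteq> 0" "f K = Const s * a + Const t * b" by blast
  have "prod f (insert K S) - Const (t * u) * b ^ card (insert K S)
      = f K * (prod f S - Const u * b ^ card S) + a * (Const s * (Const u * b ^ card S))"
    using insert(1,2) by (simp add: st(2) Const_mult algebra_simps)
  then have "a dvd prod f (insert K S) - Const (t * u) * b ^ card (insert K S)"
    using u(2) by (metis dvd_add dvd_mult dvd_triv_left)
  then show ?case using u(1) st(1) by (intro exI[of _ "t * u"]) auto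
qed

lemma in_plane_ev: "is_plane K \<Longrightarrow> v \<in> K \<longleftrightarrow> ev (\<lambda>i. v $ i) (plane_form K) = 0"
  by (simp add: plane_form_normal ev_linear_form flip: plane_dot) (simp add: normal)

section \<open>The values of logarithmic derivations on the form of the added line\<close>

context
  fixes B :: "('k::field_char_0 ^ 3) set set" and H
  assumes B: "arrangement B" and H: "is_plane H" and HB: "H \<notin> B"
begin

text \<open>In large degrees the values \<open>\<theta>(\<alpha>)\<close> of the derivations \<open>\<theta>\<close> of \<open>B\<close> are, modulo \<open>\<alpha>\<close>, exactly the
  multiples of \<open>pi_poly\<close>.\<close>

definition pts where "pts = (\<lambda>K. H \<inter> K) ` B"
definition fib where "fib X = {K \<in> B. H \<inter> K = X}"
definition rep where "rep X = (SOME K. K \<in> B \<and> H \<inter> K = X)"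
text \<open>Restricted to H this is an equation of the point X; by \<open>fib_form\<close> every
  line of \<open>fib X\<close> gives the same one up to a nonzero constant.\<close>

definition bform where "bform X = plane_form (rep X)"
text \<open>If r lines of B pass through X, tangency to all of them forces theta(alpha), restricted
  to H, to vanish at X to order r - 1. The exponents add up to the number of lines minus the number
  of points.\<close>

definition pi_poly where "pi_poly = (\<Prod>X\<in>pts. bform X ^ (card (fib X) - 1))"

abbreviation (input) "\<alpha> \<equiv> plane_form H"

lemma finB: "finite B" and planeB: "K \<in> B \<Longrightarrow> is_plane K"
  using B by (auto simp: arrangement_is_plane)

lemma fin_pts: "finite pts" and fin_fib: "finite (fib X)"
  using finB by (auto simp: pts_def fib_def)

lemma rep:
  assumes "X \<in> pts"
  shows "rep X \<in> B" "H \<inter> rep X = X" "is_plane (rep X)" "rep X \<noteq> H"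
proof -
  have "\<exists>K. K \<in> B \<and> H \<inter> K = X" using assms by (auto simp: pts_def)
  from someI_ex[OF this] have "rep X \<in> B \<and> H \<inter> rep X = X" unfolding rep_def .
  then show "rep X \<in> B" "H \<inter> rep X = X" "is_plane (rep X)" "rep X \<noteq> H"
    using planeB HB by auto
qed

lemma fib_form:
  assumes "X \<in> pts" "K \<in> fib X"
  shows "\<exists>s t. t \<noteq> 0 \<and> plane_form K = Const s * \<alpha> + Const t * bform X"
  unfolding bform_def
proof (rule plane_form_span[OF H rep(3)[OF assms(1)]])
  show "is_plane K" "K \<noteq> H" using assms(2) planeB HB by (auto simp: fib_def)
  show "H \<noteq> rep X" using rep(4)[OF assms(1)] by simp
  show "H \<inter> rep X \<subseteq> K" using rep(2)[OF assms(1)] assms(2) by (auto simp: fib_def)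
qed

lemma card_fib: "X \<in> pts \<Longrightarrow> card (fib X) > 0"
  using fin_fib by (auto simp: card_gt_0_iff fib_def pts_def)

lemma sum_card_fib: "(\<Sum>X\<in>pts. card (fib X)) = card B"
proof -
  have "card (\<Union>X\<in>pts. fib X) = (\<Sum>X\<in>pts. card (fib X))"
  proof (rule card_UN_disjoint[OF fin_pts])
    show "\<forall>X\<in>pts. finite (fib X)" using fin_fib by blast
  qed (auto simp: fib_def)
  moreover have "(\<Union>X\<in>pts. fib X) = B" by (auto simp: fib_def pts_def)
  ultimately show ?thesis by simp
qed

lemma card_pts_le: "card pts \<le> card B"
  unfolding pts_def by (rule card_image_le[OF finB])

lemma sum_mult: "(\<Sum>X\<in>pts. card (fib X) - 1) = card B - card pts"
proof -
  have "(\<Sum>X\<in>pts. card (fib X)) = (\<Sum>X\<in>pts. (card (fib X) - 1) + 1)"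
    using card_fib by (intro sum.cong) auto
  then show ?thesis using sum_card_fib by (simp only: sum.distrib) simp
qed

lemma homogeneous_pi: "homogeneous (card B - card pts) pi_poly"
  unfolding pi_poly_def sum_mult[symmetric]
proof (rule homogeneous_prod)
  show "homogeneous (card (fib X) - 1) (bform X ^ (card (fib X) - 1))" for X
    using homogeneous_power[of "Suc 0" "bform X" "card (fib X) - 1"] by (simp add: bform_def)
qed

lemma prime_alpha: "prime_elem \<alpha>"
  by (rule prime_plane_form[OF H])

lemma alpha_not_dvd: "X \<in> pts \<Longrightarrow> \<not> \<alpha> dvd bform X"
  using plane_form_dvd[OF H rep(3)] rep(4) unfolding bform_def by blast

lemma alpha_not_dvd_power: "X \<in> pts \<Longrightarrow> \<not> \<alpha> dvd bform X ^ n"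
  using prime_elem_dvd_power[OF prime_alpha] alpha_not_dvd by blast

lemma planes_neq: "X \<in> pts \<Longrightarrow> plane (normal H) \<noteq> plane (normal (rep X))"
  using normal H rep by metis

lemma point_ideal_prime:
  "X \<in> pts \<Longrightarrow> p * q \<in> ideal2 \<alpha> (bform X) \<Longrightarrow> p \<in> ideal2 \<alpha> (bform X) \<or> q \<in> ideal2 \<alpha> (bform X)"
  unfolding bform_def plane_form_normal
  by (rule ideal2_prime[OF normal(1)[OF H] normal(1)[OF rep(3)] planes_neq])

lemma one_notin_point_ideal: "X \<in> pts \<Longrightarrow> 1 \<notin> ideal2 \<alpha> (bform X)"
  unfolding bform_def plane_form_normal
  by (rule one_notin_ideal2[OF normal(1)[OF H] normal(1)[OF rep(3)] planes_neq])

lemma bform_notin_point_ideal: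
  assumes X: "X \<in> pts" and Y: "Y \<in> pts" and "X \<noteq> Y"
  shows "bform Y \<notin> ideal2 \<alpha> (bform X)"
proof
  assume "bform Y \<in> ideal2 \<alpha> (bform X)"
  then have "plane (normal H) \<inter> plane (normal (rep X)) \<subseteq> plane (normal (rep Y))"
    unfolding bform_def plane_form_normal
    by (rule linear_form_in_ideal2[OF normal(1)[OF H] normal(1)[OF rep(3)[OF X]] planes_neq[OF X]])
  then have sub: "H \<inter> rep X \<subseteq> rep Y" using normal(2) H rep(3) X Y by metis
  obtain s t where st: "t \<noteq> 0" "plane_form (rep Y) = Const s * \<alpha> + Const t * plane_form (rep X)"
    using plane_form_span[OF H rep(3)[OF X] rep(3)[OF Y] rep(4)[OF X, symmetric] sub rep(4)[OF Y]] by blast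
  have "v \<in> rep X" if "v \<in> H" "v \<in> rep Y" for v
    using that st unfolding in_plane_ev[OF H] in_plane_ev[OF rep(3)[OF X]] in_plane_ev[OF rep(3)[OF Y]]
    by (simp add: ev.hom_add ev.hom_mult)
  then have "Y \<subseteq> X" using rep(2)[OF X] rep(2)[OF Y] by blast
  moreover have "X \<subseteq> Y" using sub rep(2)[OF X] rep(2)[OF Y] by blast
  ultimately show False using \<open>X \<noteq> Y\<close> by simp
qed

lemma prod_fib:
  "X \<in> pts \<Longrightarrow> \<exists>u. u \<noteq> 0 \<and> \<alpha> dvd prod plane_form (fib X) - Const u * bform X ^ card (fib X)"
  by (rule prod_pencil[OF fin_fib fib_form])

text \<open>With \<open>\<beta> = bform X\<close>, the expression \<open>\<alpha> \<theta>(\<beta>) - \<beta> \<theta>(\<alpha>)\<close> is divisible by every form through \<open>X\<close>.\<close>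

lemma log_vf_local:
  assumes v: "v \<in> log_vf B" and X: "X \<in> pts"
  shows "der v \<alpha> \<in> ideal2 \<alpha> (bform X ^ (card (fib X) - 1))"
proof -
  let ?b = "bform X"
  let ?F = "\<alpha> * der v ?b - ?b * der v \<alpha>"
  have "plane_form K dvd ?F" if K: "K \<in> fib X" for K
  proof -
    obtain s t where st: "t \<noteq> 0" "plane_form K = Const s * \<alpha> + Const t * ?b"
      using fib_form[OF X K] by blast
    have "plane_form K dvd der v (plane_form K)" using v K by (auto simp: log_vf_def fib_def)
    then obtain y where y: "der v (plane_form K) = plane_form K * y" by blast
    \<comment> \<open>The expression is alternating in the two forms, so replacing \<beta> by s
      \<alpha> + t \<beta> multiplies it by t.\<close>
    have "Const t * ?F = \<alpha> * der v (plane_form K) - plane_form K * der v \<alpha>"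
      unfolding st(2) der_add der_Const_mult by (simp add: algebra_simps)
    also have "\<dots> = plane_form K * (\<alpha> * y - der v \<alpha>)" by (simp add: y algebra_simps)
    finally have "plane_form K dvd Const (inverse t) * (Const t * ?F)" by simp
    then show ?thesis using Const_inverse[OF st(1)] by (simp only: mult.assoc[symmetric] mult_1_left)
  qed
  then have "prod plane_form (fib X) dvd ?F"
    by (intro prod_prime_dvd fin_fib) (auto simp: fib_def planeB prime_plane_form plane_form_dvd)
  then obtain y where y: "?F = prod plane_form (fib X) * y" by blast
  obtain u z where u: "prod plane_form (fib X) - Const u * ?b ^ card (fib X) = \<alpha> * z"
    using prod_fib[OF X] by blast
  have "?b ^ card (fib X) = ?b * ?b ^ (card (fib X) - 1)"
    using card_fib[OF X] by (metis power_eq_if less_not_refl)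
  then have "prod plane_form (fib X) = \<alpha> * z + Const u * (?b * ?b ^ (card (fib X) - 1))"
    using u by (simp add: algebra_simps)
  \<comment> \<open>Modulo \<alpha> the left side of y is -\<beta> theta(\<alpha>) and the product
    of the forms through X is a constant times the full power of \<beta>. Cancelling one \<beta>
    leaves the exponent \<open>card (fib X) - 1\<close>.\<close>
  then have "?b * (der v \<alpha> + Const u * y * ?b ^ (card (fib X) - 1)) = \<alpha> * (der v ?b - z * y)"
    using y by (rule poly3_identities(1))
  then have "\<alpha> dvd ?b * (der v \<alpha> + Const u * y * ?b ^ (card (fib X) - 1))" by simp
  then have "\<alpha> dvd der v \<alpha> + Const u * y * ?b ^ (card (fib X) - 1)"
    using prime_elem_dvd_multD[OF prime_alpha] alpha_not_dvd[OF X] by blast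
  then obtain x where "der v \<alpha> + Const u * y * ?b ^ (card (fib X) - 1) = \<alpha> * x" by blast
  then have "der v \<alpha> = \<alpha> * x + ?b ^ (card (fib X) - 1) * - (Const u * y)" by (rule poly3_identities(2))
  then show ?thesis by (rule ideal2I)
qed

text \<open>On H the polynomial g does not vanish at X, so it cancels against powers of the equation
  of X. One power is gained per step: \<alpha> is prime and does not divide
  \<open>bform X ^ n\<close>, and the ideal of X is prime.\<close>

lemma ideal_power_cancel:
  assumes X: "X \<in> pts" and g: "g \<notin> ideal2 \<alpha> (bform X)"
    and "g * z \<in> ideal2 \<alpha> (bform X ^ n)"
  shows "z \<in> ideal2 \<alpha> (bform X ^ n)"
  using assms(3)
proof (induction n)
  case 0
  then show ?case by (intro ideal2I[of _ _ 0 _ z]) simp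
next
  case (Suc n)
  let ?b = "bform X"
  obtain y1 y2 where y: "g * z = \<alpha> * y1 + ?b ^ Suc n * y2" using Suc(2) by (rule ideal2E)
  then have "g * z \<in> ideal2 \<alpha> (?b ^ n)" by (intro ideal2I[of _ _ y1 _ "?b * y2"]) simp
  then obtain w z' where z: "z = \<alpha> * w + ?b ^ n * z'" using Suc(1) ideal2E by metis
  have "?b ^ n * (g * z' - ?b * y2) = \<alpha> * (y1 - g * w)"
    using y unfolding z power_Suc by (rule poly3_identities(3))
  then have "\<alpha> dvd ?b ^ n * (g * z' - ?b * y2)" by simp
  then have "\<alpha> dvd g * z' - ?b * y2"
    using prime_elem_dvd_multD[OF prime_alpha] alpha_not_dvd_power[OF X] by blast
  then obtain x where "g * z' - ?b * y2 = \<alpha> * x" by blast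
  then have "g * z' = \<alpha> * x + ?b * y2" by Groebner_Basis.algebra
  then have "g * z' \<in> ideal2 \<alpha> ?b" by (rule ideal2I)
  then have "z' \<in> ideal2 \<alpha> ?b" using point_ideal_prime[OF X] g by blast
  then obtain s t where "z' = \<alpha> * s + ?b * t" by (rule ideal2E)
  then have "z = \<alpha> * (w + ?b ^ n * s) + ?b ^ Suc n * t" unfolding z by (simp add: algebra_simps)
  then show ?case by (rule ideal2I)
qed

lemma prod_notin_point_ideal:
  assumes "finite S" "S \<subseteq> pts" "X \<in> pts" "X \<notin> S"
  shows "(\<Prod>Y\<in>S. bform Y ^ n Y) \<notin> ideal2 \<alpha> (bform X)"
  using assms(1,2,4)
proof (induction S rule: finite_induct)
  case empty
  then show ?case using one_notin_point_ideal[OF assms(3)] by simp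
next
  case (insert Y S)
  have pow: "bform Y ^ k \<notin> ideal2 \<alpha> (bform X)" for k
  proof (induction k)
    case 0
    then show ?case using one_notin_point_ideal[OF assms(3)] by simp
  next
    case (Suc k)
    then show ?case
      using point_ideal_prime[OF assms(3)] bform_notin_point_ideal[OF assms(3), of Y] insert(4,5) by auto
  qed
  have "(\<Prod>Y\<in>S. bform Y ^ n Y) \<notin> ideal2 \<alpha> (bform X)" using insert by auto
  then have "bform Y ^ n Y * (\<Prod>Y\<in>S. bform Y ^ n Y) \<notin> ideal2 \<alpha> (bform X)"
    using pow point_ideal_prime[OF assms(3)] by blast
  then show ?case using insert(1,2) by simp
qed

text \<open>On H the equations of distinct points are coprime, so divisibility by each power gives
  divisibility by their product.\<close>

lemma ideal_prod_powers:
  assumes "finite S" "S \<subseteq> pts" "\<And>X. X \<in> S \<Longrightarrow> p \<in> ideal2 \<alpha> (bform X ^ n X)"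
  shows "p \<in> ideal2 \<alpha> (\<Prod>X\<in>S. bform X ^ n X)"
  using assms
proof (induction S rule: finite_induct)
  case empty
  show ?case by (rule ideal2I[of _ _ 0 _ p]) simp
next
  case (insert X S)
  let ?g = "\<Prod>X\<in>S. bform X ^ n X"
  have X: "X \<in> pts" using insert by auto
  have "p \<in> ideal2 \<alpha> ?g" using insert by auto
  then obtain y z where p: "p = \<alpha> * y + ?g * z" by (rule ideal2E)
  obtain y' z' where p': "p = \<alpha> * y' + bform X ^ n X * z'" using insert(5)[of X] by (auto elim: ideal2E)
  have "?g * z = \<alpha> * (y' - y) + bform X ^ n X * z'" using p p' by (rule poly3_identities(4))
  then have "?g * z \<in> ideal2 \<alpha> (bform X ^ n X)" by (rule ideal2I)
  then have "z \<in> ideal2 \<alpha> (bform X ^ n X)"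
    using ideal_power_cancel[OF X] prod_notin_point_ideal[OF insert(1) _ X insert(2)] insert(4) by blast
  then obtain s t where z: "z = \<alpha> * s + bform X ^ n X * t" by (rule ideal2E)
  have "p = \<alpha> * (y + ?g * s) + (bform X ^ n X * ?g) * t"
    unfolding p z by (simp add: algebra_simps)
  then show ?case using insert(1,2) by (auto intro: ideal2I)
qed

lemma log_vf_image_subset: "v \<in> log_vf B \<Longrightarrow> der v \<alpha> \<in> ideal2 \<alpha> pi_poly"
  unfolding pi_poly_def by (rule ideal_prod_powers[OF fin_pts subset_refl log_vf_local])

text \<open>The Hamiltonian derivation of the product of the forms through \<open>X\<close>, multiplied by the other forms.\<close>

lemma log_vf_at_point:
  assumes X: "X \<in> pts"
  shows "\<exists>v\<in>log_vf B. \<exists>u. u \<noteq> 0 \<and> \<alpha> dvd der v \<alpha> - Const u * (pi_poly * (\<Prod>Y\<in>pts - {X}. bform Y))"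
proof -
  let ?b = "bform X" and ?m = "card (fib X)"
  define q where "q = prod plane_form (fib X)"
  obtain w1 where w1: "dot (normal H) w1 = 1" "dot (normal (rep X)) w1 = 0"
    using exists_dual_pair[OF normal(1)[OF H] normal(1)[OF rep(3)[OF X]] planes_neq[OF X]] by blast
  obtain w2 where w2: "dot (normal (rep X)) w2 = 1" "dot (normal H) w2 = 0"
    using exists_dual_pair[OF normal(1)[OF rep(3)[OF X]] normal(1)[OF H] planes_neq[OF X, symmetric]] by blast
  define W where "W w = (\<lambda>i. Const (w $ i))" for w :: "'k ^ 3"
  have W: "der (W w) (linear_form a) = Const (dot a w)" for w a
    by (simp add: der_linear_form W_def dot_def sum_3 Const_add Const_mult)
  \<comment> \<open>In directions dual to \<alpha> and \<beta>, with w1 along \<alpha> and w2 along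
    \<beta>, this is the field q_\<beta> d/d\<alpha> - q_\<alpha> d/d\<beta>.\<close>
  define v0 where "v0 = pscale (der (W w2) q) (W w1) - pscale (der (W w1) q) (W w2)"
  have v0: "der v0 f = der (W w2) q * der (W w1) f - der (W w1) q * der (W w2) f" for f
    unfolding v0_def der_minus_vec der_pscale ..
  define R where "R = prod plane_form (B - fib X)"
  have v: "der (pscale R v0) f = R * der v0 f" for f by (rule der_pscale)
  have log: "pscale R v0 \<in> log_vf B"
    unfolding log_vf_def
  proof (intro CollectI ballI)
    fix K assume K: "K \<in> B"
    show "plane_form K dvd der (pscale R v0) (plane_form K)"
    proof (cases "K \<in> fib X")
      case False
      then have "plane_form K dvd R" unfolding R_def using K finB by (intro dvd_prodI) auto
      then show ?thesis by (simp add: v)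
    next
      case True
      then have q: "q = plane_form K * prod plane_form (fib X - {K})"
        unfolding q_def by (rule prod.remove[OF fin_fib])
      \<comment> \<open>For a factor f of q = f q' the contributions f_\<beta> q' f_\<alpha> and
        f_\<alpha> q' f_\<beta> cancel, and only multiples of f remain.\<close>
      have "der v0 (plane_form K) = plane_form K *
         (der (W w2) (prod plane_form (fib X - {K})) * der (W w1) (plane_form K) -
          der (W w1) (prod plane_form (fib X - {K})) * der (W w2) (plane_form K))"
        unfolding v0 unfolding q der_mult by (simp add: algebra_simps)
      then show ?thesis by (simp add: v)
    qed
  qed
  obtain u z where u: "u \<noteq> 0" "q - Const u * ?b ^ ?m = \<alpha> * z"
    using prod_fib[OF X] unfolding q_def by blast
  have q: "q = Const u * ?b ^ ?m + \<alpha> * z" using u(2) by (simp add: algebra_simps)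
  have W1a: "der (W w1) \<alpha> = 1" and W2a: "der (W w2) \<alpha> = 0" and W2b: "der (W w2) ?b = 1"
    using w1 w2 by (simp_all add: plane_form_normal bform_def W)
  \<comment> \<open>The value on \<alpha> is q_\<beta>, and q is u \<beta>^r modulo \<alpha> with r
    the number of lines through X. The factor r coming from the derivative is invertible in
    characteristic 0.\<close>
  have "der v0 \<alpha> = Const (u * of_nat ?m) * ?b ^ (?m - 1) + \<alpha> * der (W w2) z"
    unfolding v0 W1a W2a unfolding q der_add der_mult der_power W2a W2b
    by (simp add: Const_mult Const_of_nat algebra_simps)
  then have e1: "\<alpha> dvd der v0 \<alpha> - Const (u * of_nat ?m) * ?b ^ (?m - 1)" by simp
  obtain c where c: "\<And>Y. Y \<in> pts \<Longrightarrow> c Y \<noteq> 0 \<and> \<alpha> dvd prod plane_form (fib Y) - Const (c Y) * bform Y ^ card (fib Y)"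
    using prod_fib by metis
  \<comment> \<open>Group the remaining lines by their points on H: modulo \<alpha> each group is a
    constant times a power of the equation of its point.\<close>
  have "B - fib X = (\<Union>Y\<in>pts - {X}. fib Y)" by (auto simp: fib_def pts_def)
  then have "R = (\<Prod>Y\<in>pts - {X}. prod plane_form (fib Y))"
    unfolding R_def
  proof (simp only:, intro prod.UNION_disjoint)
    show "\<forall>Y\<in>pts - {X}. finite (fib Y)" using fin_fib by blast
  qed (use fin_pts in \<open>auto simp: fib_def\<close>)
  moreover have "\<alpha> dvd (\<Prod>Y\<in>pts - {X}. prod plane_form (fib Y)) - (\<Prod>Y\<in>pts - {X}. Const (c Y) * bform Y ^ card (fib Y))"
    by (rule prod_cong_mod) (use c in auto)
  moreover have "(\<Prod>Y\<in>pts - {X}. Const (c Y) * bform Y ^ card (fib Y)) =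
      Const (\<Prod>Y\<in>pts - {X}. c Y) * (\<Prod>Y\<in>pts - {X}. bform Y ^ card (fib Y))"
    by (simp add: prod.distrib Const_prod)
  ultimately have e2: "\<alpha> dvd R - Const (\<Prod>Y\<in>pts - {X}. c Y) * (\<Prod>Y\<in>pts - {X}. bform Y ^ card (fib Y))" by simp
  have "(\<Prod>Y\<in>pts - {X}. bform Y ^ card (fib Y)) = (\<Prod>Y\<in>pts - {X}. bform Y ^ (card (fib Y) - 1) * bform Y)"
    using card_fib by (intro prod.cong refl) (metis DiffD1 power_eq_if less_not_refl mult.commute)
  then have e3: "?b ^ (?m - 1) * (\<Prod>Y\<in>pts - {X}. bform Y ^ card (fib Y)) = pi_poly * (\<Prod>Y\<in>pts - {X}. bform Y)"
    unfolding pi_poly_def prod.remove[OF fin_pts X] by (simp add: prod.distrib mult.assoc)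
  let ?C1 = "u * of_nat ?m" and ?C2 = "\<Prod>Y\<in>pts - {X}. c Y"
  have "der (pscale R v0) \<alpha> - Const (?C1 * ?C2) * (pi_poly * (\<Prod>Y\<in>pts - {X}. bform Y))
     = R * (der v0 \<alpha> - Const ?C1 * ?b ^ (?m - 1)) +
       (Const ?C1 * ?b ^ (?m - 1)) * (R - Const ?C2 * (\<Prod>Y\<in>pts - {X}. bform Y ^ card (fib Y)))"
    unfolding v e3[symmetric] Const_mult by (simp add: algebra_simps)
  then have "\<alpha> dvd der (pscale R v0) \<alpha> - Const (?C1 * ?C2) * (pi_poly * (\<Prod>Y\<in>pts - {X}. bform Y))"
    by (simp only:, intro dvd_add dvd_mult e1 e2)
  moreover have "?C1 * ?C2 \<noteq> 0" using u(1) card_fib[OF X] c fin_pts by auto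
  ultimately show ?thesis using log by blast
qed

text \<open>Lagrange interpolation on the projective line H: the product over \<open>S - {X}\<close>
  vanishes at every point of S except X. Matching the value of g at X leaves a remainder divisible
  by the equation of X modulo \<alpha>, whose cofactor has degree one less and is treated with one
  point less.\<close>

lemma interpolation:
  assumes "finite S" "S \<noteq> {}" "S \<subseteq> pts" "homogeneous j g" "card S \<le> Suc j"
  shows "\<exists>h y. g = (\<Sum>X\<in>S. h X * (\<Prod>Y\<in>S - {X}. bform Y)) + \<alpha> * y"
  using assms
proof (induction S arbitrary: g j rule: finite_ne_induct)
  case (singleton X)
  then show ?case by (intro exI[of _ "\<lambda>_. g"] exI[of _ 0]) simp
next
  case (insert X S)
  have X: "X \<in> pts" using insert by auto
  let ?b = "bform X" and ?P = "\<Prod>Y\<in>S. bform Y" and ?n = "card S"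
  have j: "?n \<le> j" using insert by simp
  have n: "?n > 0" using insert(1,2) by auto
  have hP: "homogeneous ?n ?P"
    using homogeneous_prod[of S "\<lambda>_. Suc 0" bform] by (simp add: bform_def)
  have nP: "?P \<notin> ideal2 \<alpha> ?b"
    using prod_notin_point_ideal[OF insert(1) _ X insert(3), of "\<lambda>_. 1"] insert(5) by simp
  obtain l where l: "\<And>n p. homogeneous n p \<Longrightarrow> \<exists>c. p - Const c * Var l ^ n \<in> ideal2 \<alpha> ?b"
    using point_quotient[OF normal(1)[OF H] normal(1)[OF rep(3)[OF X]] planes_neq[OF X]]
    unfolding bform_def plane_form_normal by blast
  obtain c where c: "?P - Const c * Var l ^ ?n \<in> ideal2 \<alpha> ?b" using l[OF hP] by blast
  have "c \<noteq> 0" using c nP by auto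
  obtain c' where c': "g - Const c' * Var l ^ j \<in> ideal2 \<alpha> ?b" using l[OF insert(6)] by blast
  \<comment> \<open>Modulo the ideal of X the product is c times a power of x_l and g is c' times
    another; this factor makes both sides agree there. It has a nonnegative degree because the bound
    on the number of points gives \<open>card S \<le> j\<close>.\<close>
  define h0 where "h0 = Const (c' / c) * Var l ^ (j - ?n)"
  have "homogeneous (j - ?n) (Var l ^ (j - ?n))"
    using homogeneous_power[of "Suc 0" "Var l" "j - ?n"] by simp
  then have "homogeneous (j - ?n + ?n) (h0 * ?P)"
    unfolding h0_def by (intro homogeneous_mult homogeneous_Const_mult hP)
  then have hg: "homogeneous j (g - h0 * ?P)" using j insert(6) by (simp add: homogeneous_diff)
  have "h0 * (Const c * Var l ^ ?n) = Const c' * Var l ^ j"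
  proof -
    have "h0 * (Const c * Var l ^ ?n) = Const (c' / c * c) * (Var l ^ (j - ?n) * Var l ^ ?n)"
      unfolding h0_def Const_mult by (simp only: mult_ac)
    moreover have "c' / c * c = c'" using \<open>c \<noteq> 0\<close> by simp
    moreover have "Var l ^ (j - ?n) * Var l ^ ?n = Var l ^ j" using j by (simp flip: power_add)
    ultimately show ?thesis by metis
  qed
  then have "g - h0 * ?P = (g - Const c' * Var l ^ j) - h0 * (?P - Const c * Var l ^ ?n)"
    by (simp add: algebra_simps)
  then have "g - h0 * ?P \<in> ideal2 \<alpha> ?b" using c c' by (metis ideal2_diff ideal2_mult)
  then obtain y g' where yg: "g - h0 * ?P = \<alpha> * y + ?b * g'" by (rule ideal2E)
  \<comment> \<open>Taking the component of degree j makes the cofactor homogeneous of degree j - 1,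
    as the induction hypothesis demands.\<close>
  have "g - h0 * ?P = hc j (\<alpha> * y + ?b * g')" using yg hg hc_homogeneous[of j "g - h0 * ?P" j] by simp
  also have "\<dots> = \<alpha> * hc (j - 1) y + ?b * hc (j - 1) g'"
    using j n unfolding hc_add hc_mult_left[OF homogeneous_plane_form] bform_def by simp
  finally have g: "g - h0 * ?P = \<alpha> * hc (j - 1) y + ?b * hc (j - 1) g'" .
  obtain h y' where h: "hc (j - 1) g' = (\<Sum>X\<in>S. h X * (\<Prod>Y\<in>S - {X}. bform Y)) + \<alpha> * y'"
    using insert(4)[of "j - 1" "hc (j - 1) g'"] insert(5) j n by auto
  let ?h = "\<lambda>Z. if Z = X then h0 else h Z"
  have "(\<Sum>Z\<in>insert X S. ?h Z * (\<Prod>Y\<in>insert X S - {Z}. bform Y)) = h0 * ?P + (\<Sum>Z\<in>S. ?h Z * (\<Prod>Y\<in>insert X S - {Z}. bform Y))"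
    using insert(1,3) by simp
  also have "(\<Sum>Z\<in>S. ?h Z * (\<Prod>Y\<in>insert X S - {Z}. bform Y)) = (\<Sum>Z\<in>S. ?b * (h Z * (\<Prod>Y\<in>S - {Z}. bform Y)))"
  proof (intro sum.cong refl)
    fix Z assume Z: "Z \<in> S"
    then have "insert X S - {Z} = insert X (S - {Z})" "X \<notin> S - {Z}" "Z \<noteq> X" using insert(3) by auto
    then show "?h Z * (\<Prod>Y\<in>insert X S - {Z}. bform Y) = ?b * (h Z * (\<Prod>Y\<in>S - {Z}. bform Y))"
      using insert(1) by simp
  qed
  also have "\<dots> = ?b * (\<Sum>Z\<in>S. h Z * (\<Prod>Y\<in>S - {Z}. bform Y))" by (simp add: sum_distrib_left)
  finally have "g = (\<Sum>Z\<in>insert X S. ?h Z * (\<Prod>Y\<in>insert X S - {Z}. bform Y)) + \<alpha> * (hc (j - 1) y + ?b * y')"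
    using g unfolding h by (simp add: algebra_simps)
  then show ?case by (intro exI[of _ ?h] exI)
qed

text \<open>The derivations of \<open>log_vf_at_point\<close> realize \<open>pi_poly\<close> times
  each Lagrange product, and interpolation combines them. The degree bound on g is what makes
  interpolation at all points possible.\<close>

lemma log_vf_image_superset:
  assumes g: "homogeneous j g" "card pts \<le> Suc j"
  shows "\<exists>v\<in>log_vf B. \<alpha> dvd der v \<alpha> - pi_poly * g"
proof (cases "B = {}")
  \<comment> \<open>Without points there is nothing to interpolate; every field is logarithmic, and
    a constant one with value 1 on \<alpha> is multiplied by g.\<close>
  case True
  then have "pts = {}" unfolding pts_def by simp
  then have "pi_poly = 1" unfolding pi_poly_def by simp
  obtain w where w: "dot (normal H) w = 1" using exists_dual[OF normal(1)[OF H]] by blast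
  have "der (pscale g (\<lambda>i. Const (w $ i))) \<alpha> = g * Const (dot (normal H) w)"
    unfolding der_pscale plane_form_normal
    by (simp add: der_linear_form dot_def sum_3 Const_add Const_mult)
  then show ?thesis
    using True w \<open>pi_poly = 1\<close> by (intro bexI[of _ "pscale g (\<lambda>i. Const (w $ i))"]) (auto simp: log_vf_def)
next
  case False
  then have "pts \<noteq> {}" by (simp add: pts_def)
  then obtain h y where hy: "g = (\<Sum>X\<in>pts. h X * (\<Prod>Y\<in>pts - {X}. bform Y)) + \<alpha> * y"
    using interpolation[OF fin_pts _ subset_refl g] by blast
  have "\<forall>X\<in>pts. \<exists>v u. v \<in> log_vf B \<and> u \<noteq> 0 \<and> \<alpha> dvd der v \<alpha> - Const u * (pi_poly * (\<Prod>Y\<in>pts - {X}. bform Y))"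
    using log_vf_at_point by blast
  then obtain v u where vu: "\<And>X. X \<in> pts \<Longrightarrow> v X \<in> log_vf B \<and> u X \<noteq> 0 \<and>
      \<alpha> dvd der (v X) \<alpha> - Const (u X) * (pi_poly * (\<Prod>Y\<in>pts - {X}. bform Y))"
    by metis
  let ?c = "\<lambda>X. Const (inverse (u X)) * h X"
  let ?w = "\<Sum>X\<in>pts. pscale (?c X) (v X)"
  have 1: "?w \<in> log_vf B" using vu by (intro log_vf_sum log_vf_pscale) auto
  have "\<alpha> dvd (\<Sum>X\<in>pts. ?c X * (der (v X) \<alpha> - Const (u X) * (pi_poly * (\<Prod>Y\<in>pts - {X}. bform Y))))"
    using vu by (intro dvd_sum dvd_mult) auto
  also have "(\<Sum>X\<in>pts. ?c X * (der (v X) \<alpha> - Const (u X) * (pi_poly * (\<Prod>Y\<in>pts - {X}. bform Y)))) =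
      (\<Sum>X\<in>pts. ?c X * der (v X) \<alpha> - pi_poly * (h X * (\<Prod>Y\<in>pts - {X}. bform Y)))"
  proof (intro sum.cong refl)
    fix X assume "X \<in> pts"
    then have "Const (inverse (u X)) * Const (u X) = 1" using vu Const_inverse by blast
    then show "?c X * (der (v X) \<alpha> - Const (u X) * (pi_poly * (\<Prod>Y\<in>pts - {X}. bform Y))) =
        ?c X * der (v X) \<alpha> - pi_poly * (h X * (\<Prod>Y\<in>pts - {X}. bform Y))"
      by Groebner_Basis.algebra
  qed
  also have "\<dots> = der ?w \<alpha> - pi_poly * g + \<alpha> * (pi_poly * y)"
    unfolding der_sum_vec der_pscale hy by (simp add: sum_subtractf sum_distrib_left algebra_simps)
  finally have "\<alpha> dvd der ?w \<alpha> - pi_poly * g" by (simp add: dvd_add_left_iff)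
  then show ?thesis using 1 by blast
qed

lemma alpha_not_dvd_pi: "\<not> \<alpha> dvd pi_poly"
  unfolding pi_poly_def using prime_elem_dvd_prod[OF prime_alpha fin_pts] alpha_not_dvd_power by blast

text \<open>With T the values theta(\<alpha>) in degree m, A the multiples of \<alpha> and P those
  of \<open>pi_poly\<close>, one has T + A = P + A. The new line keeps exactly the derivations with
  value in A, so the loss is dim T - dim (T Int A) = dim P - dim (P Int A) = dim R_{m-c} - dim
  R_{m-c-1} = m - c + 1, where c is the degree of \<open>pi_poly\<close>.\<close>

theorem dim_log_vf_insert:
  assumes m: "m > card B"
  shows "kV.dim (log_vf B \<inter> vforms m) =
    kV.dim (log_vf (insert H B) \<inter> vforms m) + (m - (card B - card pts) + 1)"
proof -
  let ?c = "card B - card pts"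
  let ?L = "log_vf B \<inter> vforms m" and ?L' = "log_vf (insert H B) \<inter> vforms m"
  let ?T = "(\<lambda>v. der v \<alpha>) ` ?L"
  let ?A = "(\<lambda>p. \<alpha> * p) ` forms (m - 1)" and ?P = "(\<lambda>p. pi_poly * p) ` forms (m - ?c)"
  have cm: "?c < m" using m by simp
  have a0: "\<alpha> \<noteq> 0" by (rule plane_form_neq_0[OF H])
  have p0: "pi_poly \<noteq> 0" using alpha_not_dvd_pi by auto
  obtain F :: "'k poly3 set" where F: "finite F" "forms m \<subseteq> kR.span F"
    using forms_finite_span by blast
  obtain G :: "(3 \<Rightarrow> 'k poly3) set" where G: "finite G" "vforms m \<subseteq> kV.span G"
    using vforms_finite_span by blast
  interpret d: Vector_Spaces.linear kvscale kscale "\<lambda>v. der v \<alpha>" by (rule linear_der)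
  have hT: "homogeneous m (der v \<alpha>)" if "v \<in> vforms m" for v
    using that homogeneous_der[OF homogeneous_plane_form, of m v m H] by (simp add: vforms_def)
  have T: "kR.subspace ?T" "?T \<subseteq> forms m"
    using d.subspace_image[OF subspace_log_vf] hT by (auto simp: forms_def)
  have A: "kR.subspace ?A" "?A \<subseteq> forms m"
    using subspace_mult_forms homogeneous_mult[OF homogeneous_plane_form, of "m - 1" _ H] cm
    by (auto simp: forms_def)
  have P: "kR.subspace ?P" "?P \<subseteq> forms m"
    using subspace_mult_forms homogeneous_mult[OF homogeneous_pi, of "m - ?c"] cm
    by (auto simp: forms_def)
  have E: "{x + y |x y. x \<in> ?T \<and> y \<in> ?A} = {x + y |x y. x \<in> ?P \<and> y \<in> ?A}" (is "?E1 = ?E2")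
  proof
    show "?E1 \<subseteq> ?E2"
    proof
      fix z assume "z \<in> ?E1"
      then obtain v a where v: "v \<in> ?L" and a: "a \<in> forms (m - 1)" and z: "z = der v \<alpha> + \<alpha> * a" by blast
      have "der v \<alpha> \<in> ideal2 \<alpha> pi_poly" using log_vf_image_subset v by blast
      then obtain x y where xy: "der v \<alpha> = \<alpha> * x + pi_poly * y" by (rule ideal2E)
      have "der v \<alpha> = hc m (\<alpha> * x + pi_poly * y)" using xy hT[of v] v hc_homogeneous[of m "der v \<alpha>" m] by simp
      also have "\<dots> = \<alpha> * hc (m - 1) x + pi_poly * hc (m - ?c) y"
        using cm unfolding hc_add hc_mult_left[OF homogeneous_plane_form] hc_mult_left[OF homogeneous_pi] by simp
      finally have "z = pi_poly * hc (m - ?c) y + \<alpha> * (hc (m - 1) x + a)" unfolding z by (simp add: algebra_simps)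
      moreover have "hc (m - 1) x + a \<in> forms (m - 1)" using a by (simp add: forms_def homogeneous_add)
      moreover have "hc (m - ?c) y \<in> forms (m - ?c)" by (simp add: forms_def)
      ultimately show "z \<in> ?E2" by blast
    qed
    show "?E2 \<subseteq> ?E1"
    proof
      fix z assume "z \<in> ?E2"
      then obtain g a where g: "g \<in> forms (m - ?c)" and a: "a \<in> forms (m - 1)" and z: "z = pi_poly * g + \<alpha> * a" by blast
      \<comment> \<open>The bound on m is used here: c is the number of lines minus the number of
        points, so m - c exceeds the number of points.\<close>
      have "card pts \<le> Suc (m - ?c)" using m card_pts_le by simp
      then obtain v where v: "v \<in> log_vf B" "\<alpha> dvd der v \<alpha> - pi_poly * g"
        using log_vf_image_superset g by (auto simp: forms_def)
      obtain y where y: "der v \<alpha> - pi_poly * g = \<alpha> * y" using v(2) by blast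
      have pg: "homogeneous m (pi_poly * g)" using P(2) g by (auto simp: forms_def)
      have "hc m (der v \<alpha> - pi_poly * g) = \<alpha> * hc (m - 1) y"
        unfolding y using cm by (subst hc_mult_left[OF homogeneous_plane_form]) simp
      then have "der (vhc m v) \<alpha> - pi_poly * g = \<alpha> * hc (m - 1) y"
        using pg by (simp add: hc_diff hc_homogeneous plane_form_normal der_vhc_linear_form)
      then have "z = der (vhc m v) \<alpha> + \<alpha> * (a - hc (m - 1) y)" unfolding z by (simp add: algebra_simps)
      moreover have "vhc m v \<in> ?L" using log_vf_vhc[OF v(1)] by simp
      moreover have "a - hc (m - 1) y \<in> forms (m - 1)" using a by (simp add: forms_def homogeneous_diff)
      ultimately show "z \<in> ?E1" by blast
    qed
  qed
  \<comment> \<open>\<alpha> is prime and does not divide \<open>pi_poly\<close>, so common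
    multiples are multiples of the product.\<close>
  have PA: "?P \<inter> ?A = (\<lambda>p. (pi_poly * \<alpha>) * p) ` forms (m - ?c - 1)"
  proof
    show "?P \<inter> ?A \<subseteq> (\<lambda>p. (pi_poly * \<alpha>) * p) ` forms (m - ?c - 1)"
    proof
      fix z assume "z \<in> ?P \<inter> ?A"
      then have "z \<in> ?P" "z \<in> ?A" by (rule IntD1, rule IntD2)
      then obtain p a where p: "p \<in> forms (m - ?c)" "z = pi_poly * p" and a: "z = \<alpha> * a" by blast
      have "\<alpha> dvd pi_poly * p" using p a by (metis dvd_triv_left)
      then have "\<alpha> dvd p" using prime_elem_dvd_multD[OF prime_alpha] alpha_not_dvd_pi by blast
      then obtain x where x: "p = \<alpha> * x" by blast
      have "p = hc (m - ?c) (\<alpha> * x)" using p(1) x hc_homogeneous[of "m - ?c" p] by (simp add: forms_def)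
      also have "\<dots> = \<alpha> * hc (m - ?c - 1) x" using cm by (subst hc_mult_left[OF homogeneous_plane_form]) simp
      finally have "z = (pi_poly * \<alpha>) * hc (m - ?c - 1) x" using p(2) by (simp add: mult.assoc)
      then show "z \<in> (\<lambda>p. (pi_poly * \<alpha>) * p) ` forms (m - ?c - 1)" by (auto simp: forms_def)
    qed
    show "(\<lambda>p. (pi_poly * \<alpha>) * p) ` forms (m - ?c - 1) \<subseteq> ?P \<inter> ?A"
    proof
      fix z assume "z \<in> (\<lambda>p. (pi_poly * \<alpha>) * p) ` forms (m - ?c - 1)"
      then obtain p where p: "homogeneous (m - ?c - 1) p" "z = pi_poly * \<alpha> * p" by (auto simp: forms_def)
      have "homogeneous (m - ?c) (\<alpha> * p)"
        using homogeneous_mult[OF homogeneous_plane_form p(1), of H] cm by (simp add: Suc_diff_Suc)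
      moreover have "homogeneous (m - 1) (pi_poly * p)"
        using homogeneous_mult[OF homogeneous_pi p(1)] cm by simp
      ultimately show "z \<in> ?P \<inter> ?A"
        using p(2) by (auto simp: forms_def image_iff mult_ac intro: bexI[of _ "\<alpha> * p"] bexI[of _ "pi_poly * p"])
    qed
  qed
  have FT: "?T \<subseteq> kR.span F" "?A \<subseteq> kR.span F" "?P \<subseteq> kR.span F" using T(2) A(2) P(2) F(2) by auto
  have dA: "kR.dim ?A = rdim (m - 1)" by (rule dim_mult_forms[OF a0])
  have 1: "kR.dim ?E1 + kR.dim (?T \<inter> ?A) = kR.dim ?T + rdim (m - 1)"
    using kR.dim_sum_inter[OF T(1) FT(1) F(1) A(1) FT(2)] dA by simp
  have 2: "kR.dim ?E2 + rdim (m - ?c - 1) = rdim (m - ?c) + rdim (m - 1)"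
    using kR.dim_sum_inter[OF P(1) FT(3) F(1) A(1) FT(2)] dA dim_mult_forms[OF p0] dim_mult_forms[of "pi_poly * \<alpha>"] a0 p0
    unfolding PA by simp
  have 3: "kV.dim ?L = kV.dim {v \<in> ?L. der v \<alpha> = 0} + kR.dim ?T"
    by (rule kVR.rank_nullity[OF linear_der subspace_log_vf _ G(1)]) (use G in auto)
  have 4: "kV.dim ?L' = kV.dim {v \<in> ?L'. der v \<alpha> = 0} + kR.dim ((\<lambda>v. der v \<alpha>) ` ?L')"
    by (rule kVR.rank_nullity[OF linear_der subspace_log_vf _ G(1)]) (use G in auto)
  \<comment> \<open>A derivation that kills \<alpha> satisfies the new condition anyway, so both
    kernels agree and only the images are to be compared.\<close>
  have 5: "{v \<in> ?L'. der v \<alpha> = 0} = {v \<in> ?L. der v \<alpha> = 0}"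
    by (auto simp: log_vf_def)
  have 6: "(\<lambda>v. der v \<alpha>) ` ?L' = ?T \<inter> ?A"
  proof
    show "(\<lambda>v. der v \<alpha>) ` ?L' \<subseteq> ?T \<inter> ?A"
    proof
      fix z assume "z \<in> (\<lambda>v. der v \<alpha>) ` ?L'"
      then obtain v where v: "v \<in> ?L'" "z = der v \<alpha>" by blast
      then obtain y where y: "z = \<alpha> * y" by (auto simp: log_vf_def)
      have "z = hc m (\<alpha> * y)" using hT[of v] v y hc_homogeneous[of m z m] by simp
      also have "\<dots> = \<alpha> * hc (m - 1) y" using cm by (subst hc_mult_left[OF homogeneous_plane_form]) simp
      finally have "z \<in> ?A" by (rule image_eqI) (simp add: forms_def)
      moreover have "v \<in> ?L" using v(1) by (simp add: log_vf_def)
      ultimately show "z \<in> ?T \<inter> ?A" using v(2) by blast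
    qed
    show "?T \<inter> ?A \<subseteq> (\<lambda>v. der v \<alpha>) ` ?L'"
      by (auto simp: log_vf_def)
  qed
  obtain k where k: "m - ?c = Suc k" using cm by (metis not0_implies_Suc zero_less_diff less_numeral_extra(3))
  have "rdim (m - ?c) = rdim (m - ?c - 1) + (m - ?c + 1)"
    unfolding k by (simp add: rdim_Suc)
  then show ?thesis using 1 2 3 4 unfolding E 5 6 by linarith
qed

end

section \<open>Dependence on the intersection lattice\<close>

lemma plane_neq_UNIV: "is_plane H \<Longrightarrow> H \<noteq> UNIV"
proof
  assume H: "is_plane H" "H = UNIV"
  obtain w where "dot (normal H) w = 1" using exists_dual[OF normal(1)[OF H(1)]] by blast
  moreover have "w \<in> plane (normal H)" using normal(2)[OF H(1)] H(2) by simp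
  ultimately show False by (simp add: plane_dot)
qed

text \<open>For reverse inclusion the planes are the atoms of the lattice. The right-hand side uses
  the order alone (UNIV being the least element), so an isomorphism must respect it.\<close>

lemma mem_arrangement_iff:
  assumes "arrangement A"
  shows "H \<in> A \<longleftrightarrow> H \<in> intersection_lattice A \<and> H \<noteq> UNIV \<and>
    (\<forall>X\<in>intersection_lattice A. H \<subseteq> X \<longrightarrow> X = H \<or> X = UNIV)"
proof
  assume H: "H \<in> A"
  have pl: "is_plane K" if "K \<in> A" for K using assms that by (simp add: arrangement_is_plane)
  have "H = \<Inter>{H}" by simp
  then have "H \<in> intersection_lattice A" using H unfolding intersection_lattice_def by blast
  moreover have "X = H \<or> X = UNIV" if X: "X \<in> intersection_lattice A" "H \<subseteq> X" for X
  proof -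
    obtain S where S: "X = \<Inter>S" "S \<subseteq> A" using X by (auto simp: intersection_lattice_def)
    have "K = H" if "K \<in> S" for K
    proof -
      have "H \<subseteq> K" using S(1) X(2) that by blast
      then show ?thesis using plane_subset_plane[of H K] pl H S(2) that by blast
    qed
    then have "S = {} \<or> S = {H}" by blast
    then show ?thesis using S(1) by auto
  qed
  ultimately show "H \<in> intersection_lattice A \<and> H \<noteq> UNIV \<and>
    (\<forall>X\<in>intersection_lattice A. H \<subseteq> X \<longrightarrow> X = H \<or> X = UNIV)"
    using plane_neq_UNIV[OF pl[OF H]] by blast
next
  assume R: "H \<in> intersection_lattice A \<and> H \<noteq> UNIV \<and>
    (\<forall>X\<in>intersection_lattice A. H \<subseteq> X \<longrightarrow> X = H \<or> X = UNIV)"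
  then obtain S where S: "H = \<Inter>S" "S \<subseteq> A" by (auto simp: intersection_lattice_def)
  then obtain K where K: "K \<in> S" using R by auto
  have "K = \<Inter>{K}" by simp
  then have "K \<in> intersection_lattice A" using K S(2) unfolding intersection_lattice_def by blast
  moreover have "H \<subseteq> K" using S(1) K by blast
  moreover have "K \<noteq> UNIV" using K S(2) assms plane_neq_UNIV by (auto simp: arrangement_is_plane)
  ultimately have "K = H" using R by blast
  then show "H \<in> A" using K S(2) by blast
qed

text \<open>Atoms go to atoms, and the intersection of two planes is their join, so it is also
  preserved. The second property records which pairs of lines meet in the same point, and thereby
  counts the points on each line of every subarrangement.\<close>

lemma lattice_iso_bij:
  assumes A: "arrangement A" and B: "arrangement B" and iso: "lattice_iso A B"
  obtains f where "bij_betw f A B"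
    "\<And>H K H' K'. \<lbrakk>H \<in> A; K \<in> A; H' \<in> A; K' \<in> A\<rbrakk> \<Longrightarrow> H \<inter> K = H' \<inter> K' \<longleftrightarrow> f H \<inter> f K = f H' \<inter> f K'"
proof -
  let ?LA = "intersection_lattice A" and ?LB = "intersection_lattice B"
  obtain f where f: "bij_betw f ?LA ?LB"
    and ord': "\<forall>X\<in>?LA. \<forall>Y\<in>?LA. Y \<subseteq> X \<longleftrightarrow> f Y \<subseteq> f X"
    using iso unfolding lattice_iso_def by (elim exE conjE)
  have ord: "Y \<subseteq> X \<longleftrightarrow> f Y \<subseteq> f X" if "X \<in> ?LA" "Y \<in> ?LA" for X Y
    using ord' that by simp
  have U: "UNIV \<in> intersection_lattice C" for C :: "('c::field_char_0 ^ 3) set set"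
    unfolding intersection_lattice_def by (intro CollectI exI[of _ "{}"]) simp
  have I: "H \<inter> K \<in> intersection_lattice C" if "H \<in> C" "K \<in> C" for C :: "('c::field_char_0 ^ 3) set set" and H K
    unfolding intersection_lattice_def using that by (intro CollectI exI[of _ "{H, K}"]) auto
  have fin: "f X \<in> ?LB" if "X \<in> ?LA" for X using f that by (auto simp: bij_betw_def)
  have inj: "f X = f Y \<longleftrightarrow> X = Y" if "X \<in> ?LA" "Y \<in> ?LA" for X Y
    using f that by (auto simp: bij_betw_def inj_on_def)
  have surj: "\<exists>X\<in>?LA. Y = f X" if "Y \<in> ?LB" for Y using f that by (auto simp: bij_betw_def)
  have fU: "f UNIV = UNIV"
  proof -
    obtain Z where "Z \<in> ?LA" "UNIV = f Z" using surj[OF U] by blast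
    then show ?thesis using ord[OF U, of Z] by auto
  qed
  have mem: "f H \<in> B \<longleftrightarrow> H \<in> A" if H: "H \<in> ?LA" for H
  proof -
    have 1: "f H \<noteq> UNIV \<longleftrightarrow> H \<noteq> UNIV" using inj[OF H U] fU by simp
    have 2: "(\<forall>Y\<in>?LB. f H \<subseteq> Y \<longrightarrow> Y = f H \<or> Y = UNIV) \<longleftrightarrow> (\<forall>X\<in>?LA. H \<subseteq> X \<longrightarrow> X = H \<or> X = UNIV)"
    proof (intro iffI ballI impI)
      fix X assume *: "\<forall>Y\<in>?LB. f H \<subseteq> Y \<longrightarrow> Y = f H \<or> Y = UNIV" "X \<in> ?LA" "H \<subseteq> X"
      have "f X \<in> ?LB" "f H \<subseteq> f X" using fin ord[OF *(2) H] *(2,3) by simp_all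
      then have "f X = f H \<or> f X = f UNIV" using *(1) fU by simp
      then show "X = H \<or> X = UNIV" using inj[OF *(2) H] inj[OF *(2) U] by simp
    next
      fix Y assume *: "\<forall>X\<in>?LA. H \<subseteq> X \<longrightarrow> X = H \<or> X = UNIV" "Y \<in> ?LB" "f H \<subseteq> Y"
      then obtain X where X: "X \<in> ?LA" "Y = f X" using surj by blast
      then have "X = H \<or> X = UNIV" using * ord[OF X(1) H] by auto
      then show "Y = f H \<or> Y = UNIV" using X fU by auto
    qed
    show ?thesis
      unfolding mem_arrangement_iff[OF A, of H] mem_arrangement_iff[OF B, of "f H"] 1 2 using H fin[OF H] by simp
  qed
  have AL: "H \<in> ?LA" if "H \<in> A" for H using I[OF that that] by simp
  have BL: "K \<in> ?LB" if "K \<in> B" for K using I[OF that that] by simp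
  have bij: "bij_betw f A B"
    unfolding bij_betw_def
  proof
    show "inj_on f A" using inj AL by (auto intro!: inj_onI)
    show "f ` A = B"
    proof
      show "f ` A \<subseteq> B" using mem AL by blast
      show "B \<subseteq> f ` A" using mem surj BL by blast
    qed
  qed
  \<comment> \<open>For the harder inclusion pull \<open>f H \<inter> f K\<close> back to a lattice
    element Z; it lies in both planes, hence in their intersection.\<close>
  have int: "f (H \<inter> K) = f H \<inter> f K" if H: "H \<in> A" and K: "K \<in> A" for H K
  proof
    show "f (H \<inter> K) \<subseteq> f H \<inter> f K"
      using ord[OF AL[OF H] I[OF H K]] ord[OF AL[OF K] I[OF H K]] by auto
    have "f H \<in> B" "f K \<in> B" using mem AL H K by auto
    then obtain Z where Z: "Z \<in> ?LA" "f H \<inter> f K = f Z" using surj[OF I] by blast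
    then have "Z \<subseteq> H" "Z \<subseteq> K" using ord[OF AL[OF H] Z(1)] ord[OF AL[OF K] Z(1)] by auto
    then show "f H \<inter> f K \<subseteq> f (H \<inter> K)" using ord[OF I[OF H K] Z(1)] Z(2) by simp
  qed
  show ?thesis
  proof (rule that[OF bij])
    fix H K H' K' assume *: "H \<in> A" "K \<in> A" "H' \<in> A" "K' \<in> A"
    then show "H \<inter> K = H' \<inter> K' \<longleftrightarrow> f H \<inter> f K = f H' \<inter> f K'"
      using int[of H K] int[of H' K'] inj[OF I[of H A K] I[of H' A K']] by simp
  qed
qed

text \<open>Both images count the classes of the same equivalence relation on S.\<close>

lemma card_image_cong:
  assumes "\<And>x y. x \<in> S \<Longrightarrow> y \<in> S \<Longrightarrow> g x = g y \<longleftrightarrow> h x = h y"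
  shows "card (g ` S) = card (h ` S)"
proof (rule bij_betw_same_card)
  let ?F = "\<lambda>z. h (SOME x. x \<in> S \<and> g x = z)"
  have F: "?F (g x) = h x" if "x \<in> S" for x
  proof -
    have "\<exists>y. y \<in> S \<and> g y = g x" using that by blast
    from someI_ex[OF this] show ?thesis using assms that by blast
  qed
  show "bij_betw ?F (g ` S) (h ` S)"
    unfolding bij_betw_def
  proof
    show "inj_on ?F (g ` S)"
    proof (rule inj_onI)
      fix a b assume "a \<in> g ` S" "b \<in> g ` S" "?F a = ?F b"
      then obtain x y where "x \<in> S" "y \<in> S" "a = g x" "b = g y" by blast
      then show "a = b" using F assms \<open>?F a = ?F b\<close> by metis
    qed
    show "?F ` (g ` S) = h ` S" unfolding image_image using F by (intro image_cong refl) 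
  qed
qed

text \<open>Both arrangements are built up line by line along the bijection. Each new line has
  equally many points on both sides, so both dimensions change by the same amount: 3 dim R_m is the
  value without lines, every line subtracts m + 1, and the degrees of the forms
  \<open>pi_poly\<close> accumulate in K.\<close>

lemma dim_log_vf_lattice:
  fixes A B :: "('k::field_char_0 ^ 3) set set"
  assumes A: "arrangement A" and B: "arrangement B" and iso: "lattice_iso A B"
  shows "card B = card A \<and> (\<exists>K::int. \<forall>m>card A.
    int (kV.dim (log_vf A \<inter> vforms m)) = 3 * int (rdim m) - int (card A) * (int m + 1) + K \<and>
    int (kV.dim (log_vf B \<inter> vforms m)) = 3 * int (rdim m) - int (card A) * (int m + 1) + K)"
proof -
  obtain f where f: "bij_betw f A B"
    and cap: "\<And>H K H' K'. \<lbrakk>H \<in> A; K \<in> A; H' \<in> A; K' \<in> A\<rbrakk> \<Longrightarrow> H \<inter> K = H' \<inter> K' \<longleftrightarrow> f H \<inter> f K = f H' \<inter> f K'"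
    using lattice_iso_bij[OF A B iso] by blast
  have inj: "inj_on f A" and im: "f ` A = B" using f by (auto simp: bij_betw_def)
  have "\<exists>K::int. \<forall>m>card S.
    int (kV.dim (log_vf S \<inter> vforms m)) = 3 * int (rdim m) - int (card S) * (int m + 1) + K \<and>
    int (kV.dim (log_vf (f ` S) \<inter> vforms m)) = 3 * int (rdim m) - int (card S) * (int m + 1) + K"
    if "finite S" "S \<subseteq> A" for S
    using that
  proof (induction S rule: finite_induct)
    case empty
    have "log_vf {} \<inter> vforms m = (vforms m :: (3 \<Rightarrow> 'k poly3) set)" for m by (auto simp: log_vf_def)
    then show ?case by (intro exI[of _ 0]) (simp add: dim_vforms')
  next
    case (insert H S)
    then have SA: "S \<subseteq> A" and HA: "H \<in> A" by auto
    obtain K :: int where K: "\<And>m. m > card S \<Longrightarrow>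
      int (kV.dim (log_vf S \<inter> vforms m)) = 3 * int (rdim m) - int (card S) * (int m + 1) + K \<and>
      int (kV.dim (log_vf (f ` S) \<inter> vforms m)) = 3 * int (rdim m) - int (card S) * (int m + 1) + K"
      using insert by auto
    have S: "arrangement S" using A SA insert(1) by (auto simp: arrangement_is_plane)
    have fS: "arrangement (f ` S)" using B SA insert(1) im by (auto simp: arrangement_is_plane)
    have H: "is_plane H" using A HA by (auto simp: arrangement_is_plane)
    have fH: "is_plane (f H)" using B HA im by (auto simp: arrangement_is_plane)
    have fHS: "f H \<notin> f ` S" using inj insert(2) SA HA by (auto simp: inj_on_def)
    have cS: "card (f ` S) = card S" using inj_on_subset[OF inj SA] by (rule card_image)
    have "card ((\<lambda>K. H \<inter> K) ` S) = card ((\<lambda>K. f H \<inter> f K) ` S)"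
    proof (rule card_image_cong)
      fix x y assume "x \<in> S" "y \<in> S"
      then show "H \<inter> x = H \<inter> y \<longleftrightarrow> f H \<inter> f x = f H \<inter> f y"
        using SA by (intro cap[OF HA _ HA]) auto
    qed
    then have pts: "card (pts (f ` S) (f H)) = card (pts S H)"
      unfolding pts_def[OF S H insert(2)] pts_def[OF fS fH fHS] by (simp add: image_image)
    have le: "card (pts S H) \<le> card S" by (rule card_pts_le[OF S H insert(2)])
    show ?case
    \<comment> \<open>The line costs m - c + 1, that is m + 1 minus a correction c independent of m,
      which moves into the constant.\<close>
    proof (intro exI[of _ "K + int (card S - card (pts S H))"] allI impI)
      fix m assume "m > card (insert H S)"
      then have m: "m > card S" using insert(1,2) by simp
      have *: "int (kV.dim (log_vf (insert H S) \<inter> vforms m)) =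
          int (kV.dim (log_vf S \<inter> vforms m)) - (int m - int (card S - card (pts S H)) + 1)"
        using dim_log_vf_insert[OF S H insert(2) m] m by simp
      have **: "int (kV.dim (log_vf (insert (f H) (f ` S)) \<inter> vforms m)) =
          int (kV.dim (log_vf (f ` S) \<inter> vforms m)) - (int m - int (card S - card (pts S H)) + 1)"
        using dim_log_vf_insert[OF fS fH fHS] m unfolding cS pts by simp
      show "int (kV.dim (log_vf (insert H S) \<inter> vforms m)) =
            3 * int (rdim m) - int (card (insert H S)) * (int m + 1) + (K + int (card S - card (pts S H))) \<and>
            int (kV.dim (log_vf (f ` insert H S) \<inter> vforms m)) =
            3 * int (rdim m) - int (card (insert H S)) * (int m + 1) + (K + int (card S - card (pts S H)))"
        using * ** K[OF m] insert(1,2) by (simp add: algebra_simps)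
    qed
  qed
  from this[of A] A im bij_betw_same_card[OF f] show ?thesis by (auto simp: arrangement_def)
qed

subsection \<open>Syzygies\<close>

definition syz :: "('k::field_char_0 ^ 3) set set \<Rightarrow> (3 \<Rightarrow> 'k poly3) set" where
  "syz B = {v. der v (defining_poly B) = 0}"

lemma syz_0: "0 \<in> syz B"
  by (simp add: syz_def)

lemma syz_add: "v \<in> syz B \<Longrightarrow> w \<in> syz B \<Longrightarrow> v + w \<in> syz B"
  by (simp add: syz_def der_plus_vec)

lemma syz_pscale: "v \<in> syz B \<Longrightarrow> pscale p v \<in> syz B"
  by (simp add: syz_def der_pscale)

lemma subspace_syz: "kV.subspace (syz B \<inter> vforms m)"
proof (rule kV.subspace_inter[OF _ subspace_vforms])
  show "kV.subspace (syz B)"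
    unfolding kV.subspace_def kvscale_def by (blast intro: syz_0 syz_add syz_pscale)
qed

lemma syz_cancel: "p \<noteq> 0 \<Longrightarrow> pscale p v \<in> syz B \<Longrightarrow> v \<in> syz B"
  by (simp add: syz_def der_pscale)

lemma syz_subset_log_vf: "arrangement B \<Longrightarrow> syz B \<subseteq> log_vf B"
  by (auto simp: log_vf_iff syz_def)

lemma vhc_plus: "vhc n (v + w) = vhc n v + vhc n w"
  by (simp add: vhc_def hc_add fun_eq_iff)

lemma vec_eq_sum_vhc: "v = (\<Sum>n\<in>(\<Union>i. tdeg ` keys (v i)). vhc n v)" for v :: "3 \<Rightarrow> 'k::field_char_0 poly3"
proof
  fix i
  let ?N = "\<Union>i. tdeg ` keys (v i)"
  have sum_apply: "sum g S i = (\<Sum>n\<in>S. g n i)" for g :: "nat \<Rightarrow> 3 \<Rightarrow> 'k poly3" and S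
    by (induction S rule: infinite_finite_induct) auto
  have "v i = (\<Sum>n\<in>tdeg ` keys (v i). hc n (v i))" by (simp add: sum_hc)
  also have "\<dots> = (\<Sum>n\<in>?N. hc n (v i))"
    by (rule sum.mono_neutral_left) (auto intro!: hc_eq_0)
  finally show "v i = (\<Sum>n\<in>?N. vhc n v) i" by (simp add: sum_apply vhc_def)
qed

text \<open>Q is homogeneous of degree d, so the component of theta(Q) in degree n + d - 1 comes
  from the component of theta in degree n alone.\<close>

lemma syz_vhc:
  assumes "v \<in> syz B" "finite B"
  shows "vhc n v \<in> syz B"
proof (cases "card B = 0")
  \<comment> \<open>Without lines the degree n + d - 1 would be truncated at n = 0; but then Q = 1
    and every vector is a syzygy.\<close>
  case True
  then have "defining_poly B = 1" using assms(2) by (simp add: defining_poly_def)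
  then show ?thesis by (simp add: syz_def)
next
  case False
  let ?Q = "defining_poly B" and ?N = "\<Union>i. tdeg ` keys (v i)"
  have h: "homogeneous (j + card B - 1) (der (vhc j v) ?Q)" for j
    by (rule homogeneous_der[OF homogeneous_defining_poly, of j]) (use False in \<open>auto simp: vhc_def\<close>)
  show ?thesis
  proof (cases "n \<in> ?N")
    case True
    have fin: "finite ?N" by auto
    have "0 = hc (n + card B - 1) (der v ?Q)" using assms by (simp add: syz_def)
    also have "der v ?Q = (\<Sum>j\<in>?N. der (vhc j v) ?Q)"
      by (subst vec_eq_sum_vhc) (rule der_sum_vec)
    also have "hc (n + card B - 1) \<dots> = (\<Sum>j\<in>?N. if j = n then der (vhc n v) ?Q else 0)"
      unfolding hc_sum
    proof (intro sum.cong refl)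
      fix j
      show "hc (n + card B - 1) (der (vhc j v) ?Q) = (if j = n then der (vhc n v) ?Q else 0)"
        using hc_homogeneous[OF h[of j], of "n + card B - 1"] False by auto
    qed
    also have "\<dots> = der (vhc n v) ?Q" using True fin by simp
    finally show ?thesis by (simp add: syz_def)
  next
    case False
    then have "vhc n v = 0" by (auto simp: vhc_def fun_eq_iff intro!: hc_eq_0)
    then show ?thesis by (simp add: syz_0)
  qed
qed

lemma Euler_defining_poly: "der Var (defining_poly B) = of_nat (card B) * defining_poly B"
  by (rule Euler[OF homogeneous_defining_poly])

text \<open>Evaluation at Q has the syzygies as kernel. Its image is all of Q R_{m-1}: the multiple
  p/d of the Euler field, with d invertible in characteristic 0, has the value Q p.\<close>

lemma dim_log_vf_eq_syz:
  assumes B: "arrangement B" and d: "card B > 0" and m: "m > 0"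
  shows "kV.dim (log_vf B \<inter> vforms m) = kV.dim (syz B \<inter> vforms m) + rdim (m - 1)"
proof -
  let ?Q = "defining_poly B" and ?L = "log_vf B \<inter> vforms m"
  obtain G :: "(3 \<Rightarrow> 'a poly3) set" where G: "finite G" "vforms m \<subseteq> kV.span G"
    using vforms_finite_span by blast
  have 1: "kV.dim ?L = kV.dim {v \<in> ?L. der v ?Q = 0} + kR.dim ((\<lambda>v. der v ?Q) ` ?L)"
    by (rule kVR.rank_nullity[OF linear_der subspace_log_vf _ G(1)]) (use G in auto)
  have 2: "{v \<in> ?L. der v ?Q = 0} = syz B \<inter> vforms m"
    using syz_subset_log_vf[OF B] by (auto simp: syz_def)
  have 3: "(\<lambda>v. der v ?Q) ` ?L = (\<lambda>p. ?Q * p) ` forms (m - 1)"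
  proof
    show "(\<lambda>v. der v ?Q) ` ?L \<subseteq> (\<lambda>p. ?Q * p) ` forms (m - 1)"
    proof
      fix z assume "z \<in> (\<lambda>v. der v ?Q) ` ?L"
      then obtain v where v: "v \<in> log_vf B" "v \<in> vforms m" "z = der v ?Q" by blast
      then obtain y where y: "z = ?Q * y" using log_vf_iff[OF B] by blast
      let ?n = "card B + m - 1"
      have "homogeneous ?n z"
        unfolding v(3) using homogeneous_der[OF homogeneous_defining_poly[of B], of m v ?n] v(2) d by (auto simp: vforms_def)
      then have "z = hc ?n (?Q * y)" using y hc_homogeneous[of ?n z ?n] by simp
      also have "\<dots> = ?Q * hc (m - 1) y" using m by (subst hc_mult_left[OF homogeneous_defining_poly]) auto
      finally show "z \<in> (\<lambda>p. ?Q * p) ` forms (m - 1)" by (rule image_eqI) (simp add: forms_def)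
    qed
    show "(\<lambda>p. ?Q * p) ` forms (m - 1) \<subseteq> (\<lambda>v. der v ?Q) ` ?L"
    proof
      fix z assume "z \<in> (\<lambda>p. ?Q * p) ` forms (m - 1)"
      then obtain p where p: "homogeneous (m - 1) p" "z = ?Q * p" by (auto simp: forms_def)
      let ?c = "Const (inverse (of_nat (card B)))"
      let ?v = "pscale (?c * p) Var"
      have c: "?c * of_nat (card B) = 1"
        using Const_inverse[of "of_nat (card B)"] d by (simp add: Const_of_nat)
      have "der ?v ?Q = (?c * of_nat (card B)) * (?Q * p)"
        unfolding der_pscale Euler_defining_poly by (simp only: mult_ac)
      then have "der ?v ?Q = z" unfolding c p(2) by simp
      moreover have "?v \<in> log_vf B" unfolding log_vf_iff[OF B] using calculation p(2) by simp
      moreover have "?v \<in> vforms m"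
        using homogeneous_mult[OF homogeneous_Const_mult[OF p(1)] homogeneous_Var] m by (simp add: vforms_def pscale_def)
      ultimately show "z \<in> (\<lambda>v. der v ?Q) ` ?L" by blast
    qed
  qed
  show ?thesis
    using 1 dim_mult_forms[OF defining_poly_neq_0[OF B], of "m - 1"] unfolding 2 3 by simp
qed

section \<open>Global sections\<close>

lemma Var_eq_linear_form: "Var i = linear_form (axis i 1)"
  by (simp add: linear_form_def axis_def if_distrib[of Const] if_distrib[of "\<lambda>x. x * _"] cong: if_cong)

lemma prime_Var: "prime_elem (Var i :: 'k::field_char_0 poly3)"
  unfolding Var_eq_linear_form by (rule prime_linear_form) (simp add: axis_eq_0_iff)

lemma Var_dvd_Var: "(Var i :: 'k::field_char_0 poly3) dvd Var j \<Longrightarrow> i = j"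
proof (rule ccontr)
  assume "(Var i :: 'k poly3) dvd Var j" "i \<noteq> j"
  then obtain p :: "'k poly3" where "Var j = Var i * p" by blast
  then have "ev (\<lambda>h. if h = j then 1 else 0) (Var j :: 'k poly3) = ev (\<lambda>h. if h = j then 1 else 0) (Var i * p)" by simp
  then show False using \<open>i \<noteq> j\<close> by (simp add: ev.hom_mult)
qed

lemma basic_open_mult: "basic_open f \<Longrightarrow> basic_open g \<Longrightarrow> basic_open (f * g)"
  unfolding basic_open_def by (metis add_pos_pos homogeneous_mult mult_eq_0_iff)

lemma basic_open_Var: "basic_open (Var i)"
  unfolding basic_open_def by (intro conjI Var_neq_0 exI[of _ "Suc 0"]) simp_all

lemma basic_open_le_mult: "basic_open_le (f * g) f" "basic_open_le (f * g) g"
  unfolding basic_open_le_def by (rule exI[of _ 1], simp)+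

lemma homogeneous_unique:
  assumes "homogeneous m p" "homogeneous n p" "p \<noteq> 0"
  shows "m = n"
  using assms hc_homogeneous by metis

lemma twist_memI:
  assumes "homogeneous r f" "homogeneous m g" "int m = n + int (j * r)"
  shows "Fract g (f ^ j) \<in> twist n f"
  unfolding twist_def using assms by blast

lemma prime_power_dvd_cancel:
  fixes p :: "'a::idom"
  assumes p: "prime_elem p" "\<not> p dvd b" and "p ^ n dvd a * b"
  shows "p ^ n dvd a"
  using assms(3)
proof (induction n arbitrary: a)
  case (Suc n)
  have "p dvd a * b" using Suc(2) by (metis dvd_mult_left power_Suc)
  then obtain a' where a': "a = p * a'" using prime_elem_dvd_multD[OF p(1)] p(2) by blast
  have "p \<noteq> 0" by (rule prime_elem_not_zeroI[OF p(1)])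
  then have "p ^ n dvd a' * b" using Suc(2) by (simp add: a' mult.assoc)
  then show ?case using Suc(1)[of a'] by (simp add: a' mult_dvd_mono)
qed simp

lemma der_bundle_memI:
  assumes "homogeneous r f" "w \<in> syz A" "w \<in> vforms (N * r)"
  shows "(\<lambda>p. Fract (der w p) (f ^ N)) \<in> der_bundle A f"
proof -
  have "der w \<in> D0 A" using assms(2) by (simp add: D0_def syz_def der_in_Der)
  moreover have "der_homogeneous (N * r) (der w)" using assms(3) by (simp add: der_homogeneous_def vforms_def)
  ultimately show ?thesis unfolding der_bundle_def using assms(1) by blast
qed

lemma vforms_pscale: "homogeneous m p \<Longrightarrow> v \<in> vforms n \<Longrightarrow> pscale p v \<in> vforms (m + n)"
  by (simp add: vforms_def pscale_def homogeneous_mult)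

lemma homogeneous_cancel:
  assumes "homogeneous m p" "p \<noteq> 0" "homogeneous (m + n) (p * q)"
  shows "homogeneous n q"
proof -
  have "p * q = hc (m + n) (p * q)" using hc_homogeneous[OF assms(3), of "m + n"] by simp
  also have "\<dots> = p * hc n q" by (simp add: hc_mult_left[OF assms(1)])
  finally have "q = hc n q" using assms(2) by simp
  then show ?thesis by (metis homogeneous_hc)
qed

text \<open>Over \<open>D\<^sub>+(x\<^sub>1)\<close> and \<open>D\<^sub>+(x\<^sub>2)\<close> the sections \<open>1 / x\<^sub>i\<^sup>e\<close> of \<open>\<O>(-e)\<close> differ by a unit of degree zero;
  the same unit relates their preimages, which therefore glue to an element of \<open>D\<^sub>0\<close>.\<close>

lemma der_bundle_sections:
  fixes A :: "('k::field_char_0 ^ 3) set set"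
  assumes iso: "sheaf_iso (der_bundle A) (twist_sq (- int e))"
  obtains t :: "2 \<Rightarrow> 3 \<Rightarrow> 'k poly3" where "\<And>c. t c \<in> syz A" "\<And>c. t c \<in> vforms e"
    "\<And>n (g :: 2 \<Rightarrow> 'k poly3) c. (\<And>c. homogeneous n (g c)) \<Longrightarrow> pscale (g 1) (t 1) + pscale (g 2) (t 2) = 0 \<Longrightarrow> g c = 0"
proof -
  obtain \<phi> where \<phi>: "\<forall>f. basic_open f \<longrightarrow>
        bij_betw (\<phi> f) (der_bundle A f) (twist_sq (- int e) f) \<and>
        (\<forall>s\<in>der_bundle A f. \<forall>t\<in>der_bundle A f. \<phi> f (s + t) = \<phi> f s + \<phi> f t) \<and>
        (\<forall>a\<in>twist 0 f. \<forall>s\<in>der_bundle A f. \<phi> f (pscale a s) = pscale a (\<phi> f s))"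
     "\<forall>f g. basic_open f \<longrightarrow> basic_open g \<longrightarrow> basic_open_le g f \<longrightarrow> (\<forall>s\<in>der_bundle A f. \<phi> g s = \<phi> f s)"
    using iso unfolding sheaf_iso_def by (elim exE conjE)
  have bij: "bij_betw (\<phi> f) (der_bundle A f) (twist_sq (- int e) f)" if "basic_open f" for f
    using \<phi>(1) that by simp
  have add: "\<phi> f (s + t) = \<phi> f s + \<phi> f t" if "basic_open f" "s \<in> der_bundle A f" "t \<in> der_bundle A f" for f s t
    using \<phi>(1) that by simp
  have scale: "\<phi> f (pscale a s) = pscale a (\<phi> f s)" if "basic_open f" "a \<in> twist 0 f" "s \<in> der_bundle A f" for f a s
    using \<phi>(1) that by simp
  have restr: "\<phi> g s = \<phi> f s" if "basic_open f" "basic_open g" "basic_open_le g f" "s \<in> der_bundle A f" for f g s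
    using \<phi>(2) that by simp
  let ?x = "Var :: 3 \<Rightarrow> 'k poly3"
  have xp: "?x i ^ n \<noteq> 0" for i n by simp
  have hx: "homogeneous n (?x i ^ n)" for i n using homogeneous_power[OF homogeneous_Var, of n i] by simp
  \<comment> \<open>The standard generators of the two summands over D_+(x_i): 1/x_i^e in component
    c.\<close>
  define \<tau> where "\<tau> c i = (\<lambda>c'::2. if c' = c then Fract 1 (?x i ^ e) else 0)" for c i
  have \<tau>: "\<tau> c i \<in> twist_sq (- int e) (?x i)" for c i
    unfolding twist_sq_def
  proof (intro CollectI allI)
    fix c'
    have "Fract (if c' = c then 1 else 0) (?x i ^ e) \<in> twist (- int e) (?x i)"
      by (rule twist_memI[of 1 _ 0]) auto
    then show "\<tau> c i c' \<in> twist (- int e) (?x i)"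
      unfolding \<tau>_def by (cases "c' = c") (simp_all add: fract_collapse xp)
  qed
  define s where "s c i = (SOME s. s \<in> der_bundle A (?x i) \<and> \<phi> (?x i) s = \<tau> c i)" for c i
  have s': "s c i \<in> der_bundle A (?x i) \<and> \<phi> (?x i) (s c i) = \<tau> c i" for c i
  proof -
    have "\<exists>s. s \<in> der_bundle A (?x i) \<and> \<phi> (?x i) s = \<tau> c i"
      using bij[OF basic_open_Var[of i]] \<tau>[of c i] unfolding bij_betw_def by (metis imageE)
    from someI_ex[OF this] show ?thesis unfolding s_def .
  qed
  then have s: "\<And>c i. s c i \<in> der_bundle A (?x i)" "\<And>c i. \<phi> (?x i) (s c i) = \<tau> c i" by blast+
  have "\<exists>v j. s c i = (\<lambda>p. Fract (der v p) (?x i ^ j)) \<and> v \<in> syz A \<and> v \<in> vforms j" for c i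
  proof -
    obtain \<theta> j r where *: "s c i = (\<lambda>p. Fract (\<theta> p) (?x i ^ j))" "\<theta> \<in> D0 A" "homogeneous r (?x i)" "der_homogeneous (j * r) \<theta>"
      using s(1)[of c i] unfolding der_bundle_def by blast
    have "r = 1" using homogeneous_unique[OF *(3) homogeneous_Var] by simp
    moreover have "\<theta> = der (\<lambda>h. \<theta> (?x h))" by (rule Der_eq_der) (use *(2) in \<open>simp add: D0_def\<close>)
    ultimately show ?thesis
      using * by (intro exI[of _ "\<lambda>h. \<theta> (?x h)"] exI[of _ j]) (simp add: D0_def syz_def der_homogeneous_def vforms_def)
  qed
  then obtain v j where v: "\<And>c i. s c i = (\<lambda>p. Fract (der (v c i) p) (?x i ^ j c i))" "\<And>c i. v c i \<in> syz A"
    "\<And>c i. v c i \<in> vforms (j c i)" by metis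
  have glue: "?x 1 ^ e * ?x 2 ^ j c 2 * v c 1 h = ?x 1 ^ j c 1 * ?x 2 ^ e * v c 2 h" for c h
  proof -
    let ?f = "?x 1 * ?x 2"
    have f: "basic_open ?f" by (intro basic_open_mult basic_open_Var)
    have le: "basic_open_le ?f (?x 1)" "basic_open_le ?f (?x 2)" by (rule basic_open_le_mult)+
    have hf: "homogeneous 2 ?f" using homogeneous_mult[OF homogeneous_Var homogeneous_Var, of 1 2] by (simp add: numeral_2_eq_2)
    \<comment> \<open>This is (x_2/x_1)^e, written over a power of f = x_1 x_2 to be visibly a
      function of degree zero on D_+(f).\<close>
    let ?u = "Fract ((?x 2 ^ e * ?x 2 ^ e)) (?f ^ e)"
    have u: "?u \<in> twist 0 ?f"
      by (rule twist_memI[OF hf homogeneous_mult[OF hx hx]]) simp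
    have "s c 1 = (\<lambda>p. Fract (der (pscale (?x 2 ^ j c 1) (v c 1)) p) (?f ^ j c 1))"
      unfolding v(1) der_pscale by (intro ext) (simp add: eq_fract power_mult_distrib mult_ac xp)
    also have "\<dots> \<in> der_bundle A ?f"
      by (rule der_bundle_memI[OF hf syz_pscale[OF v(2)]]) (use vforms_pscale[OF hx v(3)] in \<open>simp add: mult_2_right\<close>)
    finally have i1: "s c 1 \<in> der_bundle A ?f" .
    have "s c 2 = (\<lambda>p. Fract (der (pscale (?x 1 ^ j c 2) (v c 2)) p) (?f ^ j c 2))"
      unfolding v(1) der_pscale by (intro ext) (simp add: eq_fract power_mult_distrib mult_ac xp)
    also have "\<dots> \<in> der_bundle A ?f"
      by (rule der_bundle_memI[OF hf syz_pscale[OF v(2)]]) (use vforms_pscale[OF hx v(3)] in \<open>simp add: mult_2_right\<close>)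
    finally have i2: "s c 2 \<in> der_bundle A ?f" .
    have "pscale ?u (s c 2) = (\<lambda>p. Fract (der (pscale ((?x 2 ^ e * ?x 2 ^ e) * ?x 1 ^ j c 2) (v c 2)) p) (?f ^ (e + j c 2)))"
      unfolding v(1) der_pscale pscale_def[of ?u] by (intro ext) (simp add: eq_fract power_mult_distrib power_add mult_ac xp)
    also have "\<dots> \<in> der_bundle A ?f"
    proof (rule der_bundle_memI[OF hf syz_pscale[OF v(2)]])
      have "pscale ((?x 2 ^ e * ?x 2 ^ e) * ?x 1 ^ j c 2) (v c 2) \<in> vforms ((e + e + j c 2) + j c 2)"
        by (intro vforms_pscale homogeneous_mult hx v(3))
      moreover have "(e + e + j c 2) + j c 2 = (e + j c 2) * 2" by simp
      ultimately show "pscale ((?x 2 ^ e * ?x 2 ^ e) * ?x 1 ^ j c 2) (v c 2) \<in> vforms ((e + j c 2) * 2)" by metis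
    qed
    finally have i3: "pscale ?u (s c 2) \<in> der_bundle A ?f" .
    have "\<phi> ?f (s c 1) = \<tau> c 1" using restr[OF basic_open_Var f le(1) s(1)] s(2) by metis
    also have "\<tau> c 1 = pscale ?u (\<tau> c 2)"
      by (rule ext) (simp add: \<tau>_def pscale_def eq_fract power_mult_distrib power_add mult_ac xp)
    also have "\<dots> = pscale ?u (\<phi> ?f (s c 2))" using restr[OF basic_open_Var f le(2) s(1)] s(2) by metis
    also have "\<dots> = \<phi> ?f (pscale ?u (s c 2))" using scale[OF f u i2] by simp
    finally have "s c 1 = pscale ?u (s c 2)"
      using bij[OF f] i1 i3 unfolding bij_betw_def by (metis inj_onD)
    then have "s c 1 (?x h) = pscale ?u (s c 2) (?x h)" by simp
    then have "Fract (v c 1 h) (?x 1 ^ j c 1) = Fract ((?x 2 ^ e * ?x 2 ^ e) * v c 2 h) (?f ^ e * ?x 2 ^ j c 2)"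
      unfolding v(1) pscale_def by simp
    then have "v c 1 h * (?f ^ e * ?x 2 ^ j c 2) = (?x 2 ^ e * ?x 2 ^ e) * v c 2 h * ?x 1 ^ j c 1"
      by (subst (asm) eq_fract(1)) (simp_all add: xp)
    then have "?x 2 ^ e * (?x 1 ^ e * ?x 2 ^ j c 2 * v c 1 h) = ?x 2 ^ e * (?x 1 ^ j c 1 * ?x 2 ^ e * v c 2 h)"
      by (simp add: power_mult_distrib mult_ac)
    then show ?thesis using xp[of 2 e] by simp
  qed
  \<comment> \<open>The relation just glued has a factor x_1^j on the right and a power of x_2,
    coprime to it, on the left. Hence x_1^e times the section over D_+(x_1) has no denominator; this
    polynomial vector is the global element t.\<close>
  have "\<exists>y. ?x 1 ^ e * v c 1 h = ?x 1 ^ j c 1 * y" for c h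
  proof -
    have "(?x 1 ^ e * v c 1 h) * ?x 2 ^ j c 2 = ?x 1 ^ j c 1 * (?x 2 ^ e * v c 2 h)"
      using glue[of c h] by (simp only: mult_ac)
    then have "?x 1 ^ j c 1 dvd (?x 1 ^ e * v c 1 h) * ?x 2 ^ j c 2" by simp
    moreover have "\<not> ?x 1 dvd ?x 2 ^ j c 2"
      using prime_elem_dvd_power[OF prime_Var] Var_dvd_Var[of 1 2] by fastforce
    ultimately have "?x 1 ^ j c 1 dvd ?x 1 ^ e * v c 1 h"
      using prime_power_dvd_cancel[OF prime_Var] by blast
    then show ?thesis by blast
  qed
  then obtain t where t: "\<And>c h. ?x 1 ^ e * v c 1 h = ?x 1 ^ j c 1 * t c h" by metis
  have t': "pscale (?x 1 ^ j c 1) (t c) = pscale (?x 1 ^ e) (v c 1)" for c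
    by (rule ext) (simp add: pscale_def t)
  have tsyz: "t c \<in> syz A" for c
    by (rule syz_cancel[OF xp[of 1 "j c 1"]]) (simp only: t' syz_pscale[OF v(2)])
  have th: "t c \<in> vforms e" for c
    unfolding vforms_def
  proof (intro CollectI allI)
    fix h
    have "homogeneous (e + j c 1) (?x 1 ^ e * v c 1 h)"
      using v(3)[of c 1] by (intro homogeneous_mult hx) (simp add: vforms_def)
    then have "homogeneous (j c 1 + e) (?x 1 ^ j c 1 * t c h)" by (simp add: t add.commute)
    then show "homogeneous e (t c h)" by (rule homogeneous_cancel[OF hx xp])
  qed
  show ?thesis
  proof (rule that[OF tsyz th])
    fix n c and g :: "2 \<Rightarrow> 'k poly3"
    assume g: "\<And>c. homogeneous n (g c)" and 0: "pscale (g 1) (t 1) + pscale (g 2) (t 2) = 0"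
    \<comment> \<open>Independence is checked over D_+(x_1): dividing g_c t_c by x_1^(n+e) gives the
      degree zero multiple g_c/x_1^n of the local section, which the isomorphism sends into
      component c. A relation between the t_c therefore splits into its two components.\<close>
    define z where "z c = (\<lambda>p. Fract (der (pscale (g c) (t c)) p) (?x 1 ^ (n + e)))" for c
    have z_mem: "z c \<in> der_bundle A (?x 1)" for c
      unfolding z_def
      by (rule der_bundle_memI[OF homogeneous_Var syz_pscale[OF tsyz]]) (use vforms_pscale[OF g th] in simp)
    have z: "z c = pscale (Fract (g c) (?x 1 ^ n)) (s c 1)" for c
    proof
      fix p
      have k: "?x 1 ^ j c 1 * der (t c) p = ?x 1 ^ e * der (v c 1) p"
        using arg_cong[OF t'[of c], of "\<lambda>w. der w p"] by (simp only: der_pscale)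
      have e: "g c * der (t c) p * (?x 1 ^ n * ?x 1 ^ j c 1) = g c * ?x 1 ^ n * (?x 1 ^ j c 1 * der (t c) p)"
        "g c * der (v c 1) p * ?x 1 ^ (n + e) = g c * ?x 1 ^ n * (?x 1 ^ e * der (v c 1) p)"
        by (simp_all only: mult_ac power_add)
      have "g c * der (t c) p * (?x 1 ^ n * ?x 1 ^ j c 1) = g c * der (v c 1) p * ?x 1 ^ (n + e)"
        unfolding e k ..
      then show "z c p = pscale (Fract (g c) (?x 1 ^ n)) (s c 1) p"
        unfolding z_def v(1) pscale_def[of "Fract _ _"] der_pscale mult_fract
        by (subst eq_fract(1)) (simp_all add: xp)
    qed
    have ph: "\<phi> (?x 1) (z c) = pscale (Fract (g c) (?x 1 ^ n)) (\<tau> c 1)" for c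
    proof -
      have "Fract (g c) (?x 1 ^ n) \<in> twist 0 (?x 1)" by (rule twist_memI[OF homogeneous_Var g]) simp
      then show ?thesis unfolding z using scale[OF basic_open_Var _ s(1)] s(2) by metis
    qed
    have "z 1 + z 2 = 0"
    proof
      fix p
      have "z 1 p + z 2 p = Fract (der (pscale (g 1) (t 1)) p + der (pscale (g 2) (t 2)) p) (?x 1 ^ (n + e))"
        unfolding z_def by (simp add: eq_fract xp algebra_simps)
      also have "der (pscale (g 1) (t 1)) p + der (pscale (g 2) (t 2)) p = 0"
        unfolding der_plus_vec[symmetric] 0 by (rule der_zero_vec)
      finally show "(z 1 + z 2) p = 0 p" by (simp add: fract_collapse xp)
    qed
    then have "\<phi> (?x 1) 0 = \<phi> (?x 1) (z 1) + \<phi> (?x 1) (z 2)"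
      using add[OF basic_open_Var z_mem z_mem] by metis
    moreover have "\<phi> (?x 1) 0 = 0"
    proof -
      have "(\<lambda>p. Fract (der 0 p) (?x 1 ^ 0)) \<in> der_bundle A (?x 1)"
        by (rule der_bundle_memI[OF homogeneous_Var syz_0]) (simp add: vforms_def)
      moreover have "(\<lambda>p. Fract (der 0 p) (?x 1 ^ 0)) = 0"
        by (rule ext) (simp add: fract_collapse)
      ultimately have "0 \<in> der_bundle A (?x 1)" by simp
      from add[OF basic_open_Var this this] show ?thesis by simp
    qed
    ultimately have "pscale (Fract (g 1) (?x 1 ^ n)) (\<tau> 1 1) + pscale (Fract (g 2) (?x 1 ^ n)) (\<tau> 2 1) = 0"
      unfolding ph by (rule trans[OF sym])
    from fun_cong[OF this, of c]
    have *: "Fract (g 1) (?x 1 ^ n) * \<tau> 1 1 c + Fract (g 2) (?x 1 ^ n) * \<tau> 2 1 c = 0"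
      by (simp add: pscale_def)
    have "Fract (g c) (?x 1 ^ n) * Fract 1 (?x 1 ^ e) = 0"
    proof (cases "c = 1")
      case True
      then show ?thesis using * by (simp only: \<tau>_def) simp
    next
      case False
      then have "c = 2" using exhaust_2[of c] by simp
      then show ?thesis using * by (simp only: \<tau>_def) simp
    qed
    then show "g c = 0" by (simp add: Zero_fract_def eq_fract xp)
  qed
qed

text \<open>Pairs of forms of degree n embed as coefficients of the two elements t_1, t_2 of degree
  e.\<close>

lemma dim_syz_ge:
  fixes A :: "('k::field_char_0 ^ 3) set set"
  assumes iso: "sheaf_iso (der_bundle A) (twist_sq (- int e))"
  shows "kV.dim (syz A \<inter> vforms (n + e)) \<ge> 2 * rdim n"
proof -
  obtain t :: "2 \<Rightarrow> 3 \<Rightarrow> 'k poly3" where t: "\<And>c. t c \<in> syz A" "\<And>c. t c \<in> vforms e"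
    "\<And>n (g :: 2 \<Rightarrow> 'k poly3) c. (\<And>c. homogeneous n (g c)) \<Longrightarrow> pscale (g 1) (t 1) + pscale (g 2) (t 2) = 0 \<Longrightarrow> g c = 0"
    using der_bundle_sections[OF iso] by blast
  let ?T = "\<lambda>g :: 2 \<Rightarrow> 'k poly3. pscale (g 1) (t 1) + pscale (g 2) (t 2)"
  obtain F :: "(2 \<Rightarrow> 'k poly3) set" where F: "finite F" "vforms n \<subseteq> kV.span F"
    using vforms_finite_span by blast
  obtain G :: "(3 \<Rightarrow> 'k poly3) set" where G: "finite G" "vforms (n + e) \<subseteq> kV.span G"
    using vforms_finite_span by blast
  have lin: "Vector_Spaces.linear kvscale kvscale ?T"
    by unfold_locales (auto simp: kvscale_def pscale_def fun_eq_iff algebra_simps)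
  have "kV.dim (?T ` vforms n) = kV.dim (vforms n :: (2 \<Rightarrow> 'k poly3) set)"
    by (rule kVV.dim_image_inj[OF lin subspace_vforms F(2,1)])
      (use t(3)[of n] in \<open>auto simp: vforms_def fun_eq_iff\<close>)
  then have "kV.dim (?T ` vforms n) = 2 * rdim n" by (simp add: dim_vforms')
  moreover have "?T ` vforms n \<subseteq> syz A \<inter> vforms (n + e)"
  proof (intro subsetI IntI)
    fix w assume "w \<in> ?T ` vforms n"
    then obtain g where g: "g \<in> vforms n" "w = ?T g" by blast
    show "w \<in> syz A" unfolding g(2) by (intro syz_add syz_pscale t)
    have "pscale (g c) (t c) \<in> vforms (n + e)" for c
      using g(1) t(2) by (intro vforms_pscale) (auto simp: vforms_def)
    then show "w \<in> vforms (n + e)"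
      unfolding g(2) using kV.subspace_add[OF subspace_vforms] by blast
  qed
  then have "kV.dim (?T ` vforms n) \<le> kV.dim (syz A \<inter> vforms (n + e))"
    by (rule kV.dim_mono_finite[OF _ _ G(1)]) (use G(2) in blast)
  ultimately show ?thesis by simp
qed

section \<open>Determinants of derivations\<close>

definition det3 :: "(3 \<Rightarrow> 'a::comm_ring_1) \<Rightarrow> (3 \<Rightarrow> 'a) \<Rightarrow> (3 \<Rightarrow> 'a) \<Rightarrow> 'a" where
  "det3 u v w = u 1 * (v 2 * w 3 - v 3 * w 2) - u 2 * (v 1 * w 3 - v 3 * w 1) + u 3 * (v 1 * w 2 - v 2 * w 1)"

text \<open>Replacing the i-th column by the combination of all columns with coefficients a
  multiplies the determinant by a_i; the right-hand sides expand along that column.\<close>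

lemma det3_column:
  "a 1 * det3 u v w = (\<Sum>i\<in>UNIV. a i * u i) * (v 2 * w 3 - v 3 * w 2) -
    (\<Sum>i\<in>UNIV. a i * v i) * (u 2 * w 3 - u 3 * w 2) + (\<Sum>i\<in>UNIV. a i * w i) * (u 2 * v 3 - u 3 * v 2)"
  "a 2 * det3 u v w = - ((\<Sum>i\<in>UNIV. a i * u i) * (v 1 * w 3 - v 3 * w 1)) +
    (\<Sum>i\<in>UNIV. a i * v i) * (u 1 * w 3 - u 3 * w 1) - (\<Sum>i\<in>UNIV. a i * w i) * (u 1 * v 3 - u 3 * v 1)"
  "a 3 * det3 u v w = (\<Sum>i\<in>UNIV. a i * u i) * (v 1 * w 2 - v 2 * w 1) -
    (\<Sum>i\<in>UNIV. a i * v i) * (u 1 * w 2 - u 2 * w 1) + (\<Sum>i\<in>UNIV. a i * w i) * (u 1 * v 2 - u 2 * v 1)"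
  unfolding sum_3 det3_def by (simp_all add: algebra_simps)

text \<open>For a line with normal a, the combined column of \<open>det3_column\<close> consists of
  the values of the three fields on the form of the line, which that form divides; some a_i is a
  unit.\<close>

lemma det3_log_vf:
  assumes B: "arrangement B" and log: "u \<in> log_vf B" "v \<in> log_vf B" "w \<in> log_vf B"
  shows "defining_poly B dvd det3 u v w"
proof (rule defining_poly_dvd[OF B])
  fix H assume H: "H \<in> B"
  let ?a = "normal H"
  have d: "plane_form H dvd (\<Sum>i\<in>UNIV. Const (?a $ i) * v i)" if "v \<in> log_vf B" for v
    using that H by (simp add: log_vf_def plane_form_normal der_linear_form)
  have "?a \<noteq> 0" using normal(1) B H by (auto simp: arrangement_is_plane)
  then obtain i where i: "?a $ i \<noteq> 0" by (auto simp: Finite_Cartesian_Product.vec_eq_iff)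
  have "plane_form H dvd Const (?a $ i) * det3 u v w"
    using exhaust_3[of i] d[OF log(1)] d[OF log(2)] d[OF log(3)]
    by (elim disjE; simp only: det3_column[of "\<lambda>i. Const (?a $ i)"]; intro dvd_add dvd_diff dvd_mult2; simp)
  then have "plane_form H dvd Const (inverse (?a $ i)) * (Const (?a $ i) * det3 u v w)" by simp
  then show "plane_form H dvd det3 u v w"
    using Const_inverse[OF i] by (simp only: mult.assoc[symmetric] mult_1_left)
qed

lemma homogeneous_det3:
  assumes "u \<in> vforms a" "v \<in> vforms b" "w \<in> vforms c"
  shows "homogeneous (a + b + c) (det3 u v w)"
proof -
  have "homogeneous (a + b + c) (u i * (v j * w k - v l * w n))" for i j k l n
    using assms unfolding vforms_def mem_Collect_eq add.assoc
    by (intro homogeneous_mult homogeneous_diff) auto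
  then show ?thesis unfolding det3_def by (intro homogeneous_add homogeneous_diff)
qed

lemma Cramer3:
  "det3 x v w * u i = det3 u v w * x i + det3 x u w * v i + det3 x v u * w i"
  using exhaust_3[of i] by (auto simp: det3_def algebra_simps)

definition unit_vec :: "3 \<Rightarrow> 3 \<Rightarrow> 'k::field_char_0 poly3" where
  "unit_vec i = (\<lambda>j. if j = i then 1 else 0)"

lemma der_unit_vec: "der v p = (\<Sum>i\<in>UNIV. v i * der (unit_vec i) p)"
proof -
  have "v = pscale (v 1) (unit_vec 1) + pscale (v 2) (unit_vec 2) + pscale (v 3) (unit_vec 3)"
    unfolding fun_eq_iff forall_3 by (simp add: pscale_def unit_vec_def)
  then have "der v p = der (pscale (v 1) (unit_vec 1) + pscale (v 2) (unit_vec 2) + pscale (v 3) (unit_vec 3)) p"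
    by simp
  then show ?thesis by (simp only: der_plus_vec der_pscale sum_3)
qed

text \<open>For syzygies \<open>v\<close>, \<open>w\<close> the cross product \<open>v \<times> w\<close> is parallel to the gradient of \<open>Q\<close>.\<close>

lemma det3_syz_eq_0:
  fixes v w :: "3 \<Rightarrow> 'k::field_char_0 poly3"
  assumes B: "arrangement B" "card B > 0" and syz: "v \<in> syz B" "w \<in> syz B" and 0: "det3 Var v w = 0"
  shows "v i * w j = v j * w i"
proof -
  let ?Q = "defining_poly B" and ?q = "\<lambda>i. der (unit_vec i) (defining_poly B)"
  let ?dQ = "of_nat (card B) * defining_poly B"
  have v: "v 1 * ?q 1 + v 2 * ?q 2 + v 3 * ?q 3 = 0" and w: "w 1 * ?q 1 + w 2 * ?q 2 + w 3 * ?q 3 = 0"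
    using syz der_unit_vec[of v ?Q] der_unit_vec[of w ?Q] unfolding syz_def mem_Collect_eq sum_3 by simp_all
  have x: "Var 1 * ?q 1 + Var 2 * ?q 2 + Var 3 * ?q 3 = ?dQ"
    using Euler_defining_poly[of B] der_unit_vec[of Var ?Q] unfolding sum_3 by simp
  have nz: "?dQ \<noteq> 0" using defining_poly_neq_0[OF B(1)] B(2) by simp
  \<comment> \<open>In vector notation q x (v x w) = 0 since v and w are orthogonal to q. Expanding
    x x (q x (v x w)) = 0 gives (x . q)(v x w) = (x . (v x w)) q, and the right side is 0 by the
    third premise.\<close>
  have id: "(x1 * q1 + x2 * q2 + x3 * q3) * (v2 * w3 - v3 * w2) = 0 \<and>
      (x1 * q1 + x2 * q2 + x3 * q3) * (v1 * w3 - v3 * w1) = 0 \<and>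
      (x1 * q1 + x2 * q2 + x3 * q3) * (v1 * w2 - v2 * w1) = 0"
    if "v1 * q1 + v2 * q2 + v3 * q3 = 0" "w1 * q1 + w2 * q2 + w3 * q3 = 0"
      "x1 * (v2 * w3 - v3 * w2) - x2 * (v1 * w3 - v3 * w1) + x3 * (v1 * w2 - v2 * w1) = 0"
    for x1 x2 x3 q1 q2 q3 v1 v2 v3 w1 w2 w3 :: "'k poly3"
    using that by (intro conjI; Groebner_Basis.algebra)
  have "?dQ * (v 2 * w 3 - v 3 * w 2) = 0 \<and> ?dQ * (v 1 * w 3 - v 3 * w 1) = 0 \<and> ?dQ * (v 1 * w 2 - v 2 * w 1) = 0"
    using id[OF v w 0[unfolded det3_def]] unfolding x .
  then have "v 2 * w 3 = v 3 * w 2" "v 1 * w 3 = v 3 * w 1" "v 1 * w 2 = v 2 * w 1"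
    using nz by simp_all
  then show ?thesis using exhaust_3[of i] exhaust_3[of j] by auto
qed

text \<open>The determinant is a multiple of Q and homogeneous of degree a + b + 1, the Euler field
  contributing 1. In the boundary case the cofactor has degree 0.\<close>

lemma det3_syz_degree:
  assumes B: "arrangement B" and v: "v \<in> syz B \<inter> vforms a" and w: "w \<in> syz B \<inter> vforms b"
    and nz: "det3 Var v w \<noteq> 0"
  shows "card B \<le> Suc (a + b)" "card B = Suc (a + b) \<Longrightarrow> \<exists>c. c \<noteq> 0 \<and> det3 Var v w = Const c * defining_poly B"
proof -
  have V: "Var \<in> log_vf B" unfolding log_vf_iff[OF B] Euler_defining_poly by simp
  have "defining_poly B dvd det3 Var v w"
    by (rule det3_log_vf[OF B V]) (use v w syz_subset_log_vf[OF B] in auto)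
  then obtain y where y: "det3 Var v w = defining_poly B * y" by blast
  have "Var \<in> vforms 1" by (simp add: vforms_def)
  then have h: "homogeneous (Suc (a + b)) (det3 Var v w)"
    using homogeneous_det3[of Var 1 v a w b] v w by simp
  then have "det3 Var v w = hc (Suc (a + b)) (defining_poly B * y)"
    using hc_homogeneous[OF h, of "Suc (a + b)"] y by simp
  then show "card B \<le> Suc (a + b)"
    using nz unfolding hc_mult_left[OF homogeneous_defining_poly] by (auto split: if_splits)
  assume "card B = Suc (a + b)"
  then have "homogeneous 0 y"
    using homogeneous_cancel[OF homogeneous_defining_poly defining_poly_neq_0[OF B], of 0 y] h y by simp
  then obtain c where "y = Const c" by (auto simp: homogeneous_0_iff)
  then show "\<exists>c. c \<noteq> 0 \<and> det3 Var v w = Const c * defining_poly B"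
    using y nz by (intro exI[of _ c]) auto
qed

text \<open>With Q_j the partial derivatives, this is the sum over j of x_j times the Koszul syzygy
  Q_j d/dx_i - Q_i d/dx_j, rewritten with Euler's formula. Equivalently, it is d times the
  projection of Q d/dx_i to D_0 along the Euler field.\<close>

definition koszul :: "('k::field_char_0 ^ 3) set set \<Rightarrow> 3 \<Rightarrow> 3 \<Rightarrow> 'k poly3" where
  "koszul B i = pscale (of_nat (card B) * defining_poly B) (unit_vec i) - pscale (der (unit_vec i) (defining_poly B)) Var"

lemma koszul_syz: "koszul B i \<in> syz B"
  unfolding syz_def koszul_def mem_Collect_eq der_minus_vec der_pscale Euler_defining_poly by (simp add: algebra_simps)

lemma koszul_vforms:
  assumes "card B > 0"
  shows "koszul B i \<in> vforms (card B)"
proof -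
  let ?d = "card B"
  have 1: "homogeneous (?d - 1) (der (unit_vec i) (defining_poly B))"
    by (rule homogeneous_der[OF homogeneous_defining_poly, of 0]) (use assms in \<open>auto simp: unit_vec_def\<close>)
  have "homogeneous ?d (of_nat ?d * defining_poly B * unit_vec i j)" for j
    using homogeneous_Const_mult[OF homogeneous_defining_poly[of B], of "of_nat ?d"] by (simp add: unit_vec_def Const_of_nat)
  moreover have "homogeneous ?d (der (unit_vec i) (defining_poly B) * Var j)" for j
    using homogeneous_mult[OF 1 homogeneous_Var] assms by simp
  ultimately show ?thesis
    unfolding vforms_def koszul_def pscale_def by (auto intro: homogeneous_diff)
qed

text \<open>The Euler part of \<open>koszul B i\<close> drops out of the determinant, which becomes
  d Q times a component of x x v. If all vanish, v is proportional to the Euler field; but v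
  annihilates Q and the Euler field does not, so v = 0.\<close>

lemma exists_independent_syz:
  fixes v :: "3 \<Rightarrow> 'k::field_char_0 poly3"
  assumes B: "arrangement B" "card B > 0" and v: "v \<in> syz B" "v \<noteq> 0"
  shows "\<exists>i. det3 Var v (koszul B i) \<noteq> 0"
proof (rule ccontr)
  let ?q = "\<lambda>i. der (unit_vec i) (defining_poly B)" and ?dQ = "of_nat (card B) * defining_poly B"
  assume "\<not> ?thesis"
  then have 0: "det3 Var v (koszul B i) = 0" for i by simp
  have nz: "?dQ \<noteq> 0" using defining_poly_neq_0[OF B(1)] B(2) by simp
  have e: "unit_vec i j = (if j = i then 1 else 0 :: 'k poly3)" for i j by (simp add: unit_vec_def)
  have "det3 Var v (koszul B 1) = ?dQ * (Var 2 * v 3 - Var 3 * v 2)"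
    "det3 Var v (koszul B 2) = - (?dQ * (Var 1 * v 3 - Var 3 * v 1))"
    "det3 Var v (koszul B 3) = ?dQ * (Var 1 * v 2 - Var 2 * v 1)"
    by (simp_all add: det3_def koszul_def pscale_def e algebra_simps)
  then have "?dQ * (Var 2 * v 3 - Var 3 * v 2) = 0" "?dQ * (Var 1 * v 3 - Var 3 * v 1) = 0" "?dQ * (Var 1 * v 2 - Var 2 * v 1) = 0"
    unfolding 0 by (simp_all only: neg_0_equal_iff_equal)
  then have x: "Var 2 * v 3 = Var 3 * v 2" "Var 1 * v 3 = Var 3 * v 1" "Var 1 * v 2 = Var 2 * v 1"
    using nz by (simp_all only: mult_eq_0_iff right_minus_eq simp_thms)
  have vq: "v 1 * ?q 1 + v 2 * ?q 2 + v 3 * ?q 3 = 0"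
    using v(1) der_unit_vec[of v "defining_poly B"] unfolding syz_def mem_Collect_eq sum_3 by simp
  have xq: "Var 1 * ?q 1 + Var 2 * ?q 2 + Var 3 * ?q 3 = ?dQ"
    using Euler_defining_poly[of B] der_unit_vec[of Var "defining_poly B"] unfolding sum_3 by simp
  have id: "v1 * (x1 * q1 + x2 * q2 + x3 * q3) = 0 \<and> v2 * (x1 * q1 + x2 * q2 + x3 * q3) = 0 \<and> v3 * (x1 * q1 + x2 * q2 + x3 * q3) = 0"
    if "v1 * q1 + v2 * q2 + v3 * q3 = 0" "x2 * v3 = x3 * v2" "x1 * v3 = x3 * v1" "x1 * v2 = x2 * v1"
    for x1 x2 x3 q1 q2 q3 v1 v2 v3 :: "'k poly3"
    using that by (intro conjI; Groebner_Basis.algebra)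
  have "v 1 = 0 \<and> v 2 = 0 \<and> v 3 = 0" using id[OF vq x] nz unfolding xq by simp
  then have "v = 0" unfolding fun_eq_iff forall_3 by simp
  then show False using v(2) by simp
qed

lemma exists_koszul_neq_0:
  assumes "arrangement B" "card B > 0"
  shows "koszul B 1 \<noteq> 0"
proof
  assume 0: "koszul B 1 = 0"
  have "koszul B 1 2 = 0" "koszul B 1 1 = 0" unfolding 0 by simp_all
  then have "der (unit_vec 1) (defining_poly B) = 0" "of_nat (card B) * defining_poly B = der (unit_vec 1) (defining_poly B) * Var 1"
    by (simp_all add: koszul_def pscale_def unit_vec_def)
  then show False using defining_poly_neq_0[OF assms(1)] assms(2) by simp
qed

subsection \<open>Saito's criterion\<close>

lemma D_eq: "arrangement B \<Longrightarrow> D B = der ` log_vf B"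
proof
  assume B: "arrangement B"
  show "D B \<subseteq> der ` log_vf B"
  proof
    fix \<theta> assume \<theta>: "\<theta> \<in> D B"
    then have e: "\<theta> = der (\<lambda>i. \<theta> (Var i))" by (intro Der_eq_der) (simp add: D_def)
    have "defining_poly B dvd der (\<lambda>i. \<theta> (Var i)) (defining_poly B)"
      unfolding e[symmetric] using \<theta> by (simp add: D_def)
    then show "\<theta> \<in> der ` log_vf B" using e log_vf_iff[OF B] by blast
  qed
  show "der ` log_vf B \<subseteq> D B" using log_vf_iff[OF B] by (auto simp: D_def der_in_Der)
qed

lemma D0_eq: "D0 B = der ` syz B"
proof
  show "D0 B \<subseteq> der ` syz B"
  proof
    fix \<theta> assume \<theta>: "\<theta> \<in> D0 B"
    then have e: "\<theta> = der (\<lambda>i. \<theta> (Var i))" by (intro Der_eq_der) (simp add: D0_def)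
    have "der (\<lambda>i. \<theta> (Var i)) (defining_poly B) = 0"
      unfolding e[symmetric] using \<theta> by (simp add: D0_def)
    then show "\<theta> \<in> der ` syz B" using e by (auto simp: syz_def)
  qed
  show "der ` syz B \<subseteq> D0 B" by (auto simp: D0_def syz_def der_in_Der)
qed

lemma module_hom_der: "module_hom pscale pscale (der :: (3 \<Rightarrow> 'k::field_char_0 poly3) \<Rightarrow> _)"
  by unfold_locales (auto simp: fun_eq_iff der_plus_vec der_pscale pscale_def[of _ "der _"])

lemma det3_combination:
  "det3 (pscale a x + pscale b v + pscale c w) v w = a * det3 x v w"
  "det3 x (pscale a x + pscale b v + pscale c w) w = b * det3 x v w"
  "det3 x v (pscale a x + pscale b v + pscale c w) = c * det3 x v w"
  by (simp_all add: det3_def pscale_def algebra_simps)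

lemma det3_0: "det3 0 v w = 0" "det3 x 0 w = 0" "det3 x v 0 = 0"
  by (simp_all add: det3_def)

text \<open>Cramer's rule expresses any logarithmic field in the three given ones with coefficients
  det/(c Q), and these are polynomials by \<open>det3_log_vf\<close>.\<close>

lemma Saito:
  fixes B :: "('k::field_char_0 ^ 3) set set"
  assumes B: "arrangement B" and v: "v \<in> syz B" and w: "w \<in> syz B"
    and c: "c \<noteq> 0" "det3 Var v w = Const c * defining_poly B"
  shows "free_module (D B)"
proof -
  let ?S = "{Var, v, w}"
  have nz: "det3 Var v w \<noteq> 0" using c defining_poly_neq_0[OF B] by simp
  have eq: "det3 v v w = 0" "det3 Var w w = 0" "det3 w v w = 0"
    by (simp_all add: det3_def algebra_simps)
  then have dist: "Var \<noteq> v" "v \<noteq> w" "Var \<noteq> w" using nz by metis+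
  have "Var \<in> log_vf B" unfolding log_vf_iff[OF B] Euler_defining_poly by simp
  then have log: "Var \<in> log_vf B" "v \<in> log_vf B" "w \<in> log_vf B"
    using syz_subset_log_vf[OF B] v w by auto
  interpret der: module_hom pscale pscale "der :: (3 \<Rightarrow> 'k poly3) \<Rightarrow> _" by (rule module_hom_der)
  have ind: "pmod.independent ?S"
    unfolding pmod.dependent_finite[OF finite.insertI[OF finite.insertI[OF finite.insertI[OF finite.emptyI]]]]
  proof
    assume "\<exists>u. (\<exists>s\<in>?S. u s \<noteq> 0) \<and> (\<Sum>s\<in>?S. pscale (u s) s) = 0"
    then obtain u where u: "\<exists>s\<in>?S. u s \<noteq> 0" "(\<Sum>s\<in>?S. pscale (u s) s) = 0" by blast
    have "(\<Sum>s\<in>?S. pscale (u s) s) = pscale (u Var) Var + pscale (u v) v + pscale (u w) w"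
      using dist by (simp add: add.assoc)
    then have "pscale (u Var) Var + pscale (u v) v + pscale (u w) w = 0" using u(2) by simp
    then have "u Var * det3 Var v w = 0" "u v * det3 Var v w = 0" "u w * det3 Var v w = 0"
      using det3_combination[where a = "u Var" and x = Var and b = "u v" and v = v and c = "u w" and w = w] by (simp_all add: det3_0)
    then show False using nz u(1) by auto
  qed
  have "pmod.independent (der ` ?S)"
    by (rule der.independent_injective_image[OF ind]) (auto intro!: inj_onI simp: der_inject)
  moreover have "pmod.span (der ` ?S) = D B"
  proof -
    have "pmod.span ?S = log_vf B"
    proof
      have "pmod.subspace (log_vf B)"
        unfolding pmod.subspace_def by (blast intro: log_vf_0 log_vf_add log_vf_pscale)
      then show "pmod.span ?S \<subseteq> log_vf B" using log by (intro pmod.span_minimal) auto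
      show "log_vf B \<subseteq> pmod.span ?S"
      proof
        fix u assume u: "u \<in> log_vf B"
        let ?Q = "defining_poly B"
        obtain g1 where g1: "det3 u v w = ?Q * g1" using det3_log_vf[OF B u log(2,3)] by blast
        obtain g2 where g2: "det3 Var u w = ?Q * g2" using det3_log_vf[OF B log(1) u log(3)] by blast
        obtain g3 where g3: "det3 Var v u = ?Q * g3" using det3_log_vf[OF B log(1,2) u] by blast
        have "u i = Const (inverse c) * (g1 * Var i + g2 * v i + g3 * w i)" for i
        proof -
          have "?Q * (Const c * u i) = ?Q * (g1 * Var i + g2 * v i + g3 * w i)"
            using Cramer3[of Var v w u i] unfolding c(2) g1 g2 g3 by (simp add: algebra_simps)
          then have "Const c * u i = g1 * Var i + g2 * v i + g3 * w i" using defining_poly_neq_0[OF B] by simp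
          then have "Const (inverse c) * (g1 * Var i + g2 * v i + g3 * w i) = (Const (inverse c) * Const c) * u i"
            by (simp only: mult.assoc)
          then show ?thesis using Const_inverse[OF c(1)] by simp
        qed
        then have "u = pscale (Const (inverse c)) (pscale g1 Var + pscale g2 v + pscale g3 w)"
          by (simp add: fun_eq_iff pscale_def)
        also have "\<dots> \<in> pmod.span ?S"
          by (intro pmod.span_scale pmod.span_add pmod.span_base) auto
        finally show "u \<in> pmod.span ?S" .
      qed
    qed
    then show ?thesis unfolding der.span_image D_eq[OF B] by simp
  qed
  ultimately show ?thesis unfolding free_module_def by blast
qed

section \<open>The Hilbert function of the syzygies\<close>

lemma linear_pscale: "Vector_Spaces.linear kvscale kvscale (\<lambda>v. pscale p v)"
  by unfold_locales (auto simp: kvscale_def pscale_def fun_eq_iff algebra_simps)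

lemma dim_pscale_syz:
  fixes B :: "('k::field_char_0 ^ 3) set set"
  assumes "p \<noteq> 0"
  shows "kV.dim ((\<lambda>v. pscale p v) ` (syz B \<inter> vforms m)) = kV.dim (syz B \<inter> vforms m)"
proof -
  obtain G :: "(3 \<Rightarrow> 'k poly3) set" where G: "finite G" "vforms m \<subseteq> kV.span G"
    using vforms_finite_span by blast
  show ?thesis
    by (rule kVV.dim_image_inj[OF linear_pscale subspace_syz _ G(1)])
      (use G(2) assms in \<open>auto simp: pscale_def fun_eq_iff\<close>)
qed

lemma subspace_pscale_syz: "kV.subspace ((\<lambda>v. pscale p v) ` (syz B \<inter> vforms m))"
proof -
  interpret Vector_Spaces.linear kvscale kvscale "\<lambda>v. pscale p v" by (rule linear_pscale)
  show ?thesis by (rule subspace_image[OF subspace_syz])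
qed

lemma two_forms_at_point:
  fixes x :: "3 \<Rightarrow> 'k::field_char_0"
  assumes "x i \<noteq> 0"
  shows "\<exists>a b. a \<noteq> 0 \<and> b \<noteq> 0 \<and> plane a \<noteq> plane b \<and> ev x (linear_form a) = 0 \<and> ev x (linear_form b) = 0"
proof -
  obtain j l :: 3 where jl: "i \<noteq> j" "j \<noteq> l" "i \<noteq> l"
  proof -
    have "\<exists>j l :: 3. i \<noteq> j \<and> j \<noteq> l \<and> i \<noteq> l"
    proof -
      have "(2::3) \<noteq> 1" "(3::3) \<noteq> 1" "(3::3) \<noteq> 2" by simp_all
      then show ?thesis using exhaust_3[of i] by metis
    qed
    then show ?thesis using that by blast
  qed
  \<comment> \<open>The forms x_i X_j - x_j X_i and x_i X_l - x_l X_i in the variables X vanish at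
    x; they are not proportional since X_j and X_l occur in one each, with coefficient x_i.\<close>
  define a where "a = axis j (x i) - axis i (x j)"
  define b where "b = axis l (x i) - axis i (x l)"
  have aj: "a $ j = x i" and al: "a $ l = 0" and bl: "b $ l = x i"
    using jl by (auto simp: a_def b_def axis_def)
  have a0: "a \<noteq> 0" and b0: "b \<noteq> 0" using aj bl assms by auto
  have "plane a \<noteq> plane b"
  proof
    assume "plane a = plane b"
    then obtain c where "b = c *s a" using plane_subset[OF a0, of b] by auto
    then have "b $ l = c * a $ l" by simp
    then show False using al bl assms by simp
  qed
  have ev: "ev x (linear_form c) = dot c (\<chi> i. x i)" for c
    using ev_linear_form[of "\<chi> i. x i" c] by simp
  have dc: "dot c d = dot d c" for c d :: "'k ^ 3" by (simp add: dot_def mult.commute)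
  have "ev x (linear_form a) = 0" "ev x (linear_form b) = 0"
    unfolding ev dc[of _ "\<chi> i. x i"] a_def b_def dot_diff_right dot_axis by simp_all
  then show ?thesis using a0 b0 \<open>plane a \<noteq> plane b\<close> by blast
qed

text \<open>If \<open>l\<close>, \<open>k\<close> are linear forms vanishing at a point \<open>x\<close>, then syzygies that are linearly independent
  at \<open>x\<close> remain so modulo \<open>l M + k M\<close>.\<close>

lemma hilbert_convex:
  fixes B :: "('k::field_char_0 ^ 3) set set"
  assumes v: "v \<in> syz B \<inter> vforms a" and w: "w \<in> syz B \<inter> vforms b" and nz: "det3 Var v w \<noteq> 0"
    and m: "a \<le> m" "b \<le> m" "2 \<le> m"
  shows "kV.dim (syz B \<inter> vforms m) + kV.dim (syz B \<inter> vforms (m - 2)) \<ge> 2 + 2 * kV.dim (syz B \<inter> vforms (m - 1))"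
proof -
  obtain x where x: "ev x (det3 Var v w) \<noteq> 0" using exists_point_not_root[OF nz] by blast
  have ev: "ev x (det3 Var v w) = det3 x (\<lambda>i. ev x (v i)) (\<lambda>i. ev x (w i))"
    by (simp add: det3_def ev.hom_add ev.hom_mult ev.hom_minus)
  have "\<exists>i. x i \<noteq> 0"
  proof (rule ccontr)
    assume "\<not> ?thesis"
    then have "x = (\<lambda>_. 0)" by auto
    then show False using x unfolding ev by (simp add: det3_def)
  qed
  then obtain i where i: "x i \<noteq> 0" by blast
  obtain c d where cd: "c \<noteq> 0" "d \<noteq> 0" "plane c \<noteq> plane d" "ev x (linear_form c) = 0" "ev x (linear_form d) = 0"
    using two_forms_at_point[of x i, OF i] by blast
  let ?l = "linear_form c" and ?k = "linear_form d"
  have l0: "?l \<noteq> 0" "?k \<noteq> 0" using cd by (simp_all add: linear_form_eq_0)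
  let ?M = "\<lambda>m. syz B \<inter> vforms m"
  obtain G :: "(3 \<Rightarrow> 'k poly3) set" where G: "finite G" "vforms m \<subseteq> kV.span G"
    using vforms_finite_span by blast
  let ?S = "(\<lambda>v. pscale ?l v) ` ?M (m - 1)" and ?T = "(\<lambda>v. pscale ?k v) ` ?M (m - 1)"
  have sub: "(\<lambda>v. pscale (linear_form e) v) ` ?M (m - 1) \<subseteq> ?M m" for e
  proof -
    have "pscale (linear_form e) v \<in> vforms m" if "v \<in> vforms (m - 1)" for v
      using vforms_pscale[OF homogeneous_linear_form that, of e] m by simp
    then show ?thesis using syz_pscale by blast
  qed
  \<comment> \<open>Coprimality of l and k makes a common multiple divisible by lk, and a vector is
    a syzygy once a nonzero multiple of it is one. So the sum lM + kM has dimension 2 h(m-1) -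
    h(m-2) in degree m.\<close>
  have ST: "?S \<inter> ?T = (\<lambda>v. pscale (?l * ?k) v) ` ?M (m - 2)"
  proof
    show "?S \<inter> ?T \<subseteq> (\<lambda>v. pscale (?l * ?k) v) ` ?M (m - 2)"
    proof
      fix z assume "z \<in> ?S \<inter> ?T"
      then have "z \<in> ?S" "z \<in> ?T" by (rule IntD1, rule IntD2)
      then obtain s t where s: "s \<in> ?M (m - 1)" "z = pscale ?l s" and t: "z = pscale ?k t" by blast
      have "?k dvd s h" for h
      proof -
        have "?l * s h = ?k * t h" using s(2) t by (metis pscale_def)
        then have "?k dvd ?l * s h" by simp
        moreover have "\<not> ?k dvd ?l"
        proof
          assume "?k dvd ?l"
          then obtain e where e: "c = e *s d" using linear_form_dvd[OF cd(2)] by blast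
          then have "e \<noteq> 0" using cd(1) by auto
          then show False using e plane_scale cd(3) by metis
        qed
        ultimately show ?thesis using prime_elem_dvd_multD[OF prime_linear_form[OF cd(2)]] by blast
      qed
      then have "\<forall>h. \<exists>y. s h = ?k * y" by blast
      then obtain y where y: "\<And>h. s h = ?k * y h" by metis
      have sy: "s = pscale ?k y" by (rule ext) (simp add: pscale_def y)
      have "y \<in> syz B" using syz_cancel[OF l0(2), of y] s(1) sy by blast
      moreover have "homogeneous (m - 2) (y h)" for h
      proof -
        have "Suc 0 + (m - 2) = m - 1" using m by simp
        then have "homogeneous (Suc 0 + (m - 2)) (?k * y h)" using s(1) y by (auto simp: vforms_def)
        then show ?thesis by (rule homogeneous_cancel[OF homogeneous_linear_form l0(2)])
      qed
      moreover have "z = pscale (?l * ?k) y" unfolding s(2) sy by (simp add: pscale_def mult.assoc)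
      ultimately show "z \<in> (\<lambda>v. pscale (?l * ?k) v) ` ?M (m - 2)" by (auto simp: vforms_def)
    qed
    show "(\<lambda>v. pscale (?l * ?k) v) ` ?M (m - 2) \<subseteq> ?S \<inter> ?T"
    proof
      fix z assume "z \<in> (\<lambda>v. pscale (?l * ?k) v) ` ?M (m - 2)"
      then obtain y where y: "y \<in> ?M (m - 2)" "z = pscale (?l * ?k) y" by blast
      have "pscale (linear_form e) y \<in> ?M (m - 1)" for e
      proof -
        have "Suc 0 + (m - 2) = m - 1" using m by simp
        then show ?thesis using vforms_pscale[OF homogeneous_linear_form, of y "m - 2" e] y(1) syz_pscale by auto
      qed
      moreover have "z = pscale ?l (pscale ?k y)" "z = pscale ?k (pscale ?l y)"
        unfolding y(2) by (simp_all add: pscale_def mult_ac)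
      ultimately show "z \<in> ?S \<inter> ?T" by blast
    qed
  qed
  let ?U = "{s + t |s t. s \<in> ?S \<and> t \<in> ?T}"
  have "kV.dim ?U + kV.dim (?S \<inter> ?T) = kV.dim ?S + kV.dim ?T"
    by (rule kV.dim_sum_inter[OF subspace_pscale_syz _ G(1) subspace_pscale_syz]) (use sub[of c] sub[of d] G(2) in auto)
  then have dU: "kV.dim ?U + kV.dim (?M (m - 2)) = 2 * kV.dim (?M (m - 1))"
    unfolding ST using dim_pscale_syz[of "?l * ?k" B "m - 2"] dim_pscale_syz[OF l0(1), of B "m - 1"]
      dim_pscale_syz[OF l0(2), of B "m - 1"] l0 by simp
  \<comment> \<open>The syzygies vanishing at x contain lM + kM. It remains to show that they have
    codimension at least 2 in degree m.\<close>
  let ?K = "{z \<in> ?M m. \<forall>h. ev x (z h) = 0}"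
  have "kV.subspace {z :: 3 \<Rightarrow> 'k poly3. \<forall>h. ev x (z h) = 0}"
    unfolding kV.subspace_def by (auto simp: kvscale_def pscale_def ev.hom_add ev.hom_mult)
  from kV.subspace_inter[OF subspace_syz[of B m] this]
  have "kV.subspace (?M m \<inter> {z. \<forall>h. ev x (z h) = 0})" .
  moreover have "?M m \<inter> {z. \<forall>h. ev x (z h) = 0} = ?K" by blast
  ultimately have K: "kV.subspace ?K" by (simp only:)
  have UK: "?U \<subseteq> ?K"
  proof
    fix z assume "z \<in> ?U"
    then obtain s t where st: "z = pscale ?l s + pscale ?k t" "s \<in> ?M (m - 1)" "t \<in> ?M (m - 1)" by blast
    have "z \<in> ?M m"
      unfolding st(1) by (rule kV.subspace_add[OF subspace_syz]) (use sub[of c] sub[of d] st(2,3) in blast)+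
    moreover have "ev x (z h) = 0" for h
      unfolding st(1) by (simp add: pscale_def ev.hom_add ev.hom_mult cd)
    ultimately show "z \<in> ?K" by blast
  qed
  have KG: "?K \<subseteq> kV.span G" using G(2) by blast
  obtain C where C: "{} \<subseteq> C" "C \<subseteq> ?K" "kV.independent C" "?K \<subseteq> kV.span C" "finite C" "card C = kV.dim ?K"
    by (rule kV.finite_basis_extend[OF empty_subsetI kV.independent_empty KG G(1)])
  have CK: "kV.span C \<subseteq> ?K" by (rule kV.span_minimal[OF C(2) K])
  \<comment> \<open>Multiplication by powers of a variable that is nonzero at x raises v and w to
    degree m without losing their independence at x.\<close>
  let ?v = "pscale (Var i ^ (m - a)) v" and ?w = "pscale (Var i ^ (m - b)) w"
  have hx: "homogeneous n (Var i ^ n)" for n using homogeneous_power[OF homogeneous_Var, of n i] by simp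
  have vM: "?v \<in> ?M m" and wM: "?w \<in> ?M m"
    using v w syz_pscale vforms_pscale[OF hx, of v a "m - a"] vforms_pscale[OF hx, of w b "m - b"] m by auto
  have evv: "ev x (?v h) = x i ^ (m - a) * ev x (v h)" "ev x (?w h) = x i ^ (m - b) * ev x (w h)" for h
    by (simp_all add: pscale_def ev.hom_mult ev.hom_power)
  have v1: "?v \<notin> kV.span C"
  proof
    assume "?v \<in> kV.span C"
    then have "\<forall>h. ev x (?v h) = 0" using CK by blast
    then have "ev x (v h) = 0" for h using i unfolding evv by simp
    then show False using x unfolding ev by (simp add: det3_def)
  qed
  have w1: "?w \<notin> kV.span (insert ?v C)"
  proof
    assume "?w \<in> kV.span (insert ?v C)"
    then obtain k where "?w - kvscale k ?v \<in> kV.span C" unfolding kV.span_breakdown_eq by blast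
    then have "\<forall>h. ev x ((?w - kvscale k ?v) h) = 0" using CK by blast
    then have "ev x (?w h) = k * ev x (?v h)" for h
      by (simp add: kvscale_def pscale_def ev.hom_minus ev.hom_mult mult.assoc)
    then have wv: "x i ^ (m - b) * ev x (w h) = k * x i ^ (m - a) * ev x (v h)" for h
      unfolding evv by simp
    have "x i ^ (m - b) * det3 x (\<lambda>i. ev x (v i)) (\<lambda>i. ev x (w i)) =
        det3 x (\<lambda>i. ev x (v i)) (\<lambda>h. x i ^ (m - b) * ev x (w h))"
      by (simp add: det3_def algebra_simps)
    also have "\<dots> = 0" unfolding wv by (simp add: det3_def algebra_simps)
    finally show False using i x unfolding ev by simp
  qed
  have ind: "kV.independent (insert ?w (insert ?v C))"
    by (intro kV.independent_insertI w1 v1 C(3))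
  have "?v \<notin> C" "?w \<notin> insert ?v C" using v1 w1 kV.span_base by blast+
  then have "card (insert ?w (insert ?v C)) = 2 + kV.dim ?K" using C(5,6) by simp
  then have "2 + kV.dim ?K = kV.dim (insert ?w (insert ?v C))"
    using kV.dim_eq_card_independent[OF ind] by simp
  also have "\<dots> \<le> kV.dim (?M m)"
    by (rule kV.dim_mono_finite[OF _ _ G(1)]) (use vM wM C(2) G(2) in auto)
  finally have "2 + kV.dim ?K \<le> kV.dim (?M m)" .
  moreover have "kV.dim ?U \<le> kV.dim ?K" by (rule kV.dim_mono_finite[OF UK KG G(1)])
  ultimately show ?thesis using dU by linarith
qed

text \<open>A syzygy v of least degree is primitive, since dividing by a common factor would lower
  the degree. Every w proportional to v is then g v with g of degree n - a.\<close>

lemma hilbert_rank_one: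
  fixes B :: "('k::field_char_0 ^ 3) set set"
  assumes B: "arrangement B" "card B > 0"
    and v: "v \<in> syz B \<inter> vforms a" "v \<noteq> 0" and an: "a \<le> n"
    and min: "\<And>a' v'. a' < a \<Longrightarrow> v' \<in> syz B \<inter> vforms a' \<Longrightarrow> v' = 0"
    and dep: "\<And>w. w \<in> syz B \<inter> vforms n \<Longrightarrow> det3 Var v w = 0"
  shows "kV.dim (syz B \<inter> vforms n) \<le> rdim (n - a)"
proof -
  obtain i where i: "v i \<noteq> 0" using v(2) by (auto simp: fun_eq_iff)
  have prim: "p dvd 1" if p: "\<And>h. p dvd v h" for p
  proof -
    have "\<forall>h. \<exists>y. v h = p * y" using p by blast
    then obtain v' where v': "\<And>h. v h = p * v' h" by metis
    have vv: "v = pscale p v'" by (rule ext) (simp add: pscale_def v')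
    have p0: "p \<noteq> 0" using i v' by auto
    have sv: "v' \<in> syz B" using syz_cancel[OF p0, of v'] v(1) vv by blast
    have "v' i \<noteq> 0" using i v' by auto
    \<comment> \<open>The quotient v' is not known to be homogeneous. A nonzero component of it is
      again a syzygy, so its degree is at least a by minimality, while p v'_i has degree a; this
      leaves only a constant p.\<close>
    then obtain n' where n': "hc n' (v' i) \<noteq> 0" using eq_0_if_hc by blast
    have "vhc n' v' \<in> syz B \<inter> vforms n'" using syz_vhc[OF sv] B by (simp add: arrangement_def)
    moreover have "vhc n' v' \<noteq> 0" using n' by (auto simp: vhc_def fun_eq_iff)
    ultimately have "a \<le> n'" using min[of n' "vhc n' v'"] by (meson not_le)
    moreover have "homogeneous a (p * v' i)" unfolding v'[symmetric] using v(1) by (simp add: vforms_def)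
    ultimately obtain c where c: "p = Const c" using homogeneous_factor_const[OF _ n' _ p0] by blast
    then have "c \<noteq> 0" using p0 by auto
    then show ?thesis using Const_inverse[of c] c by (metis dvd_triv_right)
  qed
  have sub: "syz B \<inter> vforms n \<subseteq> (\<lambda>g. pscale g v) ` forms (n - a)"
  proof
    fix w assume w: "w \<in> syz B \<inter> vforms n"
    have "v h * w j = v j * w h" for h j
      using det3_syz_eq_0[OF B _ _ dep[OF w]] v(1) w by blast
    then have e: "v i * w j = w i * v j" for j by (metis mult.commute)
    have "v i dvd w i" by (rule primitive_dvd[OF i e prim])
    then obtain g where g: "w i = v i * g" by blast
    have "w j = g * v j" for j
      using e[of j] i unfolding g by (simp add: mult.assoc)
    then have "w j = v j * g" for j by (simp add: mult.commute)
    moreover have "hc n (v j * g) = v j * hc (n - a) g" for j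
      using v(1) an by (subst hc_mult_left[of a]) (auto simp: vforms_def)
    moreover have "hc n (w j) = w j" for j using w by (simp add: vforms_def hc_homogeneous[of n])
    ultimately have "w j = v j * hc (n - a) g" for j by metis
    then have "w = pscale (hc (n - a) g) v" by (simp add: fun_eq_iff pscale_def mult.commute)
    then show "w \<in> (\<lambda>g. pscale g v) ` forms (n - a)" by (rule image_eqI) (simp add: forms_def)
  qed
  obtain F :: "'k poly3 set" where F: "finite F" "forms (n - a) \<subseteq> kR.span F"
    using forms_finite_span by blast
  have lin: "Vector_Spaces.linear kscale kvscale (\<lambda>g. pscale g v)"
    by unfold_locales (auto simp: kscale_def kvscale_def pscale_def fun_eq_iff algebra_simps)
  have "kV.dim ((\<lambda>g. pscale g v) ` forms (n - a)) = kR.dim (forms (n - a) :: 'k poly3 set)"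
    by (rule kRV.dim_image_inj[OF lin subspace_forms F(2,1)]) (use i in \<open>auto simp: pscale_def fun_eq_iff\<close>)
  moreover have "kV.dim (syz B \<inter> vforms n) \<le> kV.dim ((\<lambda>g. pscale g v) ` forms (n - a))"
  proof (rule kV.dim_mono_finite[OF sub])
    interpret Vector_Spaces.linear kscale kvscale "\<lambda>g. pscale g v" by (rule lin)
    show "(\<lambda>g. pscale g v) ` forms (n - a) \<subseteq> kV.span ((\<lambda>g. pscale g v) ` F)" by (rule spans_image[OF F(2)])
    show "finite ((\<lambda>g. pscale g v) ` F)" using F(1) by simp
  qed
  ultimately show ?thesis by (simp add: dim_forms)
qed

lemma two_rdim_int: "2 * int (rdim n) = (int n + 1) * (int n + 2)"
  using arg_cong[OF two_rdim[of n], of int] by (simp add: algebra_simps)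

lemma rdim_mono: "m \<le> n \<Longrightarrow> rdim m \<le> rdim n"
  unfolding rdim_def by (intro div_le_mono mult_le_mono) auto

text \<open>Differences that do not decrease and are eventually 0 are never positive, so u decreases
  weakly from n on to its final value k. The hypothesis at m = n + 1 is the one that involves the
  first difference u(n+1) - u(n).\<close>

lemma convex_eventually_const:
  fixes u :: "nat \<Rightarrow> int"
  assumes conv: "\<And>m. m \<ge> Suc n \<Longrightarrow> u (Suc m) - u m \<ge> u m - u (m - 1)"
    and const: "\<And>m. m \<ge> N \<Longrightarrow> u m = k"
  shows "u n \<ge> k"
proof -
  have D: "u (Suc m) - u m \<le> u (Suc (m + j)) - u (m + j)" if "m \<ge> n" for m j
  proof (induction j)
    case (Suc j)
    have "u (Suc (Suc (m + j))) - u (Suc (m + j)) \<ge> u (Suc (m + j)) - u (m + j)"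
      using conv[of "Suc (m + j)"] that by simp
    then show ?case using Suc by simp
  qed simp
  have step: "u (Suc m) \<le> u m" if "m \<ge> n" for m
  proof -
    have "u (Suc (m + N)) - u (m + N) = 0" using const[of "m + N"] const[of "Suc (m + N)"] by simp
    then show ?thesis using D[OF that, of N] by simp
  qed
  have "u (n + j) \<le> u n" for j
  proof (induction j)
    case (Suc j)
    then show ?case using step[of "n + j"] by simp
  qed simp
  from this[of N] show ?thesis using const[of "n + N"] by simp
qed

lemma exists_two_syz:
  fixes B :: "('k::field_char_0 ^ 3) set set"
  assumes B: "arrangement B" "card B = 2 * e + 1" and e: "e \<ge> 1"
    and low: "\<And>a v. a < e \<Longrightarrow> v \<in> syz B \<inter> vforms a \<Longrightarrow> v = 0"
    and \<kappa>: "\<And>m. m > card B \<Longrightarrow> int (kV.dim (syz B \<inter> vforms m)) = 2 * int (rdim (m - e)) + \<kappa>" "\<kappa> \<ge> 0"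
  shows "\<exists>v\<in>syz B \<inter> vforms e. \<exists>w\<in>syz B \<inter> vforms e. det3 Var v w \<noteq> 0"
proof -
  let ?M = "\<lambda>m. syz B \<inter> vforms m" and ?h = "\<lambda>m. kV.dim (syz B \<inter> vforms m)"
  have d: "card B > 0" using B by simp
  \<comment> \<open>The determinant with the Euler field tests independence over R: by
    \<open>det3_syz_eq_0\<close> its vanishing makes v and w proportional.\<close>
  define P where "P b \<longleftrightarrow> (\<exists>i j v w. i \<le> b \<and> j \<le> b \<and> v \<in> ?M i \<and> w \<in> ?M j \<and> det3 Var v w \<noteq> 0)" for b
  \<comment> \<open>The syzygies \<open>koszul B i\<close> have degree d and rank two, so some b
    exists.\<close>
  have "P (card B)"
  proof -
    obtain i where "det3 Var (koszul B 1) (koszul B i) \<noteq> 0"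
      using exists_independent_syz[OF B(1) d koszul_syz exists_koszul_neq_0[OF B(1) d]] by blast
    then show ?thesis unfolding P_def using koszul_syz koszul_vforms[OF d] by blast
  qed
  define b where "b = (LEAST b. P b)"
  have Pb: "P b" unfolding b_def using \<open>P (card B)\<close> by (rule LeastI)
  have Pmin: "\<not> P b'" if "b' < b" for b' using that unfolding b_def by (rule not_less_Least)
  obtain i j v w where ij: "i \<le> b" "j \<le> b" "v \<in> ?M i" "w \<in> ?M j" "det3 Var v w \<noteq> 0"
    using Pb unfolding P_def by blast
  have "v \<noteq> 0" "w \<noteq> 0" using ij(5) det3_0 by metis+
  then have ie: "i \<ge> e" and je: "j \<ge> e" using low ij(3,4) not_le by blast+
  show ?thesis
  proof (cases "b = e")
    case True
    then have "i = e" "j = e" using ij ie je by auto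
    then show ?thesis using ij by blast
  next
    case False
    then obtain n where n: "b = Suc n" "n \<ge> e" using ij ie by (cases b) auto
    \<comment> \<open>The subtracted term is 2 dim R_{m-e} as an integer polynomial in m. Its second
      difference is exactly 2, matching the lower bound for h, and no truncated m - e
      interferes.\<close>
    define u where "u m = int (?h m) - (int m - int e + 1) * (int m - int e + 2)" for m
    have u: "u m = int (?h m) - 2 * int (rdim (m - e))" if "m \<ge> e" for m
    proof -
      define k where "k = m - e"
      have k: "m = e + k" using that by (simp add: k_def)
      have "int m - int e = int k" "m - e = k" by (simp_all add: k)
      then show ?thesis unfolding u_def by (simp only: two_rdim_int)
    qed
    have conv: "u (Suc m) - u m \<ge> u m - u (m - 1)" if "m \<ge> Suc n - 1" "m \<ge> 1" for m
    proof -
      have "?h (Suc m) + ?h (Suc m - 2) \<ge> 2 + 2 * ?h (Suc m - 1)"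
      proof (rule hilbert_convex[OF ij(3,4,5), of "Suc m"])
        show "i \<le> Suc m" "j \<le> Suc m" using ij(1,2) n(1) that(1) by simp_all
        show "2 \<le> Suc m" using that(2) by simp
      qed
      then have "int (?h (Suc m)) + int (?h (m - 1)) \<ge> 2 + 2 * int (?h m)" by simp
      moreover have "int (m - 1) = int m - 1" using that by simp
      ultimately show ?thesis unfolding u_def by (simp add: algebra_simps)
    qed
    have "u n \<ge> \<kappa>"
    proof (rule convex_eventually_const)
      show "u (Suc m) - u m \<ge> u m - u (m - 1)" if "m \<ge> Suc n" for m
        by (rule conv) (use that in auto)
      show "u m = \<kappa>" if "m \<ge> Suc (card B)" for m
        using u[of m] \<kappa>(1)[of m] that B(2) by simp
    qed
    then have hn: "?h n \<ge> 2 * rdim (n - e)" using u[OF n(2)] \<kappa>(2) by simp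
    have rpos: "rdim (n - e) > 0" using two_rdim[of "n - e"] by (metis add_is_0 gr0I mult_is_0 nat_mult_eq_1_iff one_neq_zero zero_neq_numeral)
    show ?thesis
    proof (cases "\<exists>a v. a \<le> n \<and> v \<in> ?M a \<and> v \<noteq> 0")
      case True
      define a where "a = (LEAST a. \<exists>v. v \<in> ?M a \<and> v \<noteq> 0)"
      obtain a0 v0 where a0: "a0 \<le> n" "v0 \<in> ?M a0" "v0 \<noteq> 0" using True by blast
      then have "\<exists>v. v \<in> ?M a0 \<and> v \<noteq> 0" by blast
      then have "a \<le> a0" unfolding a_def by (rule Least_le)
      have "\<exists>v. v \<in> ?M a \<and> v \<noteq> 0"
        unfolding a_def by (rule LeastI[of "\<lambda>a. \<exists>v. v \<in> ?M a \<and> v \<noteq> 0"]) fact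
      then obtain z where z: "z \<in> ?M a" "z \<noteq> 0" by blast
      have an: "a \<le> n" using \<open>a \<le> a0\<close> a0(1) by simp
      have min: "v' = 0" if "a' < a" "v' \<in> ?M a'" for a' v'
        using not_less_Least[OF that(1)[unfolded a_def]] that(2) by blast
      \<comment> \<open>Two independent syzygies of degree at most n = b - 1 would contradict the
        minimality of b.\<close>
      have dep: "det3 Var z w = 0" if "w \<in> ?M n" for w
        using Pmin[of n] n(1) z(1) an that unfolding P_def by blast
      \<comment> \<open>This gives h(n) <= dim R_{n-e}, against h(n) >= 2 dim R_{n-e} > 0 from
        convexity.\<close>
      have "?h n \<le> rdim (n - a)" by (rule hilbert_rank_one[OF B(1) d z an min dep])
      also have "\<dots> \<le> rdim (n - e)" using low[of a z] z by (intro rdim_mono) (meson diff_le_mono2 not_le)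
      finally show ?thesis using hn rpos by simp
    next
      case False
      then have "?M n \<subseteq> {0}" by blast
      then have "?h n = 0" using kV.dim_le_card[of "?M n" "{}"] by simp
      then show ?thesis using hn rpos by simp
    qed
  qed
qed

section \<open>Homogeneous generating sets\<close>

lemma hc_mult_low:
  assumes "\<And>m. m < e \<Longrightarrow> hc m q = 0" "m < e"
  shows "hc m (p * q) = 0"
proof -
  have "hc m (p * q) = hc m ((\<Sum>j\<in>tdeg ` keys p. hc j p) * q)" by (simp add: sum_hc)
  also have "\<dots> = (\<Sum>j\<in>tdeg ` keys p. hc m (hc j p * q))" by (simp add: sum_distrib_right hc_sum)
  also have "\<dots> = 0"
    by (intro sum.neutral ballI) (use assms in \<open>simp add: hc_mult_left[OF homogeneous_hc]\<close>)
  finally show ?thesis .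
qed

lemma der_homogeneous_iff: "der_homogeneous m (der v) \<longleftrightarrow> v \<in> vforms m"
  by (simp add: der_homogeneous_def vforms_def)

definition lower_syz :: "('k::field_char_0 ^ 3) set set \<Rightarrow> nat \<Rightarrow> (3 \<Rightarrow> 'k poly3) set" where
  "lower_syz B m = syz B \<inter> vforms m \<inter> pmod.span (\<Union>j<m. syz B \<inter> vforms j)"

lemma kspan_subset_span: "kV.span S \<subseteq> pmod.span S"
proof (rule kV.span_minimal)
  show "kV.subspace (pmod.span S)"
    unfolding kV.subspace_def kvscale_def
    by (blast intro: pmod.span_zero pmod.span_add pmod.span_scale)
qed (rule pmod.span_superset)

text \<open>In each degree \<open>m\<close> take a basis \<open>C\<^sub>m - C'\<^sub>m\<close> of a complement of the syzygies that are combinations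
  of syzygies of lower degree.\<close>

lemma exists_minimal_generators:
  fixes B :: "('k::field_char_0 ^ 3) set set"
  assumes B: "finite B"
  shows "\<exists>G. minimal_homogeneous_generating_set (D0 B) G"
proof -
  let ?V = "\<lambda>m. syz B \<inter> vforms m" and ?L = "lower_syz B"
  have "\<exists>C'. C' \<subseteq> ?L m \<and> kV.independent C' \<and> ?L m \<subseteq> kV.span C'" for m
    using kV.maximal_independent_subset[of "?L m"] by metis
  then obtain C' where C': "\<And>m. C' m \<subseteq> ?L m" "\<And>m. kV.independent (C' m)" "\<And>m. ?L m \<subseteq> kV.span (C' m)" by metis
  have LV: "?L m \<subseteq> ?V m" for m by (auto simp: lower_syz_def)
  have "\<exists>C. C' m \<subseteq> C \<and> C \<subseteq> ?V m \<and> kV.independent C \<and> ?V m \<subseteq> kV.span C" for m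
    using kV.maximal_independent_subset_extend[OF subset_trans[OF C'(1) LV] C'(2)] by metis
  then obtain C where C: "\<And>m. C' m \<subseteq> C m" "\<And>m. C m \<subseteq> ?V m" "\<And>m. kV.independent (C m)" "\<And>m. ?V m \<subseteq> kV.span (C m)" by metis
  define G where "G = (\<Union>m. C m - C' m)"
  have VG: "?V m \<subseteq> pmod.span G" for m
  proof (induction m rule: less_induct)
    case (less m)
    have "C' m \<subseteq> pmod.span (\<Union>j<m. ?V j)" using C'(1) by (auto simp: lower_syz_def)
    also have "\<dots> \<subseteq> pmod.span G" by (rule pmod.span_minimal) (use less in auto)
    finally have 1: "C' m \<subseteq> pmod.span G" .
    have "C m - C' m \<subseteq> pmod.span G" using pmod.span_superset[of G] by (auto simp: G_def)
    then have "C m \<subseteq> pmod.span G" using 1 by blast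
    then have "pmod.span (C m) \<subseteq> pmod.span G" by (rule pmod.span_minimal) simp
    then show ?case using C(4)[of m] kspan_subset_span[of "C m"] by blast
  qed
  have sub: "pmod.subspace (syz B)"
    unfolding pmod.subspace_def by (blast intro: syz_0 syz_add syz_pscale)
  have GV: "G \<subseteq> syz B" using C(2) by (auto simp: G_def)
  have span: "pmod.span G = syz B"
  proof
    show "pmod.span G \<subseteq> syz B" by (rule pmod.span_minimal[OF GV sub])
    show "syz B \<subseteq> pmod.span G"
    proof
      fix v assume v: "v \<in> syz B"
      have "vhc n v \<in> pmod.span G" for n using VG[of n] syz_vhc[OF v B, of n] by auto
      then have "(\<Sum>n\<in>(\<Union>i. tdeg ` keys (v i)). vhc n v) \<in> pmod.span G" by (intro pmod.span_sum) auto
      then show "v \<in> pmod.span G" using vec_eq_sum_vhc[of v] by simp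
    qed
  qed
  have notin: "g \<notin> pmod.span (G - {g})" if g: "g \<in> G" for g
  proof
    assume gs: "g \<in> pmod.span (G - {g})"
    obtain m where m: "g \<in> C m - C' m" using g by (auto simp: G_def)
    let ?W = "kV.span (C' m \<union> (C m - C' m - {g}))"
    have LW: "?L m \<subseteq> ?W" using C'(3)[of m] kV.span_mono[of "C' m" "C' m \<union> (C m - C' m - {g})"] by blast
    \<comment> \<open>In degree m a generator of higher degree contributes nothing, one of degree m
      only constant multiples of itself, and one of lower degree an element of
      \<open>lower_syz B m\<close>. So the degree m part of any combination of the other generators
      lies in W.\<close>
    have "vhc m w \<in> ?W" if "w \<in> pmod.span (G - {g})" for w
      using that
    proof (induction rule: pmod.span_induct_alt)
      case base
      have "vhc m 0 = (0 :: 3 \<Rightarrow> 'k poly3)" by (simp add: vhc_def fun_eq_iff)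
      then show ?case using kV.span_zero by metis
    next
      case (step c x y)
      then obtain j where j: "x \<in> C j - C' j" "x \<noteq> g" by (auto simp: G_def)
      then have xV: "x \<in> ?V j" using C(2) by blast
      have hx: "hc m (c * x i) = (if j \<le> m then hc (m - j) c * x i else 0)" for i
        using xV by (subst mult.commute, subst hc_mult_left[of j]) (auto simp: vforms_def mult.commute)
      have "vhc m (pscale c x) \<in> ?W"
      proof (cases "j \<le> m")
        case False
        then have "vhc m (pscale c x) = 0" by (simp add: vhc_def pscale_def hx fun_eq_iff)
        then show ?thesis using kV.span_zero by metis
      next
        case True
        then have e: "vhc m (pscale c x) = pscale (hc (m - j) c) x" by (simp add: vhc_def pscale_def hx fun_eq_iff)
        show ?thesis
        proof (cases "j = m")
          case True
          have "homogeneous 0 (hc 0 c)" by (rule homogeneous_hc)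
          then obtain a where "hc 0 c = Const a" unfolding homogeneous_0_iff by blast
          then have "vhc m (pscale c x) = kvscale a x" using e True by (simp add: kvscale_def)
          moreover have "x \<in> ?W" using j True by (intro kV.span_base) auto
          ultimately show ?thesis using kV.span_scale by metis
        next
          case False
          then have "j < m" using True by simp
          then have "x \<in> pmod.span (\<Union>j<m. ?V j)" using xV by (intro pmod.span_base) blast
          then have "pscale (hc (m - j) c) x \<in> pmod.span (\<Union>j<m. ?V j)" by (rule pmod.span_scale)
          moreover have "pscale (hc (m - j) c) x \<in> ?V m"
            using xV vforms_pscale[OF homogeneous_hc, of x j "m - j" c] True syz_pscale by auto
          ultimately have "pscale (hc (m - j) c) x \<in> ?L m" by (simp add: lower_syz_def)
          then show ?thesis using LW e by auto
        qed
      qed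
      then show ?case unfolding vhc_plus using step by (intro kV.span_add)
    qed
    from this[OF gs] have "g \<in> ?W" using m C(2)[of m] vhc_vforms[of g m] by auto
    moreover have "C' m \<union> (C m - C' m - {g}) = C m - {g}" using C(1)[of m] m by blast
    ultimately have "g \<in> kV.span (C m - {g})" by simp
    then show False using C(3)[of m] m unfolding kV.dependent_def by blast
  qed
  interpret der: module_hom pscale pscale "der :: (3 \<Rightarrow> 'k poly3) \<Rightarrow> _" by (rule module_hom_der)
  have "minimal_homogeneous_generating_set (D0 B) (der ` G)"
    unfolding minimal_homogeneous_generating_set_def homogeneous_generating_set_def
  proof (intro conjI allI impI notI)
    show "\<forall>\<theta>\<in>der ` G. \<exists>m. der_homogeneous m \<theta>"
      using C(2) by (fastforce simp: G_def der_homogeneous_iff)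
    show "pmod.span (der ` G) = D0 B" unfolding der.span_image span D0_eq ..
    fix G' assume G': "G' \<subset> der ` G" and "(\<forall>\<theta>\<in>G'. \<exists>m. der_homogeneous m \<theta>) \<and> pmod.span G' = D0 B"
    then have sG: "pmod.span G' = D0 B" by simp
    obtain g where g: "g \<in> G" "der g \<notin> G'" using G' by blast
    have "G' \<subseteq> der ` (G - {g})" using G' g by blast
    then have "D0 B \<subseteq> der ` pmod.span (G - {g})"
      unfolding sG[symmetric] der.span_image[symmetric] by (rule pmod.span_mono)
    moreover have "der g \<in> D0 B" using g GV unfolding D0_eq by blast
    ultimately have "g \<in> pmod.span (G - {g})" by (auto simp: der_inject)
    then show False using notin g by blast
  qed
  then show ?thesis by blast
qed

text \<open>Derivations without components of degree below e form a submodule. If it contained G, it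
  would contain v. The conclusion demands a nonzero generator because 0 is homogeneous of every
  degree.\<close>

lemma generator_low_degree:
  fixes B :: "('k::field_char_0 ^ 3) set set"
  assumes G: "homogeneous_generating_set (D0 B) G"
    and v: "v \<in> syz B \<inter> vforms a" "v \<noteq> 0" "a < e"
  shows "\<exists>\<theta>\<in>G. \<exists>m. \<theta> \<noteq> 0 \<and> der_homogeneous m \<theta> \<and> m < e"
proof (rule ccontr)
  assume neg: "\<not> ?thesis"
  let ?T = "{\<theta> :: 'k poly3 \<Rightarrow> 'k poly3. \<forall>m<e. \<forall>i. hc m (\<theta> (Var i)) = 0}"
  have "pmod.subspace ?T"
    unfolding pmod.subspace_def by (auto simp: hc_add pscale_def intro: hc_mult_low)
  moreover have "G \<subseteq> ?T"
  proof (intro subsetI CollectI allI impI)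
    fix \<theta> m i assume \<theta>: "\<theta> \<in> G" and m: "m < e"
    obtain n where n: "der_homogeneous n \<theta>" using G \<theta> unfolding homogeneous_generating_set_def by blast
    show "hc m (\<theta> (Var i)) = 0"
    proof (cases "\<theta> = 0")
      case False
      then have "m \<noteq> n" using neg \<theta> n m by blast
      then show ?thesis using n hc_homogeneous[of n "\<theta> (Var i)" m] by (simp add: der_homogeneous_def)
    qed simp
  qed
  ultimately have "pmod.span G \<subseteq> ?T" by (intro pmod.span_minimal)
  moreover have "der v \<in> pmod.span G" using G v(1) unfolding homogeneous_generating_set_def D0_eq by blast
  ultimately have "hc a (v i) = 0" for i using v(3) by auto
  moreover have "hc a (v i) = v i" for i using v(1) hc_homogeneous[of a "v i" a] by (simp add: vforms_def)
  ultimately show False using v(2) by (simp add: fun_eq_iff)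
qed

lemma generator_high_degree:
  fixes B :: "('k::field_char_0 ^ 3) set set"
  assumes B: "arrangement B" "card B = 2 * e + 1"
    and G: "homogeneous_generating_set (D0 B) G"
    and v: "v \<in> syz B \<inter> vforms a" "v \<noteq> 0" "a < e"
  shows "\<exists>\<theta>\<in>G. \<exists>m. \<theta> \<noteq> 0 \<and> der_homogeneous m \<theta> \<and> m > e"
proof (rule ccontr)
  assume neg: "\<not> ?thesis"
  let ?T = "{\<theta> :: 'k poly3 \<Rightarrow> 'k poly3. det3 Var v (\<lambda>i. \<theta> (Var i)) = 0}"
  have "pmod.subspace ?T"
    unfolding pmod.subspace_def
  proof (intro conjI ballI allI)
    show "0 \<in> ?T" by (simp add: det3_def)
    fix \<theta> \<eta> assume "\<theta> \<in> ?T" "\<eta> \<in> ?T"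
    moreover have "det3 Var v (\<lambda>i. (\<theta> + \<eta>) (Var i)) = det3 Var v (\<lambda>i. \<theta> (Var i)) + det3 Var v (\<lambda>i. \<eta> (Var i))"
      by (simp add: det3_def algebra_simps)
    ultimately show "\<theta> + \<eta> \<in> ?T" by simp
  next
    fix c \<theta> assume "\<theta> \<in> ?T"
    moreover have "det3 Var v (\<lambda>i. pscale c \<theta> (Var i)) = c * det3 Var v (\<lambda>i. \<theta> (Var i))"
      by (simp add: det3_def pscale_def algebra_simps)
    ultimately show "pscale c \<theta> \<in> ?T" by simp
  qed
  moreover have "G \<subseteq> ?T"
  proof (intro subsetI CollectI)
    fix \<theta> assume \<theta>: "\<theta> \<in> G"
    then have "\<theta> \<in> D0 B" using G pmod.span_base unfolding homogeneous_generating_set_def by blast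
    then obtain w where w: "w \<in> syz B" "\<theta> = der w" unfolding D0_eq by blast
    obtain n where n: "der_homogeneous n \<theta>" using G \<theta> unfolding homogeneous_generating_set_def by blast
    show "det3 Var v (\<lambda>i. \<theta> (Var i)) = 0"
    proof (rule ccontr)
      assume nz: "det3 Var v (\<lambda>i. \<theta> (Var i)) \<noteq> 0"
      then have nz': "det3 Var v w \<noteq> 0" by (simp add: w(2))
      have "\<theta> \<noteq> 0" using nz by (auto simp: det3_def)
      then have "n \<le> e" using neg \<theta> n by (meson not_le)
      \<comment> \<open>But a < e and n <= e give a + n + 1 <= 2 e < d.\<close>
      moreover have "card B \<le> Suc (a + n)"
        using det3_syz_degree(1)[OF B(1) v(1) _ nz', of n] w n by (simp add: der_homogeneous_iff)
      ultimately show False using B(2) v(3) by simp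
    qed
  qed
  ultimately have T: "pmod.span G \<subseteq> ?T" by (intro pmod.span_minimal)
  have d: "card B > 0" using B(2) by simp
  obtain i where i: "det3 Var v (koszul B i) \<noteq> 0" using exists_independent_syz[OF B(1) d _ v(2)] v(1) by blast
  have "der (koszul B i) \<in> pmod.span G"
    using G koszul_syz unfolding homogeneous_generating_set_def D0_eq by blast
  then have "det3 Var v (\<lambda>j. der (koszul B i) (Var j)) = 0" using T by blast
  then show False using i by simp
qed

section \<open>Comparison of the Hilbert functions of the two arrangements\<close>

lemma essential_card:
  assumes A: "arrangement A" and ess: "essential A"
  shows "card A \<noteq> 1"
proof
  assume "card A = 1"
  then obtain H where H: "A = {H}" by (auto simp: card_1_singleton_iff)
  then have pl: "is_plane H" using A by (simp add: arrangement_is_plane)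
  let ?a = "normal H"
  have "\<exists>v. v \<noteq> 0 \<and> dot ?a v = 0"
  proof (cases "?a $ 1 = 0")
    case True
    then show ?thesis by (intro exI[of _ "axis 1 1"]) (simp add: dot_axis axis_eq_0_iff)
  next
    case False
    let ?v = "axis 2 (?a $ 1) - axis 1 (?a $ 2) :: 'a ^ 3"
    have "?v $ (2 :: 3) \<noteq> (0 :: 'a ^ 3) $ (2 :: 3)" using False by (simp add: axis_def)
    then have "?v \<noteq> 0" by metis
    moreover have "dot ?a ?v = 0" by (simp add: dot_diff_right dot_axis)
    ultimately show ?thesis by blast
  qed
  then obtain v where "v \<noteq> 0" "v \<in> plane ?a" by (auto simp: plane_dot)
  then show False using ess normal(2)[OF pl] H unfolding essential_def by auto
qed

text \<open>For d = 2 e + 1 the terms 3 dim R_m - dim R_{m-1} - d (m + 1) add up to (m + 1)(m + 2 -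
  2 e), which exceeds 2 dim R_{m-e} = (m - e + 1)(m - e + 2) by e - e^2.\<close>

lemma dim_syz_polynomial:
  assumes B: "arrangement B" "card B = 2 * e + 1" and m: "m > card B"
    and K: "int (kV.dim (log_vf B \<inter> vforms m)) = 3 * int (rdim m) - int (card B) * (int m + 1) + K"
  shows "int (kV.dim (syz B \<inter> vforms m)) = 2 * int (rdim (m - e)) + (K + int e - int e * int e)"
proof -
  have "m = Suc (m - e - 1) + e" using m B(2) by simp
  then obtain k where k: "m = Suc k + e" by blast
  have "kV.dim (log_vf B \<inter> vforms m) = kV.dim (syz B \<inter> vforms m) + rdim (m - 1)"
    by (rule dim_log_vf_eq_syz) (use B m in auto)
  moreover note two_rdim_int[of m] two_rdim_int[of "m - 1"] two_rdim_int[of "m - e"]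
  ultimately have "2 * int (kV.dim (syz B \<inter> vforms m)) = 2 * (2 * int (rdim (m - e)) + (K + int e - int e * int e))"
    using K B(2) by (simp add: k algebra_simps)
  then show ?thesis by simp
qed

theorem theorem5p8:
  fixes A B :: "('k::field_char_0 ^ 3) set set" and d :: nat
  assumes "arrangement A" and "card A = d" and "odd d" and "essential A"
    and "free_module (D A)"
    and "sheaf_iso (der_bundle A) (twist_sq (- int ((d - 1) div 2)))"
    and "arrangement B" and "lattice_iso A B"
    and "\<not> free_module (D B)"
  shows "(\<exists>G. minimal_homogeneous_generating_set (D0 B) G) \<and>
    (\<forall>G. minimal_homogeneous_generating_set (D0 B) G \<longrightarrow>
       (\<exists>\<theta>\<in>G. \<exists>m. \<theta> \<noteq> 0 \<and> der_homogeneous m \<theta> \<and> m < (d - 1) div 2) \<and>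
       (\<exists>\<theta>\<in>G. \<exists>m. \<theta> \<noteq> 0 \<and> der_homogeneous m \<theta> \<and> m > (d - 1) div 2))"
proof -
  define e where "e = (d - 1) div 2"
  have d: "d = 2 * e + 1" using assms(3) by (auto simp: e_def elim: oddE)
  \<comment> \<open>A single plane contains a nonzero vector, so an essential arrangement does not
    consist of one line and d = 1 is excluded.\<close>
  have "e \<noteq> 0" using essential_card[OF assms(1,4)] assms(2) d by simp
  then have e: "e \<ge> 1" by simp
  have cA: "card A = 2 * e + 1" using assms(2) d by simp
  obtain K where cB: "card B = card A" and K: "\<And>m. m > card A \<Longrightarrow>
      int (kV.dim (log_vf A \<inter> vforms m)) = 3 * int (rdim m) - int (card A) * (int m + 1) + K \<and>
      int (kV.dim (log_vf B \<inter> vforms m)) = 3 * int (rdim m) - int (card A) * (int m + 1) + K"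
    using dim_log_vf_lattice[OF assms(1,7,8)] by blast
  let ?k = "K + int e - int e * int e"
  have hA: "int (kV.dim (syz A \<inter> vforms m)) = 2 * int (rdim (m - e)) + ?k" if "m > card A" for m
    by (rule dim_syz_polynomial[OF assms(1) cA that]) (use K[OF that] in simp)
  have hB: "int (kV.dim (syz B \<inter> vforms m)) = 2 * int (rdim (m - e)) + ?k" if "m > card B" for m
    by (rule dim_syz_polynomial[OF assms(7) _ that]) (use K[of m] cA cB that in auto)
  have "?k \<ge> 0"
  proof -
    \<comment> \<open>Any degree beyond d would do for comparing the lower bound with the exact
      formula; this one has m - e = d + 1.\<close>
    have "kV.dim (syz A \<inter> vforms (Suc (card A) + e)) \<ge> 2 * rdim (Suc (card A))"
      by (rule dim_syz_ge) (use assms(6) in \<open>simp add: e_def\<close>)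
    then show ?thesis using hA[of "Suc (card A) + e"] by simp
  qed
  have "\<exists>a v. a < e \<and> v \<in> syz B \<inter> vforms a \<and> v \<noteq> 0"
  proof (rule ccontr)
    assume "\<not> ?thesis"
    then have low: "v = 0" if "a < e" "v \<in> syz B \<inter> vforms a" for a v using that by blast
    have cB': "card B = 2 * e + 1" using cA cB by simp
    have two: "\<exists>v\<in>syz B \<inter> vforms e. \<exists>w\<in>syz B \<inter> vforms e. det3 Var v w \<noteq> 0"
    proof (rule exists_two_syz[OF assms(7) cB' e])
      show "v = 0" if "a < e" "v \<in> syz B \<inter> vforms a" for a v by (rule low[OF that])
      show "int (kV.dim (syz B \<inter> vforms m)) = 2 * int (rdim (m - e)) + ?k" if "m > card B" for m
        by (rule hB[OF that])
      show "?k \<ge> 0" by fact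
    qed
    obtain v w where vw: "v \<in> syz B \<inter> vforms e" "w \<in> syz B \<inter> vforms e" "det3 Var v w \<noteq> 0"
      using two by blast
    \<comment> \<open>The determinant has degree 1 + e + e = d, so it is a constant times Q.\<close>
    obtain c where "c \<noteq> 0" "det3 Var v w = Const c * defining_poly B"
      using det3_syz_degree(2)[OF assms(7) vw] cB' by auto
    then have "free_module (D B)" using Saito[OF assms(7)] vw by blast
    then show False using assms(9) by simp
  qed
  then obtain a v where v: "v \<in> syz B \<inter> vforms a" "v \<noteq> 0" "a < e" by blast
  have "finite B" using assms(7) by (simp add: arrangement_def)
  from exists_minimal_generators[OF this] show ?thesis
    using generator_low_degree[OF _ v] generator_high_degree[OF assms(7) _ _ v] cA cB
    unfolding minimal_homogeneous_generating_set_def e_def[symmetric] by auto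
qed

end
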